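(* Let $n\in\mathbb{N}$, $n\geq 1$. There exists a constant $C\in(0,\infty)$, depending only on $n$, such that for every $f\in BV(\mathbb{H}^n)$, $$\|f\|_{\frac{2n+2}{2n+1}}\leq C\prod_{j=1}^{2n}\|X_jf\|^{\frac{1}{2n}}.$$
   Context: $\mathbb{H}^n$ is identified with $\mathbb{R}^{2n+1}$, with points written $(x,t)=(x_1,\ldots,x_{2n},t)$, equipped with Lebesgue measure. The standard left-invariant horizontal vector fields are $$X_j=\partial_{x_j}-\tfrac{x_{n+j}}{2}\partial_t,\qquad X_{n+j}=\partial_{x_{n+j}}+\tfrac{x_j}{2}\partial_t,\qquad j=1,\ldots,n.$$ $BV(\mathbb{H}^n)$ is the set of functions $f\in L^1(\mathbb{R}^{2n+1})$ such that, for each $j=1,\ldots,2n$, the distributional derivative $X_jf$ is a signed Radon measure on $\mathbb{R}^{2n+1}$ of finite total variation, i.e. there is a finite signed Radon measure $X_jf$ with $\int f\,X_j\varphi\,dp=-\int\varphi\,d(X_jf)$ for all $\varphi\in C_c^\infty(\mathbb{R}^{2n+1})$. The total variation of this measure is denoted $\|X_jf\|$. $\|f\|_p$ denotes the $L^p$ norm with respect to Lebesgue measure on $\mathbb{R}^{2n+1}$. *)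

theory Defs
  imports "HOL-Analysis.Analysis"
begin

section \<open>Test functions\<close>

definition partial_deriv :: "'a::euclidean_space \<Rightarrow> ('a \<Rightarrow> real) \<Rightarrow> 'a \<Rightarrow> real" where
  "partial_deriv v f p = frechet_derivative f (at p) v"

text \<open>A function is \<open>C\<close>-\<open>(k+1)\<close> iff it is differentiable and all its first-order partial
  derivatives are \<open>C\<close>-\<open>k\<close>; the derivatives are then automatically continuous.\<close>

primrec Ck :: "nat \<Rightarrow> ('a::euclidean_space \<Rightarrow> real) \<Rightarrow> bool" where
  "Ck 0 f \<longleftrightarrow> continuous_on UNIV f"
| "Ck (Suc k) f \<longleftrightarrow> (\<forall>p. f differentiable (at p)) \<and> (\<forall>b\<in>Basis. Ck k (partial_deriv b f))"

definition test_functions :: "('a::euclidean_space \<Rightarrow> real) set" where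
  "test_functions = {\<phi>. (\<forall>k. Ck k \<phi>) \<and> compact (closure {p. \<phi> p \<noteq> 0})}"


section \<open>Finite signed measures\<close>

text \<open>A finite signed Borel measure on a Euclidean space is a countably additive real-valued
  function on the Borel sets; it is automatically Radon. Its values on non-Borel sets play no role
  below.\<close>

definition finite_signed_measure :: "('a::euclidean_space set \<Rightarrow> real) \<Rightarrow> bool" where
  "finite_signed_measure \<nu> \<longleftrightarrow> \<nu> {} = 0 \<and>
    (\<forall>A :: nat \<Rightarrow> 'a set. range A \<subseteq> sets borel \<longrightarrow> disjoint_family A \<longrightarrow>
        (\<lambda>i. \<nu> (A i)) sums \<nu> (\<Union>i. A i))"

text \<open>Since \<open>\<nu> {} = 0\<close>, truncating negative values by \<^term>\<open>ennreal\<close> does not change the supremum.\<close>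

definition pos_variation :: "('a::euclidean_space set \<Rightarrow> real) \<Rightarrow> 'a set \<Rightarrow> ennreal" where
  "pos_variation \<nu> A = (SUP B\<in>{B \<in> sets borel. B \<subseteq> A}. ennreal (\<nu> B))"

definition pos_part :: "('a::euclidean_space set \<Rightarrow> real) \<Rightarrow> 'a measure" where
  "pos_part \<nu> = measure_of UNIV (sets borel) (pos_variation \<nu>)"

definition neg_part :: "('a::euclidean_space set \<Rightarrow> real) \<Rightarrow> 'a measure" where
  "neg_part \<nu> = pos_part (\<lambda>A. - \<nu> A)"

definition total_variation :: "('a::euclidean_space set \<Rightarrow> real) \<Rightarrow> ennreal" where
  "total_variation \<nu> = emeasure (pos_part \<nu>) UNIV + emeasure (neg_part \<nu>) UNIV"

definition signed_integral :: "('a::euclidean_space set \<Rightarrow> real) \<Rightarrow> ('a \<Rightarrow> real) \<Rightarrow> real" where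
  "signed_integral \<nu> \<phi> = (\<integral>p. \<phi> p \<partial>pos_part \<nu>) - (\<integral>p. \<phi> p \<partial>neg_part \<nu>)"

lemma sets_pos_part [simp]: "sets (pos_part \<nu>) = sets borel"
  using sets.sets_measure_of_eq[of borel "pos_variation \<nu>"] unfolding pos_part_def space_borel .

lemma space_pos_part [simp]: "space (pos_part \<nu>) = UNIV"
  unfolding pos_part_def by (rule space_measure_of) simp

lemma finite_signed_measure_uminus:
  "finite_signed_measure \<nu> \<Longrightarrow> finite_signed_measure (\<lambda>A. - \<nu> A)"
  by (auto simp: finite_signed_measure_def intro: sums_minus)

lemma finite_signed_measure_Un:
  assumes "finite_signed_measure \<nu>" "A \<in> sets borel" "B \<in> sets borel" "A \<inter> B = {}"
  shows "\<nu> (A \<union> B) = \<nu> A + \<nu> B"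
proof -
  have "(\<lambda>i. \<nu> (binaryset A B i)) sums \<nu> (\<Union>i. binaryset A B i)"
  proof -
    have "range (binaryset A B) \<subseteq> sets borel"
      using assms(2,3) by (simp add: range_binaryset_eq)
    moreover have "disjoint_family (binaryset A B)"
      using assms(4) by (auto simp: disjoint_family_on_def binaryset_def)
    ultimately show ?thesis
      using assms(1) unfolding finite_signed_measure_def by blast
  qed
  moreover have "(\<lambda>i. \<nu> (binaryset A B i)) sums (\<nu> A + \<nu> B)"
    using assms by (intro binaryset_sums) (auto simp: finite_signed_measure_def)
  ultimately show ?thesis
    by (simp add: UN_binaryset_eq sums_unique2)
qed

lemma pos_variation_upper: "B \<in> sets borel \<Longrightarrow> B \<subseteq> A \<Longrightarrow> ennreal (\<nu> B) \<le> pos_variation \<nu> A"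
  unfolding pos_variation_def by (rule SUP_upper) auto

lemma pos_variation_mono: "A \<subseteq> B \<Longrightarrow> pos_variation \<nu> A \<le> pos_variation \<nu> B"
  unfolding pos_variation_def by (rule SUP_subset_mono) auto

lemma pos_variation_empty:
  assumes "finite_signed_measure \<nu>"
  shows "pos_variation \<nu> {} = 0"
proof -
  have "{B \<in> sets borel. B \<subseteq> {}} = {{} :: 'a set}" by auto
  then show ?thesis using assms by (simp add: pos_variation_def finite_signed_measure_def)
qed

lemma pos_variation_superadd:
  assumes \<nu>: "finite_signed_measure \<nu>" and AB: "A \<inter> B = {}"
  shows "pos_variation \<nu> A + pos_variation \<nu> B \<le> pos_variation \<nu> (A \<union> B)"
proof -
  have *: "ennreal (\<nu> S) + ennreal (\<nu> T) \<le> pos_variation \<nu> (A \<union> B)"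
    if S: "S \<in> sets borel" "S \<subseteq> A" and T: "T \<in> sets borel" "T \<subseteq> B" for S T
  proof -
    consider "\<nu> S \<le> 0" | "\<nu> T \<le> 0" | "\<nu> S \<ge> 0" "\<nu> T \<ge> 0" by linarith
    then show ?thesis
    proof cases
      case 1
      have "ennreal (\<nu> T) \<le> pos_variation \<nu> (A \<union> B)"
        using T by (intro pos_variation_upper) auto
      with 1 show ?thesis by (simp add: ennreal_neg)
    next
      case 2
      have "ennreal (\<nu> S) \<le> pos_variation \<nu> (A \<union> B)"
        using S by (intro pos_variation_upper) auto
      with 2 show ?thesis by (simp add: ennreal_neg)
    next
      case 3
      have "S \<inter> T = {}" using S T AB by auto
      then have "\<nu> (S \<union> T) = \<nu> S + \<nu> T"
        using finite_signed_measure_Un[OF \<nu>] S T by auto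
      moreover have "ennreal (\<nu> (S \<union> T)) \<le> pos_variation \<nu> (A \<union> B)"
        using S T by (intro pos_variation_upper) auto
      ultimately show ?thesis using 3 by (simp flip: ennreal_plus)
    qed
  qed
  have ne: "{S \<in> sets borel. S \<subseteq> X} \<noteq> {}" for X :: "'a set" by auto
  have "pos_variation \<nu> A + pos_variation \<nu> B =
      (SUP T\<in>{T \<in> sets borel. T \<subseteq> B}. SUP S\<in>{S \<in> sets borel. S \<subseteq> A}. ennreal (\<nu> S) + ennreal (\<nu> T))"
    unfolding pos_variation_def
    by (simp add: ennreal_SUP_add_right[OF ne] ennreal_SUP_add_left[OF ne])
  also have "\<dots> \<le> pos_variation \<nu> (A \<union> B)"
    using * by (intro SUP_least) auto
  finally show ?thesis .
qed

lemma countably_additive_pos_variation: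
  fixes \<nu> :: "'a::euclidean_space set \<Rightarrow> real"
  assumes \<nu>: "finite_signed_measure \<nu>"
  shows "countably_additive (sets borel) (pos_variation \<nu>)"
proof (rule countably_additiveI)
  fix A :: "nat \<Rightarrow> 'a set"
  assume A: "range A \<subseteq> sets borel" "disjoint_family A"
  show "(\<Sum>i. pos_variation \<nu> (A i)) = pos_variation \<nu> (\<Union>i. A i)"
  proof (rule antisym)
    have fin: "(\<Sum>i<n. pos_variation \<nu> (A i)) \<le> pos_variation \<nu> (\<Union>i<n. A i)" for n
    proof (induction n)
      case 0
      then show ?case by simp
    next
      case (Suc n)
      have "(\<Union>i<n. A i) \<inter> A n = {}"
      proof -
        have "A i \<inter> A n = {}" if "i < n" for i
          using disjoint_family_onD[OF A(2)] that by auto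
        then show ?thesis by blast
      qed
      then have "pos_variation \<nu> (\<Union>i<n. A i) + pos_variation \<nu> (A n)
          \<le> pos_variation \<nu> ((\<Union>i<n. A i) \<union> A n)"
        by (rule pos_variation_superadd[OF \<nu>])
      also have "(\<Union>i<n. A i) \<union> A n = (\<Union>i<Suc n. A i)"
        by (auto simp: lessThan_Suc)
      finally show ?case
        using add_right_mono[OF Suc, of "pos_variation \<nu> (A n)"]
        unfolding sum.lessThan_Suc by (rule order_trans[rotated])
    qed
    have "(\<Sum>i<n. pos_variation \<nu> (A i)) \<le> pos_variation \<nu> (\<Union>i. A i)" for n
      by (rule order_trans[OF fin pos_variation_mono]) auto
    then show "(\<Sum>i. pos_variation \<nu> (A i)) \<le> pos_variation \<nu> (\<Union>i. A i)"
      by (intro suminf_le_const) auto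
  next
    show "pos_variation \<nu> (\<Union>i. A i) \<le> (\<Sum>i. pos_variation \<nu> (A i))"
      unfolding pos_variation_def[of \<nu> "\<Union>i. A i"]
    proof (rule SUP_least)
      fix B assume "B \<in> {B \<in> sets borel. B \<subseteq> (\<Union>i. A i)}"
      then have B: "B \<in> sets borel" "B \<subseteq> (\<Union>i. A i)" by auto
      have BA: "B \<inter> A i \<in> sets borel" for i
        using A(1) B(1) by (intro sets.Int) auto
      have "(\<lambda>i. \<nu> (B \<inter> A i)) sums \<nu> (\<Union>i. B \<inter> A i)"
      proof -
        have "range (\<lambda>i. B \<inter> A i) \<subseteq> sets borel" using BA by auto
        moreover have "disjoint_family (\<lambda>i. B \<inter> A i)"
          using A(2) by (auto simp: disjoint_family_on_def)
        ultimately show ?thesis using \<nu> unfolding finite_signed_measure_def by blast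
      qed
      also have "(\<Union>i. B \<inter> A i) = B" using B by auto
      finally have "(\<lambda>n. ennreal (\<Sum>i<n. \<nu> (B \<inter> A i))) \<longlonglongrightarrow> ennreal (\<nu> B)"
        unfolding sums_def by (rule tendsto_ennrealI)
      moreover have "ennreal (\<Sum>i<n. \<nu> (B \<inter> A i)) \<le> (\<Sum>i. pos_variation \<nu> (A i))" for n
      proof -
        have "ennreal (\<Sum>i<n. \<nu> (B \<inter> A i)) \<le> ennreal (\<Sum>i<n. max 0 (\<nu> (B \<inter> A i)))"
          by (intro ennreal_leI sum_mono) auto
        also have "\<dots> = (\<Sum>i<n. ennreal (max 0 (\<nu> (B \<inter> A i))))"
          by (simp add: sum_ennreal)
        also have "\<dots> \<le> (\<Sum>i<n. pos_variation \<nu> (A i))"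
        proof (rule sum_mono)
          fix i
          have "ennreal (\<nu> (B \<inter> A i)) \<le> pos_variation \<nu> (A i)"
            using BA by (intro pos_variation_upper) auto
          then show "ennreal (max 0 (\<nu> (B \<inter> A i))) \<le> pos_variation \<nu> (A i)"
            by (simp add: max_def)
        qed
        also have "\<dots> \<le> (\<Sum>i. pos_variation \<nu> (A i))"
          by (intro sum_le_suminf) auto
        finally show ?thesis .
      qed
      ultimately show "ennreal (\<nu> B) \<le> (\<Sum>i. pos_variation \<nu> (A i))"
        by (intro LIMSEQ_le_const2) auto
    qed
  qed
qed

lemma emeasure_pos_part:
  fixes \<nu> :: "'a::euclidean_space set \<Rightarrow> real"
  assumes \<nu>: "finite_signed_measure \<nu>" and A: "A \<in> sets borel"
  shows "emeasure (pos_part \<nu>) A = pos_variation \<nu> A"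
  unfolding pos_part_def
proof (rule emeasure_measure_of_sigma)
  show "sigma_algebra UNIV (sets (borel :: 'a measure))"
    using sets.sigma_algebra_axioms[of "borel :: 'a measure"] by simp
  show "positive (sets borel) (pos_variation \<nu>)"
    by (simp add: positive_def pos_variation_empty[OF \<nu>])
qed (use A countably_additive_pos_variation[OF \<nu>] in auto)

lemma jordan_decomposition_le:
  assumes \<nu>: "finite_signed_measure \<nu>" and A: "A \<in> sets borel"
    and fin: "total_variation \<nu> < \<infinity>"
  shows "measure (pos_part \<nu>) A \<le> \<nu> A + measure (neg_part \<nu>) A"
proof -
  note \<nu>' = finite_signed_measure_uminus[OF \<nu>]
  have neg: "emeasure (neg_part \<nu>) A = pos_variation (\<lambda>A. - \<nu> A) A"
    unfolding neg_part_def by (rule emeasure_pos_part[OF \<nu>' A])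
  have "pos_variation (\<lambda>A. - \<nu> A) A \<le> pos_variation (\<lambda>A. - \<nu> A) UNIV"
    by (rule pos_variation_mono) simp
  also have "\<dots> = emeasure (neg_part \<nu>) UNIV"
    unfolding neg_part_def by (rule emeasure_pos_part[OF \<nu>', symmetric]) simp
  also have "\<dots> \<le> total_variation \<nu>" by (simp add: total_variation_def)
  also note fin
  finally have nf: "emeasure (neg_part \<nu>) A < \<infinity>" by (simp add: neg)
  have le: "- \<nu> B \<le> measure (neg_part \<nu>) A" if "B \<in> sets borel" "B \<subseteq> A" for B
  proof -
    have "ennreal (- \<nu> B) \<le> emeasure (neg_part \<nu>) A"
      unfolding neg using that by (rule pos_variation_upper)
    also have "\<dots> = ennreal (measure (neg_part \<nu>) A)"
      using nf by (simp add: emeasure_eq_ennreal_measure)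
    finally show ?thesis by (simp add: ennreal_le_iff)
  qed
  have "pos_variation \<nu> A \<le> ennreal (\<nu> A + measure (neg_part \<nu>) A)"
    unfolding pos_variation_def
  proof (rule SUP_least, rule ennreal_leI)
    fix B assume "B \<in> {B \<in> sets borel. B \<subseteq> A}"
    then have B: "B \<in> sets borel" "B \<subseteq> A" by auto
    have "\<nu> (B \<union> (A - B)) = \<nu> B + \<nu> (A - B)"
      using B A by (intro finite_signed_measure_Un[OF \<nu>]) auto
    moreover have "B \<union> (A - B) = A" using B by auto
    moreover have "- \<nu> (A - B) \<le> measure (neg_part \<nu>) A"
      using A B by (intro le) auto
    ultimately show "\<nu> B \<le> \<nu> A + measure (neg_part \<nu>) A" by simp
  qed
  then have "emeasure (pos_part \<nu>) A \<le> ennreal (\<nu> A + measure (neg_part \<nu>) A)"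
    by (simp add: emeasure_pos_part[OF \<nu> A])
  moreover have "0 \<le> \<nu> A + measure (neg_part \<nu>) A" using le[OF A] by simp
  ultimately show ?thesis
    by (metis Sigma_Algebra.measure_def enn2real_leI)
qed

lemma jordan_decomposition:
  assumes \<nu>: "finite_signed_measure \<nu>" and fin: "total_variation \<nu> < \<infinity>" and A: "A \<in> sets borel"
  shows "\<nu> A = measure (pos_part \<nu>) A - measure (neg_part \<nu>) A"
proof (rule antisym)
  have "total_variation (\<lambda>A. - \<nu> A) < \<infinity>"
    using fin by (simp add: total_variation_def neg_part_def add.commute)
  from jordan_decomposition_le[OF finite_signed_measure_uminus[OF \<nu>] A this]
  show "\<nu> A \<le> measure (pos_part \<nu>) A - measure (neg_part \<nu>) A"
    by (simp add: neg_part_def)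
  show "measure (pos_part \<nu>) A - measure (neg_part \<nu>) A \<le> \<nu> A"
    using jordan_decomposition_le[OF \<nu> A fin] by simp
qed


section \<open>Functions of bounded variation on the Heisenberg group\<close>

text \<open>With \<open>n = CARD('n)\<close>, the coordinate \<open>x\<^sub>j\<close> is \<open>x $ Inl j\<close>, and \<open>x\<^sub>n\<^sub>+\<^sub>j\<close> is \<open>x $ Inr j\<close>;
  likewise \<^typ>\<open>'n + 'n\<close> indexes the \<open>2n\<close> horizontal vector fields.\<close>

type_synonym 'n heisenberg = "(real ^ ('n + 'n)) \<times> real"

definition deriv_x :: "'n + 'n \<Rightarrow> ('n::finite heisenberg \<Rightarrow> real) \<Rightarrow> 'n heisenberg \<Rightarrow> real" where
  "deriv_x j = partial_deriv (axis j 1, 0)"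

definition deriv_t :: "('n::finite heisenberg \<Rightarrow> real) \<Rightarrow> 'n heisenberg \<Rightarrow> real" where
  "deriv_t = partial_deriv (0, 1)"

fun horizontal :: "'n + 'n \<Rightarrow> ('n::finite heisenberg \<Rightarrow> real) \<Rightarrow> 'n heisenberg \<Rightarrow> real" where
  "horizontal (Inl j) \<phi> p = deriv_x (Inl j) \<phi> p - (fst p $ Inr j) / 2 * deriv_t \<phi> p"
| "horizontal (Inr j) \<phi> p = deriv_x (Inr j) \<phi> p + (fst p $ Inl j) / 2 * deriv_t \<phi> p"

text \<open>\<open>has_horizontal_measure f j \<nu>\<close>: the distributional derivative \<open>X\<^sub>j f\<close> is the finite signed
  measure \<open>\<nu>\<close>.\<close>

definition has_horizontal_measure ::
    "('n::finite heisenberg \<Rightarrow> real) \<Rightarrow> 'n + 'n \<Rightarrow> ('n heisenberg set \<Rightarrow> real) \<Rightarrow> bool" where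
  "has_horizontal_measure f j \<nu> \<longleftrightarrow>
    finite_signed_measure \<nu> \<and> total_variation \<nu> < \<infinity> \<and>
    (\<forall>\<phi>\<in>test_functions.
      (\<integral>p. f p * horizontal j \<phi> p \<partial>lebesgue) = - signed_integral \<nu> \<phi>)"

definition BV :: "('n::finite heisenberg \<Rightarrow> real) set" where
  "BV = {f. integrable lebesgue f \<and> (\<forall>j. \<exists>\<nu>. has_horizontal_measure f j \<nu>)}"

text \<open>The \<open>L\<close>-\<open>q\<close> norm with respect to Lebesgue measure, for \<open>0 < q < \<infinity>\<close>, with value \<open>\<infinity>\<close> for
  measurable functions outside \<open>L\<close>-\<open>q\<close>.\<close>

definition lebesgue_norm :: "real \<Rightarrow> ('a::euclidean_space \<Rightarrow> real) \<Rightarrow> ennreal" where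
  "lebesgue_norm q f =
    (let I = (\<integral>\<^sup>+p. ennreal (\<bar>f p\<bar> powr q) \<partial>lebesgue)
     in if I = \<infinity> then \<infinity> else ennreal (enn2real I powr (1 / q)))"

end

theory Submission
  imports Defs
begin

text \<open>The map \<open>\<Psi>\<^sub>j\<close>, \<open>(x, t) \<mapsto> (x, t \<plusminus> x\<^sub>j x\<^sub>j' / 2)\<close> with \<open>j'\<close> the index conjugate to \<open>j\<close>,
  preserves volume and straightens \<open>X\<^sub>j\<close> to \<open>\<partial>\<^sub>j\<close>. Testing \<open>X\<^sub>j f\<close> against smooth approximations of
  indicators of slabs and differentiating along shrinking cubes yields
  \<open>\<bar>f\<bar> \<le> F\<^sub>j \<circ> \<Psi>\<^sub>j\<close> almost everywhere, where \<open>F\<^sub>j\<close> does not depend on the \<open>j\<close>-th coordinate and its integral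
  over the remaining coordinates is at most \<open>\<parallel>X\<^sub>j f\<parallel>\<close>. The superlevel sets of \<open>f\<close> are therefore
  controlled by the Loomis-Whitney inequality for sets and the maps \<open>\<Psi>\<^sub>j\<close>; integrating
  over the levels and applying Hoelder's inequality in the level gives the theorem.

  The Loomis-Whitney inequality is obtained from one conjugate pair of coordinates at a time. On the
  three-dimensional slices where only \<open>x\<^sub>a, x\<^sub>n\<^sub>+\<^sub>a, t\<close> vary it is a bound for incidences between points
  and lines of the plane, proved by discarding pairs of points at distance at most \<open>\<delta>\<close> and optimising \<open>\<delta>\<close>.
  Interpolating with the trivial bounds by the other projections and integrating the slices with
  Finner's inequality gives a version that favours the pair \<open>a\<close>; the geometric mean
  over \<open>a\<close> is the symmetric inequality.\<close>

section \<open>Smooth functions and bumps\<close>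

text \<open>The two fields of a conjugate pair do not commute, so no single change of variables
  straightens both, and the classical inequality for coordinate projections does not apply. Once the
  coordinates outside one pair are frozen, however, every other shear is a translation in
  \<open>t\<close>, and the twist is confined to three variables. There one coordinate of the pair
  and \<open>t\<close> are slope and intercept of a line, and the other coordinate is the abscissa
  of a point on it. Two points determine the line with Jacobian equal to the distance of their
  abscissae; nearby points are therefore the obstacle, and the threshold \<delta> isolates them. The
  total exponent (2n+2)/(2n+1) reflects the homogeneous dimension 2n+2 rather than the topological
  dimension 2n+1; the gain comes from the planar bound, whose exponents 2/3 + 2/3 are already the
  case n = 1. Applied to superlevel sets, a set inequality alone gives a weak-type bound. The strong
  one is reached because the measure of the set where F_j exceeds l is at most the total variation
  divided by l and is also integrable in l.\<close>

lemma partial_derivI: "(f has_derivative f') (at p) \<Longrightarrow> partial_deriv v f p = f' v"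
  unfolding partial_deriv_def by (metis frechet_derivative_at)

lemma Ck_imp_continuous: "Ck k f \<Longrightarrow> continuous_on UNIV f"
  by (cases k) (simp_all add: continuous_on_eq_continuous_at differentiable_imp_continuous_within)

lemma Ck_SucD: "Ck (Suc k) f \<Longrightarrow> Ck k f"
proof (induction k arbitrary: f)
  case 0
  from Ck_imp_continuous[OF 0] show ?case by simp
next
  case (Suc k)
  then show ?case by simp
qed

section \<open>Closure properties of functions of class \<open>Ck\<close>\<close>

lemma Ck_const: "Ck k (\<lambda>_. c)"
proof (induction k arbitrary: c)
  case (Suc k)
  have "partial_deriv b (\<lambda>_. c) = (\<lambda>_. 0)" for b :: 'a
    by (intro ext partial_derivI) auto
  with Suc show ?case by simp
qed simp

lemma Ck_bounded_linear:
  assumes "bounded_linear f"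
  shows "Ck k f"
proof (cases k)
  case (Suc l)
  have "partial_deriv b f = (\<lambda>_. f b)" for b
    by (intro ext partial_derivI bounded_linear_imp_has_derivative assms)
  with Suc assms show ?thesis
    by (auto simp: Ck_const intro: bounded_linear_imp_differentiable)
qed (use assms in \<open>auto intro: linear_continuous_on\<close>)

lemma Ck_add:
  assumes "Ck k f" "Ck k g"
  shows "Ck k (\<lambda>p. f p + g p)"
  using assms
proof (induction k arbitrary: f g)
  case (Suc k)
  have "partial_deriv b (\<lambda>p. f p + g p) = (\<lambda>p. partial_deriv b f p + partial_deriv b g p)" for b
  proof
    fix p
    have "(f has_derivative frechet_derivative f (at p)) (at p)"
      "(g has_derivative frechet_derivative g (at p)) (at p)"
      using Suc.prems by (auto simp flip: frechet_derivative_works)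
    from has_derivative_add[OF this]
    show "partial_deriv b (\<lambda>p. f p + g p) p = partial_deriv b f p + partial_deriv b g p"
      unfolding partial_deriv_def[of b f] partial_deriv_def[of b g] by (rule partial_derivI)
  qed
  with Suc show ?case by (auto intro: differentiable_add)
qed (auto intro!: continuous_on_add continuous_on_mult)

lemma Ck_mult:
  assumes "Ck k f" "Ck k g"
  shows "Ck k (\<lambda>p. f p * g p)"
  using assms
proof (induction k arbitrary: f g)
  case (Suc k)
  have "partial_deriv b (\<lambda>p. f p * g p) =
      (\<lambda>p. f p * partial_deriv b g p + partial_deriv b f p * g p)" for b
  proof
    fix p
    have "(f has_derivative frechet_derivative f (at p)) (at p)"
      "(g has_derivative frechet_derivative g (at p)) (at p)"
      using Suc.prems by (auto simp flip: frechet_derivative_works)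
    from has_derivative_mult[OF this]
    show "partial_deriv b (\<lambda>p. f p * g p) p = f p * partial_deriv b g p + partial_deriv b f p * g p"
      unfolding partial_deriv_def[of b f] partial_deriv_def[of b g] by (rule partial_derivI)
  qed
  with Suc.prems show ?case
    using Ck_SucD[OF Suc.prems(1)] Ck_SucD[OF Suc.prems(2)]
    by (auto intro!: differentiable_mult Ck_add Suc.IH)
qed (auto intro!: continuous_on_add continuous_on_mult)

lemma Ck_prod:
  assumes "finite I" "\<And>i. i \<in> I \<Longrightarrow> Ck k (f i)"
  shows "Ck k (\<lambda>p. \<Prod>i\<in>I. f i p)"
  using assms by (induction I rule: finite_induct) (auto intro: Ck_const Ck_mult)

text \<open>The induction on \<open>k\<close> keeps \<open>b\<close> arbitrary because the chain
  rule replaces \<open>b\<close> by its derivative; requiring every order of smoothness makes the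
  class of outer functions closed under this step.\<close>

lemma Ck_compose:
  fixes b :: "real \<Rightarrow> real"
  assumes "\<And>k. Ck k b" "Ck k P"
  shows "Ck k (\<lambda>p. b (P p))"
  using assms
proof (induction k arbitrary: b)
  case 0
  have "continuous_on UNIV b" "continuous_on UNIV P" using 0(1)[of 0] 0(2) by simp_all
  from continuous_on_compose2[OF this] show ?case by simp
next
  case (Suc k)
  have b: "(b has_derivative frechet_derivative b (at x)) (at x)" for x
    using Suc.prems(1)[of 1] by (simp flip: frechet_derivative_works)
  have P: "(P has_derivative frechet_derivative P (at p)) (at p)" for p
    using Suc.prems(2) by (simp flip: frechet_derivative_works)
  have comp: "((\<lambda>p. b (P p)) has_derivative
      (\<lambda>v. frechet_derivative b (at (P p)) (frechet_derivative P (at p) v))) (at p)" for p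
    by (rule has_derivative_compose[OF P b])
  have "partial_deriv v (\<lambda>p. b (P p)) = (\<lambda>p. partial_deriv 1 b (P p) * partial_deriv v P p)" for v
  proof
    fix p
    have "frechet_derivative b (at (P p)) (frechet_derivative P (at p) v) =
        frechet_derivative P (at p) v * frechet_derivative b (at (P p)) 1"
      using linear_scale[OF has_derivative_linear[OF b], of "P p" "frechet_derivative P (at p) v" 1]
      by simp
    with partial_derivI[OF comp, of v p]
    show "partial_deriv v (\<lambda>p. b (P p)) p = partial_deriv 1 b (P p) * partial_deriv v P p"
      unfolding partial_deriv_def by (metis mult.commute)
  qed
  moreover have "Ck k (\<lambda>p. partial_deriv 1 b (P p) * partial_deriv v P p)" if "v \<in> Basis" for v
  proof (rule Ck_mult)
    have "Ck k (partial_deriv 1 b)" for k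
      using Suc.prems(1)[of "Suc k"] by simp
    then show "Ck k (\<lambda>p. partial_deriv 1 b (P p))"
      by (rule Suc.IH) (rule Ck_SucD[OF Suc.prems(2)])
    show "Ck k (partial_deriv v P)"
      using Suc.prems(2) that by simp
  qed
  ultimately show ?case
    using differentiableI[OF comp] by simp
qed

lemma Ck_Suc_real:
  fixes f :: "real \<Rightarrow> real"
  assumes "\<And>x. (f has_real_derivative f' x) (at x)" "Ck k f'"
  shows "Ck (Suc k) f"
proof -
  have "partial_deriv 1 f = f'"
    using partial_derivI[OF assms(1)[THEN has_field_derivative_imp_has_derivative]] by auto
  moreover have "f differentiable (at x)" for x
    by (rule differentiableI[OF assms(1)[THEN has_field_derivative_imp_has_derivative]])
  ultimately show ?thesis
    using assms(2) by simp
qed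

lemma Ck_exp: "Ck k (exp :: real \<Rightarrow> real)"
  by (induction k) (simp add: continuous_on_exp, rule Ck_Suc_real[OF DERIV_exp])

text \<open>The functions x^(-k) e^(-1/x), extended by 0 to x \<le> 0. The derivative of each is a
  linear combination of two others, so one induction on the order shows the whole family smooth; the
  bumps use k = 0.\<close>

definition flat_exp :: "nat \<Rightarrow> real \<Rightarrow> real" where
  "flat_exp k x = (if x > 0 then inverse x ^ k * exp (- inverse x) else 0)"

lemma flat_exp_tendsto_0: "(flat_exp k \<longlongrightarrow> 0) (at 0)"
proof -
  have "((\<lambda>x. inverse x ^ k / exp (inverse x)) \<longlongrightarrow> 0) (at_right (0::real))"
    using filterlim_compose[OF tendsto_power_div_exp_0 filterlim_inverse_at_top_right] .
  then have "(flat_exp k \<longlongrightarrow> 0) (at_right 0)"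
    by (rule Lim_transform_eventually)
      (auto simp: eventually_at_filter flat_exp_def exp_minus divide_inverse)
  moreover have "(flat_exp k \<longlongrightarrow> 0) (at_left 0)"
    by (rule tendsto_eventually) (auto simp: eventually_at_filter flat_exp_def)
  ultimately show ?thesis by (rule filterlim_split_at_real[rotated])
qed

lemma flat_exp_has_derivative:
  "(flat_exp k has_real_derivative flat_exp (k + 2) x + (- real k) * flat_exp (Suc k) x) (at x)"
proof -
  consider "x > 0" | "x < 0" | "x = 0" by linarith
  then show ?thesis
  proof cases
    case 1
    have inv: "(inverse has_real_derivative - (inverse x * inverse x)) (at x)"
      using DERIV_inverse[of x UNIV] 1 by (simp add: power2_eq_square power_inverse)
    have "((\<lambda>x. inverse x ^ k * exp (- inverse x)) has_real_derivative
        flat_exp (k + 2) x + (- real k) * flat_exp (Suc k) x) (at x)"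
      using DERIV_mult[OF DERIV_power[OF inv, of k] DERIV_fun_exp[OF DERIV_minus[OF inv]]] 1
      by (cases k) (simp_all add: flat_exp_def algebra_simps)
    then show ?thesis
      by (rule has_field_derivative_transform_within_open[of _ _ _ "{0<..}"])
        (use 1 in \<open>simp_all add: flat_exp_def\<close>)
  next
    case 2
    have "((\<lambda>x. 0) has_real_derivative flat_exp (k + 2) x + (- real k) * flat_exp (Suc k) x) (at x)"
      using 2 by (simp add: flat_exp_def)
    then show ?thesis
      by (rule has_field_derivative_transform_within_open[of _ _ _ "{..<0}"])
        (use 2 in \<open>simp_all add: flat_exp_def\<close>)
  next
    case 3
    \<comment> \<open>At the origin the difference quotient of one member of the family is the next
      member, which tends to 0.\<close>
    have eq: "flat_exp (Suc k) = (\<lambda>y. (flat_exp k y - flat_exp k 0) / (y - 0))"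
      by (auto simp: flat_exp_def field_simps)
    have "(flat_exp k has_real_derivative 0) (at 0)"
      using flat_exp_tendsto_0[of "Suc k"] unfolding has_field_derivative_iff eq .
    with 3 show ?thesis by (simp add: flat_exp_def)
  qed
qed

lemma Ck_flat_exp: "Ck m (flat_exp k)"
proof (induction m arbitrary: k)
  case 0
  show ?case
    using DERIV_isCont[OF flat_exp_has_derivative] by (simp add: continuous_on_eq_continuous_at)
next
  case (Suc m)
  show ?case
    by (rule Ck_Suc_real[OF flat_exp_has_derivative]) (intro Ck_add Ck_mult Ck_const Suc)
qed

text \<open>The product of the two flat factors is positive exactly on the open interval from
  \<open>c\<close> to \<open>d\<close>. Composing it with 1 - e^(-m r) keeps support and smoothness,
  forces values in [0, 1], and makes the indicator of the interval the limit for large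
  \<open>m\<close>, with no normalising constant.\<close>

definition bump :: "real \<Rightarrow> real \<Rightarrow> real \<Rightarrow> real \<Rightarrow> real" where
  "bump m c d s = 1 - exp (- m * (flat_exp 0 (s - c) * flat_exp 0 (d - s)))"

lemma Ck_affine: "Ck k (\<lambda>s::real. a * s + b)"
  by (intro Ck_add Ck_const Ck_bounded_linear bounded_linear_mult_right)

lemma Ck_bump: "Ck k (bump m c d)"
proof -
  have "Ck k (\<lambda>s. 1 + (-1) * exp ((- m) * (flat_exp 0 (1 * s + (- c)) * flat_exp 0 ((-1) * s + d))))" for k
    by (intro Ck_add Ck_const Ck_mult Ck_compose[OF Ck_exp] Ck_compose[OF Ck_flat_exp] Ck_affine)
  moreover have "bump m c d = (\<lambda>s. 1 + (-1) * exp ((- m) * (flat_exp 0 (1 * s + (- c)) * flat_exp 0 ((-1) * s + d))))"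
    by (simp add: bump_def fun_eq_iff)
  ultimately show ?thesis by simp
qed

lemma flat_exp_nonneg: "0 \<le> flat_exp k x"
  by (auto simp: flat_exp_def)

lemma bump_bounds: "m \<ge> 0 \<Longrightarrow> 0 \<le> bump m c d s" "bump m c d s \<le> 1"
  by (auto simp: bump_def flat_exp_nonneg intro!: mult_nonneg_nonneg)

lemma bump_eq_0: "s \<notin> {c<..<d} \<Longrightarrow> bump m c d s = 0"
  by (auto simp: bump_def flat_exp_def)

lemma bump_tendsto: "(\<lambda>m. bump (real m) c d s) \<longlonglongrightarrow> indicator {c<..<d} s"
proof (cases "s \<in> {c<..<d}")
  case True
  define u where "u = flat_exp 0 (s - c) * flat_exp 0 (d - s)"
  have "u > 0" using True by (simp add: u_def flat_exp_def)
  then have "filterlim (\<lambda>m. real m * u) at_top sequentially"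
    by (intro filterlim_at_top_mult_tendsto_pos[OF tendsto_const] filterlim_real_sequentially)
  then have "(\<lambda>m. exp (- (real m * u))) \<longlonglongrightarrow> 0"
    by (intro filterlim_compose[OF exp_at_bot] filterlim_compose[OF filterlim_uminus_at_bot_at_top])
  then have "(\<lambda>m. 1 - exp (- (real m * u))) \<longlonglongrightarrow> 1 - 0"
    by (intro tendsto_intros)
  then show ?thesis using True by (simp add: bump_def u_def)
qed (simp add: bump_eq_0)

section \<open>Test functions adapted to a horizontal field\<close>

fun opp :: "'n + 'n \<Rightarrow> 'n + 'n" where
  "opp (Inl j) = Inr j"
| "opp (Inr j) = Inl j"

text \<open>The sign is chosen so that X_j has \<open>t\<close>-component - \<open>twist j\<close>
  times the conjugate coordinate; hence \<open>t\<close> plus \<open>twist j\<close> times the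
  product of the two coordinates is constant along X_j.\<close>

fun twist :: "'n + 'n \<Rightarrow> real" where
  "twist (Inl j) = 1 / 2"
| "twist (Inr j) = - 1 / 2"

definition height :: "'n + 'n \<Rightarrow> 'n::finite heisenberg \<Rightarrow> real" where
  "height j p = snd p + twist j * (fst p $ j * fst p $ opp j)"

definition shear :: "'n + 'n \<Rightarrow> 'n::finite heisenberg \<Rightarrow> 'n heisenberg" where
  "shear j p = (fst p, height j p)"

definition field_at :: "'n + 'n \<Rightarrow> 'n::finite heisenberg \<Rightarrow> 'n heisenberg" where
  "field_at j p = (axis j 1, - twist j * fst p $ opp j)"

lemma opp_neq [simp]: "opp j \<noteq> j" "j \<noteq> opp j"
  by (cases j; simp)+

lemma abs_twist: "\<bar>twist j\<bar> = 1 / 2"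
  by (cases j) simp_all

lemma horizontal_eq:
  assumes "\<phi> differentiable (at p)"
  shows "horizontal j \<phi> p = frechet_derivative \<phi> (at p) (field_at j p)"
proof -
  have lin: "linear (frechet_derivative \<phi> (at p))"
    by (rule linear_frechet_derivative[OF assms])
  have "(axis j 1, c) = (axis j 1, 0) + c *\<^sub>R (0, 1)" for c :: real and j :: "'a + 'a"
    by simp
  then have "frechet_derivative \<phi> (at p) (axis j 1, c) =
      deriv_x j \<phi> p + c * deriv_t \<phi> p" for c j
    unfolding deriv_x_def deriv_t_def partial_deriv_def
    by (metis linear_add[OF lin] linear_scale[OF lin] real_scaleR_def)
  then show ?thesis
    by (cases j) (simp_all add: field_at_def)
qed

text \<open>The coefficient of X_j involves only the conjugate coordinate, which does not change
  along the field. The integral curves are thus straight lines, and X_j applied to a function of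
  coordinates and height becomes a one-variable derivative.\<close>

lemma horizontal_along_flow:
  assumes "\<phi> differentiable (at p)"
    and "((\<lambda>s. \<phi> (p + s *\<^sub>R field_at j p)) has_real_derivative D) (at 0)"
  shows "horizontal j \<phi> p = D"
proof -
  have "((\<lambda>s. p + s *\<^sub>R field_at j p) has_derivative (\<lambda>s. s *\<^sub>R field_at j p)) (at 0)"
    by (auto intro!: derivative_eq_intros)
  moreover have "(\<phi> has_derivative frechet_derivative \<phi> (at p)) (at (p + 0 *\<^sub>R field_at j p))"
    using assms(1) by (simp add: frechet_derivative_works)
  ultimately have "((\<lambda>s. \<phi> (p + s *\<^sub>R field_at j p)) has_derivative
      (\<lambda>s. frechet_derivative \<phi> (at p) (s *\<^sub>R field_at j p))) (at 0)"
    by (rule has_derivative_compose)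
  moreover have "((\<lambda>s. \<phi> (p + s *\<^sub>R field_at j p)) has_derivative (\<lambda>s. D * s)) (at 0)"
    using assms(2) by (simp add: has_field_derivative_def)
  ultimately have "(\<lambda>s. frechet_derivative \<phi> (at p) (s *\<^sub>R field_at j p)) = (\<lambda>s. D * s)"
    by (rule has_derivative_unique)
  from fun_cong[OF this, of 1] show ?thesis
    by (simp add: horizontal_eq[OF assms(1)])
qed

lemma flow_coordinates:
  "fst (p + s *\<^sub>R field_at j p) $ i = (if i = j then fst p $ j + s else fst p $ i)"
  "height j (p + s *\<^sub>R field_at j p) = height j p"
  by (auto simp: field_at_def axis_def height_def algebra_simps)

lemma bump_antiderivative:
  assumes "m \<ge> 0" "c \<le> d"
  obtains B where "\<And>s. (B has_real_derivative bump m c d s) (at s)"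
    "\<And>s. s \<le> c \<Longrightarrow> B s = 0" "\<And>s. s \<ge> d \<Longrightarrow> B s = B d" "\<And>s. 0 \<le> B s" "\<And>s. B s \<le> d - c"
proof -
  \<comment> \<open>With the integral started at \<open>c - 1\<close>, the point \<open>c\<close> is
    interior and the fundamental theorem covers it; further left the function vanishes
    locally.\<close>
  define B where "B = (\<lambda>s. integral {c - 1..s} (bump m c d))"
  have cont: "continuous_on A (bump m c d)" for A
    using Ck_imp_continuous[OF Ck_bump[of 0 m c d]] continuous_on_subset by blast
  have B0: "B s = 0" if "s \<le> c" for s
  proof -
    have "B s = integral {c - 1..s} (\<lambda>_. 0)"
      unfolding B_def using that by (intro integral_cong bump_eq_0) auto
    then show ?thesis by simp
  qed
  have D: "(B has_real_derivative bump m c d s) (at s)" for s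
  proof (cases "s > c - 1")
    case True
    have "(B has_real_derivative bump m c d s) (at s within {c - 1..s + 1})"
      unfolding B_def using True by (intro integral_has_real_derivative cont) auto
    moreover have "at s within {c - 1..s + 1} = at s"
      using True by (intro at_within_interior) (auto simp: interior_atLeastAtMost_real)
    ultimately show ?thesis by simp
  next
    case False
    have "((\<lambda>_. 0) has_real_derivative bump m c d s) (at s)"
      using False by (simp add: bump_eq_0)
    then show ?thesis
      by (rule has_field_derivative_transform_within_open[of _ _ _ "{..<c}"])
        (use False B0 in auto)
  qed
  have mono: "B s \<le> B t" if "s \<le> t" for s t
    using that by (rule DERIV_nonneg_imp_nondecreasing) (use D bump_bounds(1)[OF assms(1)] in blast)
  \<comment> \<open>The bump is at most 1, so \<open>B\<close> grows no faster than the identity.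
    This gives the bound \<open>d - c\<close>, which becomes the factor \<open>h\<close> of the slab
    estimate.\<close>
  have "B s - s \<ge> B t - t" if "s \<le> t" for s t
  proof (rule DERIV_nonpos_imp_nonincreasing[OF that, of "\<lambda>s. B s - s"])
    fix x
    have "((\<lambda>s. B s - s) has_real_derivative bump m c d x - 1) (at x)"
      by (intro DERIV_diff D DERIV_ident)
    then show "\<exists>y. ((\<lambda>s. B s - s) has_real_derivative y) (at x) \<and> y \<le> 0"
      using bump_bounds(2)[of m c d x] by (intro exI[of _ "bump m c d x - 1"]) auto
  qed
  from this[OF assms(2)] have Bd: "B d \<le> d - c" using B0[of c] by simp
  have const: "B s = B d" if "s \<ge> d" for s
  proof (cases "s = d")
    case False
    then have "d < s" using that by simp
    then show ?thesis
    proof (rule DERIV_isconst_end)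
      show "continuous_on {d..s} B"
        using D DERIV_isCont by (blast intro: continuous_at_imp_continuous_on)
      show "(B has_real_derivative 0) (at x)" if "d < x" "x < s" for x
        using D[of x] that by (simp add: bump_eq_0)
    qed
  qed simp
  have "0 \<le> B s" for s
    using mono[of c s] B0[of c] B0[of s] by (cases "c \<le> s") auto
  moreover have "B s \<le> d - c" for s
    using mono[of s d] const[of s] Bd by (cases "s \<le> d") auto
  ultimately show thesis using that D B0 const by blast
qed

text \<open>A product of bumps in quantities that are all constant along X_j, so X_j treats it as a
  constant.\<close>

definition cutoff :: "'n + 'n \<Rightarrow> 'n::finite heisenberg \<Rightarrow> real \<Rightarrow> real \<Rightarrow> 'n heisenberg \<Rightarrow> real" where
  "cutoff j q h m p = (\<Prod>i\<in>UNIV - {j}. bump m (fst q $ i) (fst q $ i + h) (fst p $ i)) *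
     bump m (snd q) (snd q + h) (height j p)"

text \<open>In the straightened coordinates this is an open cube of side \<open>h\<close> with
  corner \<open>q\<close>, extended to the whole line in direction \<open>j\<close>; in particular
  it ignores the \<open>j\<close>-th coordinate of \<open>q\<close>.\<close>

definition slab :: "'n + 'n \<Rightarrow> 'n::finite heisenberg \<Rightarrow> real \<Rightarrow> 'n heisenberg set" where
  "slab j q h = {p. (\<forall>i\<in>UNIV - {j}. fst p $ i \<in> {fst q $ i<..<fst q $ i + h}) \<and>
     height j p \<in> {snd q<..<snd q + h}}"

lemma Ck_coordinate: "Ck k (\<lambda>p::'n::finite heisenberg. fst p $ i)"
  by (intro Ck_bounded_linear bounded_linear_compose[OF bounded_linear_vec_nth] bounded_linear_fst)

lemma Ck_height: "Ck k (height j :: 'n::finite heisenberg \<Rightarrow> real)"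
  unfolding height_def[abs_def]
  by (intro Ck_add Ck_mult Ck_const Ck_coordinate Ck_bounded_linear bounded_linear_snd)

lemma Ck_cutoff: "Ck k (cutoff j q h m)"
  unfolding cutoff_def[abs_def]
  by (intro Ck_mult Ck_prod Ck_compose[OF Ck_bump] Ck_coordinate Ck_height) auto

lemma cutoff_bounds:
  assumes "m \<ge> 0"
  shows "0 \<le> cutoff j q h m p" "cutoff j q h m p \<le> 1"
proof -
  note b = bump_bounds(1)[OF assms] bump_bounds(2)
  show "0 \<le> cutoff j q h m p"
    unfolding cutoff_def by (intro mult_nonneg_nonneg prod_nonneg b ballI)
  show "cutoff j q h m p \<le> 1"
    unfolding cutoff_def by (intro mult_le_one prod_le_1 b conjI)
qed

lemma cutoff_eq_0: "p \<notin> slab j q h \<Longrightarrow> cutoff j q h m p = 0"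
proof -
  assume "p \<notin> slab j q h"
  then consider i where "i \<in> UNIV - {j}" "fst p $ i \<notin> {fst q $ i<..<fst q $ i + h}"
    | "height j p \<notin> {snd q<..<snd q + h}"
    unfolding slab_def by blast
  then show ?thesis
  proof cases
    case 1
    then have "(\<Prod>i\<in>UNIV - {j}. bump m (fst q $ i) (fst q $ i + h) (fst p $ i)) = 0"
      by (intro prod_zero bexI[of _ i] bump_eq_0) auto
    then show ?thesis by (simp add: cutoff_def)
  qed (simp add: cutoff_def bump_eq_0)
qed

lemma cutoff_tendsto: "(\<lambda>m. cutoff j q h (real m) p) \<longlonglongrightarrow> indicator (slab j q h) p"
proof -
  have "(\<lambda>m. cutoff j q h (real m) p) \<longlonglongrightarrow>
     (\<Prod>i\<in>UNIV - {j}. indicator {fst q $ i<..<fst q $ i + h} (fst p $ i)) *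
     indicator {snd q<..<snd q + h} (height j p)"
    unfolding cutoff_def by (intro tendsto_mult tendsto_prod bump_tendsto)
  also have "(\<Prod>i\<in>UNIV - {j}. indicator {fst q $ i<..<fst q $ i + h} (fst p $ i)) *
     indicator {snd q<..<snd q + h} (height j p) = (indicator (slab j q h) p :: real)"
  proof (cases "\<forall>i\<in>UNIV - {j}. fst p $ i \<in> {fst q $ i<..<fst q $ i + h}")
    case True
    then show ?thesis by (simp add: slab_def indicator_def)
  next
    case False
    then have "(\<Prod>i\<in>UNIV - {j}. indicator {fst q $ i<..<fst q $ i + h} (fst p $ i)) = (0::real)"
      by (intro prod_zero) (auto simp: indicator_def)
    moreover have "p \<notin> slab j q h" using False by (auto simp: slab_def)
    ultimately show ?thesis by simp
  qed
  finally show ?thesis .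
qed

text \<open>The antiderivative of a bump is constant but in general nonzero to the right of its
  support; subtracting the translate by \<open>m\<close> restores compact support. The same
  \<open>m\<close> is sharpness and shift, so one limit both sharpens the bumps and moves the
  unwanted translate away.\<close>

lemma test_function_cutoff:
  fixes q :: "'n::finite heisenberg" and j :: "'n + 'n" and h :: real
  assumes B: "\<And>s. (B has_real_derivative bump m c d s) (at s)"
    "\<And>s. s \<le> c \<Longrightarrow> B s = 0" "\<And>s. s \<ge> d \<Longrightarrow> B s = B d" and m: "m \<ge> 0" "c \<le> d"
  defines "\<phi> \<equiv> \<lambda>p::'n heisenberg. (B (fst p $ j) - B (fst p $ j + m)) * cutoff j q h m p"
  shows "\<phi> \<in> test_functions"
    and "horizontal j \<phi> p = (bump m c d (fst p $ j) - bump m c d (fst p $ j + m)) * cutoff j q h m p"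
proof -
  define a where "a = (\<lambda>s. B s - B (s + m))"
  have a: "(a has_real_derivative bump m c d s - bump m c d (s + m)) (at s)" for s
    unfolding a_def using B(1)[of "s + m"] by (intro DERIV_diff B) (simp add: DERIV_shift)
  have Ck_B: "Ck k B" for k
    by (cases k) (use Ck_Suc_real[OF B(1) Ck_bump] Ck_SucD in blast)+
  have "Ck k (\<lambda>s. B s + (-1) * B (1 * s + m))" for k
    by (intro Ck_add Ck_mult Ck_const Ck_B Ck_compose[OF Ck_B] Ck_affine)
  then have Ck_a: "Ck k a" for k by (simp add: a_def)
  have Ck_phi: "Ck k \<phi>" for k
    unfolding \<phi>_def a_def[symmetric, THEN fun_cong]
    by (intro Ck_mult Ck_compose[OF Ck_a] Ck_coordinate Ck_cutoff)
  define K where "K = (\<Sum>i\<in>UNIV. \<bar>fst q $ i\<bar>) + \<bar>snd q\<bar> + \<bar>h\<bar> + \<bar>c\<bar> + \<bar>d\<bar> + m"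
  have "bounded {p. \<phi> p \<noteq> 0}"
  proof (rule boundedI)
    fix p assume "p \<in> {p. \<phi> p \<noteq> 0}"
    then have "a (fst p $ j) \<noteq> 0" "p \<in> slab j q h"
      using cutoff_eq_0[of p j q h m] by (auto simp: \<phi>_def a_def)
    have sum: "\<bar>fst q $ i\<bar> \<le> (\<Sum>i\<in>UNIV. \<bar>fst q $ i\<bar>)" for i
      by (rule member_le_sum) auto
    have xj: "c - m \<le> fst p $ j" "fst p $ j \<le> d"
      using \<open>a (fst p $ j) \<noteq> 0\<close> B(2)[of "fst p $ j"] B(2)[of "fst p $ j + m"]
        B(3)[of "fst p $ j"] B(3)[of "fst p $ j + m"] m unfolding a_def by (linarith | force)+
    have x: "\<bar>fst p $ i\<bar> \<le> K" for i
    proof (cases "i = j")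
      case True
      have "0 \<le> (\<Sum>i\<in>UNIV. \<bar>fst q $ i\<bar>)" by (simp add: sum_nonneg)
      with xj m show ?thesis unfolding K_def True by linarith
    next
      case False
      then have "fst q $ i < fst p $ i" "fst p $ i < fst q $ i + h"
        using \<open>p \<in> slab j q h\<close> by (auto simp: slab_def)
      with sum[of i] m show ?thesis unfolding K_def by linarith
    qed
    have "\<bar>height j p\<bar> \<le> K"
    proof -
      have "0 \<le> (\<Sum>i\<in>UNIV. \<bar>fst q $ i\<bar>)" by (simp add: sum_nonneg)
      moreover have "snd q < height j p" "height j p < snd q + h"
        using \<open>p \<in> slab j q h\<close> by (auto simp: slab_def)
      ultimately show ?thesis using m unfolding K_def by linarith
    qed
    \<comment> \<open>The support is controlled in terms of the height; returning to
      \<open>t\<close> costs a product of two coordinates, hence the quadratic term in the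
      bound.\<close>
    moreover have "\<bar>twist j * (fst p $ j * fst p $ opp j)\<bar> \<le> 1 / 2 * (K * K)"
      unfolding abs_mult abs_twist
      by (intro mult_mono mult_nonneg_nonneg abs_ge_zero x order_trans[OF abs_ge_zero x]) auto
    moreover have "snd p = height j p - twist j * (fst p $ j * fst p $ opp j)"
      by (simp add: height_def)
    ultimately have "\<bar>snd p\<bar> \<le> K + 1 / 2 * (K * K)" by linarith
    moreover have "norm (fst p) \<le> real CARD('n + 'n) * K"
      using norm_le_l1_cart[of "fst p"] sum_bounded_above[of UNIV "\<lambda>i. \<bar>fst p $ i\<bar>" K] x
      by (simp only: order_trans of_nat_mult)
    moreover have "norm p \<le> norm (fst p) + \<bar>snd p\<bar>"
      using norm_Pair_le[of "fst p" "snd p"] by simp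
    ultimately show "norm p \<le> real CARD('n + 'n) * K + (K + 1 / 2 * (K * K))" by linarith
  qed
  with Ck_phi show "\<phi> \<in> test_functions"
    by (simp add: test_functions_def compact_closure)
  show "horizontal j \<phi> p = (bump m c d (fst p $ j) - bump m c d (fst p $ j + m)) * cutoff j q h m p"
  proof (rule horizontal_along_flow)
    show "\<phi> differentiable (at p)" using Ck_phi[of "Suc 0"] unfolding Ck.simps by blast
    have "cutoff j q h m (p + s *\<^sub>R field_at j p) = cutoff j q h m p" for s
      unfolding cutoff_def flow_coordinates by (simp cong: prod.cong_simp)
    then have "(\<lambda>s. \<phi> (p + s *\<^sub>R field_at j p)) = (\<lambda>s. a (fst p $ j + s) * cutoff j q h m p)"
      by (simp only: \<phi>_def a_def flow_coordinates if_True simp_thms)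
    moreover have "((\<lambda>s. a (fst p $ j + s)) has_real_derivative
        bump m c d (fst p $ j) - bump m c d (fst p $ j + m)) (at 0)"
      using a[of "fst p $ j"] DERIV_shift[of a _ 0 "fst p $ j"] by (simp add: add.commute)
    ultimately show "((\<lambda>s. \<phi> (p + s *\<^sub>R field_at j p)) has_real_derivative
        (bump m c d (fst p $ j) - bump m c d (fst p $ j + m)) * cutoff j q h m p) (at 0)"
      by (auto intro!: DERIV_cmult_right)
  qed
qed

section \<open>Directional slopes of functions of bounded variation\<close>

lemma nn_integral_lborel_translate:
  fixes g :: "real \<Rightarrow> ennreal"
  assumes "g \<in> borel_measurable borel"
  shows "(\<integral>\<^sup>+t. g (t + c) \<partial>lborel) = (\<integral>\<^sup>+t. g t \<partial>lborel)"
  using nn_integral_real_affine[of g 1 c] assms by (simp add: add.commute)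

lemma nn_integral_lborel_pair:
  fixes g :: "'a::euclidean_space \<times> 'b::euclidean_space \<Rightarrow> ennreal"
  assumes [measurable]: "g \<in> borel_measurable borel"
  shows "(\<integral>\<^sup>+p. g p \<partial>lborel) = (\<integral>\<^sup>+x. \<integral>\<^sup>+t. g (x, t) \<partial>lborel \<partial>lborel)"
proof -
  have "(\<integral>\<^sup>+p. g p \<partial>lborel) = (\<integral>\<^sup>+p. g p \<partial>(lborel \<Otimes>\<^sub>M lborel))"
    by (simp add: lborel_prod)
  also have "\<dots> = (\<integral>\<^sup>+x. \<integral>\<^sup>+t. g (x, t) \<partial>lborel \<partial>lborel)"
  proof (rule lborel.nn_integral_fst[symmetric])
    show "g \<in> borel_measurable (lborel \<Otimes>\<^sub>M lborel)" by (simp add: lborel_prod)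
  qed
  finally show ?thesis .
qed

lemma measurable_coordinate [measurable]:
  "(\<lambda>p::'n::finite heisenberg. fst p $ i) \<in> borel_measurable borel"
  by (intro borel_measurable_continuous_onI continuous_intros)

lemma measurable_height [measurable]:
  "(height j :: 'n::finite heisenberg \<Rightarrow> real) \<in> borel_measurable borel"
  unfolding height_def[abs_def] by (intro borel_measurable_continuous_onI continuous_intros)

lemma measurable_shear [measurable]:
  "(shear j :: 'n::finite heisenberg \<Rightarrow> 'n heisenberg) \<in> borel_measurable borel"
  unfolding shear_def[abs_def] height_def
  by (intro borel_measurable_continuous_onI continuous_intros)

text \<open>For fixed horizontal coordinates the shear is a translation in \<open>t\<close>.\<close>

lemma nn_integral_shear:
  fixes g :: "'n::finite heisenberg \<Rightarrow> ennreal"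
  assumes [measurable]: "g \<in> borel_measurable borel"
  shows "(\<integral>\<^sup>+p. g (shear j p) \<partial>lborel) = (\<integral>\<^sup>+p. g p \<partial>lborel)"
proof -
  have g: "(\<lambda>t. g (x, t)) \<in> borel_measurable borel" for x
    by (rule measurable_compose[OF _ assms]) (simp add: borel_prod[symmetric])
  have "(\<integral>\<^sup>+t. g (shear j (x, t)) \<partial>lborel) = (\<integral>\<^sup>+t. g (x, t) \<partial>lborel)" for x
    unfolding shear_def height_def using nn_integral_lborel_translate[OF g] by simp
  then show ?thesis
    by (simp add: nn_integral_lborel_pair)
qed

lemma distr_shear: "distr lborel lborel (shear j) = (lborel :: 'n::finite heisenberg measure)"
proof (rule measure_eqI)
  fix A :: "'n heisenberg set" assume "A \<in> sets (distr lborel lborel (shear j))"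
  then have A[measurable]: "A \<in> sets borel" by simp
  have "emeasure (distr lborel lborel (shear j)) A = (\<integral>\<^sup>+p. indicator A p \<partial>distr lborel lborel (shear j))"
    by simp
  also have "\<dots> = (\<integral>\<^sup>+p. indicator A (shear j p) \<partial>lborel)"
    by (rule nn_integral_distr) simp_all
  also have "\<dots> = emeasure lborel A"
    by (simp add: nn_integral_shear)
  finally show "emeasure (distr lborel lborel (shear j)) A = emeasure lborel A" .
qed simp

lemma measurable_cutoff [measurable]: "cutoff j q h m \<in> borel_measurable borel"
  by (rule borel_measurable_continuous_onI[OF Ck_imp_continuous[OF Ck_cutoff[of 0]]])

lemma measurable_bump [measurable]: "bump m c d \<in> borel_measurable borel"
  by (rule borel_measurable_continuous_onI[OF Ck_imp_continuous[OF Ck_bump[of 0]]])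

lemma measurable_slab [measurable]: "slab j q h \<in> sets borel"
proof -
  have "slab j q h = (\<Inter>i\<in>UNIV. {p. i = j \<or> fst p $ i \<in> {fst q $ i<..<fst q $ i + h}}) \<inter>
     {p. height j p \<in> {snd q<..<snd q + h}}"
    by (auto simp: slab_def)
  also have "\<dots> \<in> sets borel" by measurable
  finally show ?thesis .
qed

lemma sets_neg_part [simp]: "sets (neg_part \<nu>) = sets borel"
  by (simp add: neg_part_def)

lemma space_neg_part [simp]: "space (neg_part \<nu>) = UNIV"
  by (simp add: neg_part_def)

lemma finite_measure_jordan:
  assumes "total_variation \<nu> < \<infinity>"
  shows "finite_measure (pos_part \<nu>)" "finite_measure (neg_part \<nu>)"
  using assms by (auto simp: total_variation_def intro!: finite_measureI)

lemma abs_integral_le_measure: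
  fixes \<phi> :: "'a::euclidean_space \<Rightarrow> real"
  assumes M: "finite_measure M" "sets M = sets borel" and S: "S \<in> sets borel"
    and \<phi>: "\<And>p. \<bar>\<phi> p\<bar> \<le> c * indicator S p"
  shows "\<bar>\<integral>p. \<phi> p \<partial>M\<bar> \<le> c * measure M S"
proof -
  interpret finite_measure M by fact
  have "\<bar>\<integral>p. \<phi> p \<partial>M\<bar> \<le> (\<integral>p. \<bar>\<phi> p\<bar> \<partial>M)"
    using integral_norm_bound[of M \<phi>] by simp
  also have "\<dots> \<le> (\<integral>p. c * indicator S p \<partial>M)"
    by (rule integral_mono') (use M S \<phi> in \<open>auto intro!: integrable_mult_right integrable_real_indicator
        simp: emeasure_eq_measure intro: order_trans[OF abs_ge_zero]\<close>)
  also have "\<dots> = c * measure M S"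
    using S M(2) sets_eq_imp_space_eq[OF M(2)] by simp
  finally show ?thesis .
qed

text \<open>Passes from a Lebesgue measurable function to a Borel representative, so that all later
  applications of Tonelli's theorem take place over \<open>lborel\<close>. The integrands agree
  almost everywhere, and X_j \<phi> is Borel because the partial derivatives of \<phi> are
  continuous.\<close>

lemma has_horizontal_measure_cong_AE:
  assumes \<nu>: "has_horizontal_measure f j \<nu>" and f: "f \<in> borel_measurable lebesgue"
    and g: "g \<in> borel_measurable borel" and fg: "AE p in lborel. f p = g p"
    and \<phi>: "\<phi> \<in> test_functions"
  shows "(\<integral>p. g p * horizontal j \<phi> p \<partial>lborel) = - signed_integral \<nu> \<phi>"
proof -
  have Ck: "Ck k \<phi>" for k using \<phi> by (simp add: test_functions_def)
  have d: "\<phi> differentiable (at p)" for p using Ck[of "Suc 0"] unfolding Ck.simps by blast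
  have "continuous_on UNIV (partial_deriv b \<phi>)" if "b \<in> Basis" for b
    using Ck[of "Suc 0"] that by simp
  then have "continuous_on UNIV (deriv_x i \<phi>)" "continuous_on UNIV (deriv_t \<phi>)" for i
    unfolding deriv_x_def deriv_t_def by (auto simp: Basis_prod_def axis_in_Basis_iff)
  then have [measurable]: "deriv_x i \<phi> \<in> borel_measurable borel" "deriv_t \<phi> \<in> borel_measurable borel" for i
    by (auto intro: borel_measurable_continuous_onI)
  have "horizontal j \<phi> = (\<lambda>p. deriv_x j \<phi> p - twist j * (fst p $ opp j) * deriv_t \<phi> p)"
    by (cases j) (simp_all add: fun_eq_iff)
  then have X[measurable]: "horizontal j \<phi> \<in> borel_measurable borel" by simp
  note g[measurable]
  have "(\<integral>p. g p * horizontal j \<phi> p \<partial>lborel) = (\<integral>p. g p * horizontal j \<phi> p \<partial>lebesgue)"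
    by (rule integral_completion[symmetric]) measurable
  also have "\<dots> = (\<integral>p. f p * horizontal j \<phi> p \<partial>lebesgue)"
  proof (rule integral_cong_AE)
    have X': "horizontal j \<phi> \<in> borel_measurable lebesgue" and g': "g \<in> borel_measurable lebesgue"
      by (rule measurable_completion; simp add: g X)+
    show "(\<lambda>p. g p * horizontal j \<phi> p) \<in> borel_measurable lebesgue"
      "(\<lambda>p. f p * horizontal j \<phi> p) \<in> borel_measurable lebesgue"
      by (rule borel_measurable_times[OF g' X'] borel_measurable_times[OF f X'])+
    show "AE p in lebesgue. g p * horizontal j \<phi> p = f p * horizontal j \<phi> p"
      using AE_completion[OF fg] by eventually_elim simp
  qed
  also have "\<dots> = - signed_integral \<nu> \<phi>"
    using \<nu> \<phi> by (simp add: has_horizontal_measure_def)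
  finally show ?thesis .
qed

definition variation :: "('a::euclidean_space set \<Rightarrow> real) \<Rightarrow> 'a set \<Rightarrow> ennreal" where
  "variation \<nu> S = emeasure (pos_part \<nu>) S + emeasure (neg_part \<nu>) S"

text \<open>Testing against \<open>\<phi>\<^sub>m\<close>, whose derivative along \<open>X\<^sub>j\<close> tends to the indicator of a box while
  its negative part escapes to infinity and \<open>\<bar>\<phi>\<^sub>m\<bar> \<le> h\<close> on the slab.\<close>

lemma box_estimate:
  fixes f :: "'n::finite heisenberg \<Rightarrow> real"
  assumes tv: "total_variation \<nu> < \<infinity>" and f: "integrable lborel f" and h: "h > 0"
    and weak: "\<And>\<phi>. \<phi> \<in> test_functions \<Longrightarrow>
      (\<integral>p. f p * horizontal j \<phi> p \<partial>lborel) = - signed_integral \<nu> \<phi>"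
  shows "ennreal \<bar>\<integral>p. f p * (indicator {c<..<c + h} (fst p $ j) * indicator (slab j q h) p) \<partial>lborel\<bar>
    \<le> ennreal h * variation \<nu> (slab j q h)"
proof -
  note borel_measurable_integrable[OF f, measurable]
  define M where "M = measure (pos_part \<nu>) (slab j q h) + measure (neg_part \<nu>) (slab j q h)"
  define u where "u m p = f p * ((bump (real m) c (c + h) (fst p $ j) -
      bump (real m) c (c + h) (fst p $ j + real m)) * cutoff j q h (real m) p)" for m p
  have le: "\<bar>\<integral>p. u m p \<partial>lborel\<bar> \<le> h * M" for m
  proof -
    obtain B where B: "\<And>s. (B has_real_derivative bump m c (c + h) s) (at s)"
      "\<And>s. s \<le> c \<Longrightarrow> B s = 0" "\<And>s. s \<ge> c + h \<Longrightarrow> B s = B (c + h)"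
      "\<And>s. 0 \<le> B s" "\<And>s. B s \<le> c + h - c"
      using bump_antiderivative[of "real m" c "c + h"] h by auto
    define \<phi> where "\<phi> = (\<lambda>p. (B (fst p $ j) - B (fst p $ j + real m)) * cutoff j q h (real m) p)"
    have \<phi>: "\<phi> \<in> test_functions" "horizontal j \<phi> p =
        (bump m c (c + h) (fst p $ j) - bump m c (c + h) (fst p $ j + m)) * cutoff j q h m p" for p
      unfolding \<phi>_def using h by (intro test_function_cutoff[OF B(1-3)]; simp)+
    have b: "\<bar>\<phi> p\<bar> \<le> h * indicator (slab j q h) p" for p
    proof (cases "p \<in> slab j q h")
      case True
      have "\<bar>B (fst p $ j) - B (fst p $ j + real m)\<bar> \<le> h"
        using B(4,5)[of "fst p $ j"] B(4,5)[of "fst p $ j + real m"] by linarith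
      moreover have "\<bar>cutoff j q h (real m) p\<bar> \<le> 1"
        using cutoff_bounds[of "real m" j q h p] by simp
      ultimately have "\<bar>\<phi> p\<bar> \<le> h * 1"
        unfolding \<phi>_def abs_mult using h by (intro mult_mono) auto
      with True show ?thesis by simp
    qed (simp add: \<phi>_def cutoff_eq_0)
    have "\<bar>signed_integral \<nu> \<phi>\<bar> \<le> h * M"
      unfolding signed_integral_def M_def distrib_left
      by (rule order_trans[OF abs_triangle_ineq4])
        (intro add_mono abs_integral_le_measure b finite_measure_jordan[OF tv]; simp)
    then show ?thesis
      using weak[OF \<phi>(1)] by (simp add: u_def \<phi>(2))
  qed
  have "(\<lambda>m. \<integral>p. u m p \<partial>lborel) \<longlonglongrightarrow>
     (\<integral>p. f p * (indicator {c<..<c + h} (fst p $ j) * indicator (slab j q h) p) \<partial>lborel)"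
  proof (rule integral_dominated_convergence[where w = "\<lambda>p. \<bar>f p\<bar>"])
    show "integrable lborel (\<lambda>p. \<bar>f p\<bar>)" using f by simp
    show "AE p in lborel. (\<lambda>m. u m p) \<longlonglongrightarrow>
        f p * (indicator {c<..<c + h} (fst p $ j) * indicator (slab j q h) p)"
    proof (rule AE_I2)
      fix p :: "'n heisenberg"
      \<comment> \<open>For a fixed point the translated bump vanishes as soon as \<open>m\<close>
        reaches this threshold; only the bump around the box survives in the limit.\<close>
      obtain K where K: "c + h - fst p $ j \<le> real K" using real_arch_simple by blast
      have "\<forall>\<^sub>F m in sequentially. 0 = bump (real m) c (c + h) (fst p $ j + real m)"
        using eventually_ge_at_top[of K]
      proof eventually_elim
        case (elim m)
        then have "real K \<le> real m" by simp
        with K show ?case by (intro bump_eq_0[symmetric]) auto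
      qed
      from Lim_transform_eventually[OF tendsto_const this]
      have "(\<lambda>m. u m p) \<longlonglongrightarrow> f p * ((indicator {c<..<c + h} (fst p $ j) - 0) * indicator (slab j q h) p)"
        unfolding u_def by (intro tendsto_intros bump_tendsto cutoff_tendsto)
      then show "(\<lambda>m. u m p) \<longlonglongrightarrow> f p * (indicator {c<..<c + h} (fst p $ j) * indicator (slab j q h) p)"
        by simp
    qed
    show "AE p in lborel. norm (u m p) \<le> \<bar>f p\<bar>" for m
    proof (rule AE_I2)
      fix p :: "'n heisenberg"
      have "\<bar>bump (real m) c (c + h) (fst p $ j) - bump (real m) c (c + h) (fst p $ j + real m)\<bar> \<le> 1"
        using bump_bounds[of "real m" c "c + h" "fst p $ j"]
          bump_bounds[of "real m" c "c + h" "fst p $ j + real m"] by auto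
      then have "\<bar>(bump (real m) c (c + h) (fst p $ j) - bump (real m) c (c + h) (fst p $ j + real m))
          * cutoff j q h (real m) p\<bar> \<le> 1"
        unfolding abs_mult using cutoff_bounds[of "real m" j q h p] by (intro mult_le_one) auto
      then show "norm (u m p) \<le> \<bar>f p\<bar>"
        unfolding u_def real_norm_def abs_mult[of "f p"] by (rule mult_left_le) simp
    qed
  qed (unfold u_def, measurable)
  then have "\<bar>\<integral>p. f p * (indicator {c<..<c + h} (fst p $ j) * indicator (slab j q h) p) \<partial>lborel\<bar> \<le> h * M"
    by (rule LIMSEQ_le_const2[OF tendsto_rabs]) (use le in blast)
  then have "ennreal \<bar>\<integral>p. f p * (indicator {c<..<c + h} (fst p $ j) * indicator (slab j q h) p) \<partial>lborel\<bar>
     \<le> ennreal (h * M)" by (rule ennreal_leI)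
  also have "\<dots> = ennreal h * variation \<nu> (slab j q h)"
    using h finite_measure_jordan[OF tv]
    by (simp add: M_def variation_def ennreal_mult finite_measure.emeasure_eq_measure)
  finally show ?thesis .
qed

text \<open>A lower density of the variation measure: the slab has width \<open>h\<close> in 2n
  directions, hence the factor h^(-2n). Taking a liminf avoids any question of convergence: the
  pointwise lower bound passes through it, and Fatou's lemma bounds its integral from above.\<close>

definition slope ::
    "'n + 'n \<Rightarrow> ('n::finite heisenberg set \<Rightarrow> real) \<Rightarrow> 'n heisenberg \<Rightarrow> ennreal" where
  "slope j \<nu> q = liminf (\<lambda>k. ennreal (real (Suc k) ^ CARD('n + 'n)) *
     variation \<nu> (slab j q (inverse (real (Suc k)))))"

lemma slope_cong:
  assumes "\<And>i. i \<noteq> j \<Longrightarrow> fst q $ i = fst q' $ i" "snd q = snd q'"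
  shows "slope j \<nu> q = slope j \<nu> q'"
  using assms by (simp add: slope_def slab_def)

lemma mem_box_shear:
  fixes q :: "'n::finite heisenberg"
  shows "shear j p \<in> box q (q + h *\<^sub>R One) \<longleftrightarrow>
    fst p $ j \<in> {fst q $ j<..<fst q $ j + h} \<and> p \<in> slab j q h"
proof -
  have "shear j p \<in> box q (q + h *\<^sub>R One) \<longleftrightarrow>
      (\<forall>b\<in>Basis. q \<bullet> b < shear j p \<bullet> b \<and> shear j p \<bullet> b < q \<bullet> b + h)"
    unfolding mem_box by (intro ball_cong refl) (simp add: inner_simps inner_sum_left_Basis)
  also have "\<dots> \<longleftrightarrow> (\<forall>i. fst p $ i \<in> {fst q $ i<..<fst q $ i + h}) \<and>
      height j p \<in> {snd q<..<snd q + h}"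
    by (auto simp: Basis_prod_def Basis_vec_def ball_Un inner_prod_def shear_def inner_axis)
  also have "\<dots> \<longleftrightarrow> fst p $ j \<in> {fst q $ j<..<fst q $ j + h} \<and> p \<in> slab j q h"
    by (auto simp: slab_def)
  finally show ?thesis .
qed

definition unshear :: "'n + 'n \<Rightarrow> 'n::finite heisenberg \<Rightarrow> 'n heisenberg" where
  "unshear j q = (fst q, snd q - twist j * (fst q $ j * fst q $ opp j))"

lemma unshear_shear [simp]: "unshear j (shear j p) = p"
  by (simp add: unshear_def shear_def height_def)

lemma measurable_unshear [measurable]:
  "(unshear j :: 'n::finite heisenberg \<Rightarrow> 'n heisenberg) \<in> borel_measurable borel"
  unfolding unshear_def[abs_def]
  by (intro borel_measurable_continuous_onI continuous_intros)

text \<open>The set is open because heights and coordinates are continuous; joint measurability in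
  corner and point is what exchanging the order of integration requires.\<close>

lemma sets_slab_pairs:
  "{z. snd z \<in> slab j (fst z) h} \<in> sets (borel \<Otimes>\<^sub>M (borel :: 'n::finite heisenberg measure))"
proof -
  have "{z. snd z \<in> slab j (fst z) h} =
      (\<Inter>i\<in>UNIV - {j}. {z. fst (fst z) $ i < fst (snd z) $ i} \<inter> {z. fst (snd z) $ i < fst (fst z) $ i + h}) \<inter>
      ({z. snd (fst z) < height j (snd z)} \<inter> {z. height j (snd z) < snd (fst z) + h})"
    by (auto simp: slab_def)
  also have "open \<dots>"
    unfolding height_def by (intro open_Int open_INT open_Collect_less continuous_intros ballI finite)
  finally show ?thesis unfolding borel_prod by (rule borel_open)
qed

lemma measurable_emeasure_slab:
  fixes M :: "'n::finite heisenberg measure"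
  assumes "finite_measure M" "sets M = sets borel"
  shows "(\<lambda>q. emeasure M (slab j q h)) \<in> borel_measurable borel"
proof -
  interpret finite_measure M by fact
  note sets_slab_pairs[of j h]
  also have "sets (borel \<Otimes>\<^sub>M borel) = sets (borel \<Otimes>\<^sub>M M)"
    using assms(2) by (intro sets_pair_measure_cong) auto
  finally have "(\<lambda>q. emeasure M (Pair q -` {z. snd z \<in> slab j (fst z) h})) \<in> borel_measurable borel"
    by (rule measurable_emeasure_Pair)
  then show ?thesis by (simp add: vimage_def)
qed

lemma measurable_variation_slab:
  assumes "total_variation \<nu> < \<infinity>"
  shows "(\<lambda>q. variation \<nu> (slab j q h)) \<in> borel_measurable borel"
  unfolding variation_def
  by (intro borel_measurable_add measurable_emeasure_slab finite_measure_jordan[OF assms]) simp_all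

lemma measurable_slope:
  assumes "total_variation \<nu> < \<infinity>"
  shows "slope j \<nu> \<in> borel_measurable borel"
  unfolding slope_def[abs_def]
  by (intro borel_measurable_liminf borel_measurable_times_ennreal measurable_variation_slab[OF assms]) simp

text \<open>In the straightened coordinates \<open>f\<close> becomes \<open>g\<close>, and almost
  everywhere \<open>g\<close> is the limit of its means over cubes of side \<open>h\<close>. Such a
  mean is h^(-2n-1) times an integral that \<open>box_estimate\<close> bounds by \<open>h\<close>
  times the variation of a slab, which leaves exactly the normalisation of
  \<open>slope\<close>.\<close>

lemma abs_le_slope:
  fixes f :: "'n::finite heisenberg \<Rightarrow> real"
  assumes tv: "total_variation \<nu> < \<infinity>" and f: "integrable lborel f"
    and weak: "\<And>\<phi>. \<phi> \<in> test_functions \<Longrightarrow>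
      (\<integral>p. f p * horizontal j \<phi> p \<partial>lborel) = - signed_integral \<nu> \<phi>"
  shows "AE p in lborel. ennreal \<bar>f p\<bar> \<le> slope j \<nu> (shear j p)"
proof -
  note [measurable] = borel_measurable_integrable[OF f] measurable_slope[OF tv]
  define g where "g = (\<lambda>q. f (unshear j q))"
  have [measurable]: "g \<in> borel_measurable borel" unfolding g_def by measurable
  have g: "integrable lborel g"
    using f integrable_distr_eq[of "shear j" lborel lborel g]
    by (simp add: distr_shear) (simp add: g_def)
  define h where "h k = inverse (real (Suc k))" for k
  have h: "h k > 0" for k by (simp add: h_def)
  \<comment> \<open>Lebesgue's differentiation theorem for cubes with corner
    \<open>x\<close>.\<close>
  obtain N where N: "negligible N"
    "\<And>x e. x \<notin> N \<Longrightarrow> 0 < e \<Longrightarrow> \<exists>d>0. \<forall>h. 0 < h \<and> h < d \<longrightarrow>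
      norm (integral (cbox x (x + h *\<^sub>R One)) g /\<^sub>R h ^ DIM('n heisenberg) - g x) < e"
    using integrable_ccontinuous_explicit[of g] integrable_on_lborel[OF g]
      integrable_on_subcbox by (metis subset_UNIV)
  have int: "integral (cbox q (q + h k *\<^sub>R One)) g =
      (\<integral>p. f p * (indicator {fst q $ j<..<fst q $ j + h k} (fst p $ j) * indicator (slab j q (h k)) p) \<partial>lborel)"
    for q k
  proof -
    have "integral (cbox q (q + h k *\<^sub>R One)) g = integral (box q (q + h k *\<^sub>R One)) g"
      by (rule integral_open_interval[symmetric])
    also have "\<dots> = (LINT x:box q (q + h k *\<^sub>R One)|lborel. g x)"
    proof (rule set_borel_integral_eq_integral(2)[symmetric])
      show "set_integrable lborel (box q (q + h k *\<^sub>R One)) g"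
        unfolding set_integrable_def by (rule integrable_mult_indicator[OF _ g]) simp
    qed
    also have "\<dots> = (\<integral>x. indicator (box q (q + h k *\<^sub>R One)) x * g x \<partial>distr lborel lborel (shear j))"
      by (simp add: set_lebesgue_integral_def distr_shear)
    also have "\<dots> = (\<integral>p. indicator (box q (q + h k *\<^sub>R One)) (shear j p) * g (shear j p) \<partial>lborel)"
      by (rule integral_distr) measurable
    also have "\<dots> = (\<integral>p. f p * (indicator {fst q $ j<..<fst q $ j + h k} (fst p $ j) * indicator (slab j q (h k)) p) \<partial>lborel)"
      by (intro Bochner_Integration.integral_cong refl)
        (auto simp: g_def mem_box_shear indicator_def)
    finally show ?thesis .
  qed
  have le: "ennreal \<bar>g q\<bar> \<le> slope j \<nu> q" if "q \<notin> N" for q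
  proof -
    define X where "X k = integral (cbox q (q + h k *\<^sub>R One)) g /\<^sub>R h k ^ DIM('n heisenberg)" for k
    have "X \<longlonglongrightarrow> g q"
    proof (rule LIMSEQ_I)
      fix e :: real assume "e > 0"
      from N(2)[OF that this] obtain d where d: "d > 0"
        "\<And>h. 0 < h \<Longrightarrow> h < d \<Longrightarrow> norm (integral (cbox q (q + h *\<^sub>R One)) g /\<^sub>R h ^ DIM('n heisenberg) - g q) < e"
        by blast
      obtain n where n: "h n < d"
        using reals_Archimedean[OF d(1)] by (auto simp: h_def)
      have "h k < d" if "k \<ge> n" for k
      proof -
        have "h k \<le> h n" unfolding h_def using that by (intro le_imp_inverse_le) auto
        with n show ?thesis by simp
      qed
      then show "\<exists>no. \<forall>n\<ge>no. norm (X n - g q) < e"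
        using d(2) h unfolding X_def by blast
    qed
    then have "(\<lambda>k. ennreal \<bar>X k\<bar>) \<longlonglongrightarrow> ennreal \<bar>g q\<bar>"
      by (intro tendsto_ennrealI tendsto_rabs)
    then have "ennreal \<bar>g q\<bar> = liminf (\<lambda>k. ennreal \<bar>X k\<bar>)"
      by (rule lim_imp_Liminf[OF sequentially_bot, symmetric])
    also have "\<dots> \<le> slope j \<nu> q"
      unfolding slope_def h_def[symmetric]
    proof (rule Liminf_mono, rule always_eventually, rule allI)
      fix k
      have "ennreal \<bar>X k\<bar> = ennreal (inverse (h k ^ DIM('n heisenberg))) *
          ennreal \<bar>integral (cbox q (q + h k *\<^sub>R One)) g\<bar>"
        using h[of k] by (simp add: X_def abs_mult flip: ennreal_mult)
      also have "\<dots> \<le> ennreal (inverse (h k ^ DIM('n heisenberg))) *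
          (ennreal (h k) * variation \<nu> (slab j q (h k)))"
        unfolding int by (intro mult_left_mono box_estimate[OF tv f h weak]) auto
      also have "\<dots> = ennreal (inverse (h k ^ DIM('n heisenberg)) * h k) * variation \<nu> (slab j q (h k))"
        using h[of k] by (simp add: ennreal_mult mult.assoc)
      also have "inverse (h k ^ DIM('n heisenberg)) * h k = real (Suc k) ^ CARD('n + 'n)"
        using h[of k] by (simp add: h_def power_inverse field_simps)
      finally show "ennreal \<bar>X k\<bar> \<le>
          ennreal (real (Suc k) ^ CARD('n + 'n)) * variation \<nu> (slab j q (h k))" .
    qed
    finally show ?thesis .
  qed
  have "N \<in> null_sets lebesgue" using N(1) by (simp add: negligible_iff_null_sets)
  then have "AE q in lebesgue. ennreal \<bar>g q\<bar> \<le> slope j \<nu> q"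
    by (rule AE_I'[of N]) (use le in auto)
  then have "AE q in lborel. ennreal \<bar>g q\<bar> \<le> slope j \<nu> q"
    by (simp add: AE_completion_iff)
  then have "AE q in distr lborel lborel (shear j). ennreal \<bar>g q\<bar> \<le> slope j \<nu> q"
    by (simp only: distr_shear)
  then have "AE p in lborel. ennreal \<bar>g (shear j p)\<bar> \<le> slope j \<nu> (shear j p)"
    by (rule AE_distrD[rotated]) simp
  then show ?thesis by (simp add: g_def)
qed

text \<open>A corner whose slab contains \<open>p\<close> lies within \<open>h\<close> below
  \<open>p\<close> in each of the 2n remaining coordinates of the straightened picture. Confining
  the free coordinate to the unit interval turns an integral over all variables into one over the
  others, as nothing depends on that coordinate.\<close>

lemma nn_integral_slab:
  fixes p :: "'n::finite heisenberg"
  assumes h: "h > 0"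
  shows "(\<integral>\<^sup>+q. indicator {q. fst q $ j \<in> {0..1}} q * indicator (slab j q h) p \<partial>lborel)
    \<le> ennreal (h ^ CARD('n + 'n))"
proof -
  define l u where "l = (\<chi> i. if i = j then 0 else fst p $ i - h)" and "u = (\<chi> i. if i = j then 1 else fst p $ i)"
  let ?t = "height j p"
  have "(\<integral>\<^sup>+q. indicator {q. fst q $ j \<in> {0..1}} q * indicator (slab j q h) p \<partial>lborel)
     \<le> (\<integral>\<^sup>+q. indicator (cbox l u \<times> {?t - h..?t}) q \<partial>lborel)"
  proof (rule nn_integral_mono)
    fix q :: "'n heisenberg"
    have "q \<in> cbox l u \<times> {?t - h..?t}" if "fst q $ j \<in> {0..1}" "p \<in> slab j q h"
    proof -
      have "fst q $ i \<in> {fst p $ i - h..fst p $ i}" if "i \<noteq> j" for i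
      proof -
        have "fst p $ i \<in> {fst q $ i<..<fst q $ i + h}"
          using \<open>p \<in> slab j q h\<close> that unfolding slab_def by blast
        then show ?thesis by simp
      qed
      then have "fst q \<in> cbox l u"
        using that(1) by (auto simp: mem_box_cart l_def u_def)
      moreover have "snd q \<in> {?t - h..?t}"
        using that(2) by (auto simp: slab_def)
      ultimately show ?thesis by (cases q) simp
    qed
    then show "indicator {q. fst q $ j \<in> {0..1}} q * indicator (slab j q h) p
        \<le> (indicator (cbox l u \<times> {?t - h..?t}) q :: ennreal)"
      by (auto simp: indicator_def)
  qed
  also have "\<dots> = emeasure (lborel \<Otimes>\<^sub>M lborel) (cbox l u \<times> {?t - h..?t})"
    unfolding lborel_prod by (rule nn_integral_indicator) (simp only: sets_lborel, intro borel_closed closed_Times closed_cbox closed_atLeastAtMost)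
  also have "\<dots> = emeasure lborel (cbox l u) * emeasure lborel {?t - h..?t}"
    by (rule lborel.emeasure_pair_measure_Times) auto
  also have "emeasure lborel {?t - h..?t} = ennreal h"
    using h by simp
  also have "emeasure lborel (cbox l u) = ennreal (measure lborel (cbox l u))"
    by (rule emeasure_eq_ennreal_measure) (use emeasure_lborel_cbox_finite[of l u] in simp)
  also have "measure lborel (cbox l u) = (\<Prod>i\<in>UNIV. u $ i - l $ i)"
    using h by (intro content_cbox_cart) (auto simp: interval_eq_empty_cart l_def u_def)
  also have "\<dots> = (\<Prod>i\<in>UNIV. if i = j then 1 else h)"
    by (intro prod.cong) (auto simp: l_def u_def)
  also have "\<dots> = h ^ (CARD('n + 'n) - 1)"
    by (simp add: prod.If_cases Collect_neg_eq card_Diff_singleton Compl_eq_Diff_UNIV)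
  also have "ennreal (h ^ (CARD('n + 'n) - 1)) * ennreal h = ennreal (h ^ CARD('n + 'n))"
    using h power_minus_mult[of "CARD('n + 'n)" h] by (simp flip: ennreal_mult)
  finally show ?thesis .
qed

text \<open>By Tonelli's theorem the integral over corners of the mass of a slab is an integral over
  points of the volume of admissible corners, which is at most h^(2n) for each point.\<close>

lemma nn_integral_emeasure_slab:
  fixes M :: "'n::finite heisenberg measure"
  assumes M: "finite_measure M" "sets M = sets borel" and h: "h > 0"
  shows "(\<integral>\<^sup>+q. indicator {q. fst q $ j \<in> {0..1}} q * emeasure M (slab j q h) \<partial>lborel)
    \<le> ennreal (h ^ CARD('n + 'n)) * emeasure M UNIV"
proof -
  interpret M: finite_measure M by fact
  interpret pair_sigma_finite lborel M by standard
  have [measurable_cong]: "sets M = sets borel" by fact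
  have m: "(\<lambda>(q, p). indicator {q. fst q $ j \<in> {0..1}} q * indicator (slab j q h) p :: ennreal)
      \<in> borel_measurable (lborel \<Otimes>\<^sub>M M)"
  proof -
    have "sets (lborel \<Otimes>\<^sub>M M) = sets (borel \<Otimes>\<^sub>M borel)"
      using M(2) by (intro sets_pair_measure_cong) auto
    moreover have "(\<lambda>(q, p). indicator {q. fst q $ j \<in> {0..1}} q * indicator (slab j q h) p :: ennreal)
      = (\<lambda>z. indicator {z. fst (fst z) $ j \<in> {0..1}} z * indicator {z. snd z \<in> slab j (fst z) h} z)"
      by (auto simp: indicator_def fun_eq_iff)
    moreover have "\<dots> \<in> borel_measurable (borel \<Otimes>\<^sub>M borel)"
      using sets_slab_pairs[of j h] by measurable
    ultimately show ?thesis by (simp cong: measurable_cong_sets)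
  qed
  have "(\<integral>\<^sup>+q. indicator {q. fst q $ j \<in> {0..1}} q * emeasure M (slab j q h) \<partial>lborel) =
     (\<integral>\<^sup>+q. \<integral>\<^sup>+p. indicator {q. fst q $ j \<in> {0..1}} q * indicator (slab j q h) p \<partial>M \<partial>lborel)"
    using M(2) by (intro nn_integral_cong) (simp add: nn_integral_cmult)
  also have "\<dots> = (\<integral>\<^sup>+p. \<integral>\<^sup>+q. indicator {q. fst q $ j \<in> {0..1}} q * indicator (slab j q h) p \<partial>lborel \<partial>M)"
    by (rule Fubini'[OF m, symmetric])
  also have "\<dots> \<le> (\<integral>\<^sup>+p. ennreal (h ^ CARD('n + 'n)) \<partial>M)"
    by (intro nn_integral_mono nn_integral_slab h)
  also have "\<dots> = ennreal (h ^ CARD('n + 'n)) * emeasure M UNIV"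
    using sets_eq_imp_space_eq[OF M(2)] by simp
  finally show ?thesis .
qed

text \<open>Fatou's lemma; the normalisation h^(-2n) cancels the volume of corners at every
  scale.\<close>

lemma nn_integral_slope:
  fixes \<nu> :: "'n::finite heisenberg set \<Rightarrow> real"
  assumes tv: "total_variation \<nu> < \<infinity>"
  shows "(\<integral>\<^sup>+q. indicator {q. fst q $ j \<in> {0..1}} q * slope j \<nu> q \<partial>lborel) \<le> total_variation \<nu>"
proof -
  note [measurable] = measurable_variation_slab[OF tv]
  define h where "h k = inverse (real (Suc k))" for k
  have h: "h k > 0" for k by (simp add: h_def)
  define c where "c k = ennreal (real (Suc k) ^ CARD('n + 'n))" for k
  let ?I = "\<lambda>q::'n heisenberg. indicator {q. fst q $ j \<in> {0..1}} q :: ennreal"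
  have step: "(\<integral>\<^sup>+q. ?I q * (c k * variation \<nu> (slab j q (h k))) \<partial>lborel) \<le> total_variation \<nu>" for k
  proof -
    note fm = finite_measure_jordan[OF tv]
    have m: "(\<lambda>q. ?I q * emeasure (pos_part \<nu>) (slab j q (h k))) \<in> borel_measurable lborel"
      "(\<lambda>q. ?I q * emeasure (neg_part \<nu>) (slab j q (h k))) \<in> borel_measurable lborel"
      by (intro borel_measurable_times_ennreal; simp add: measurable_emeasure_slab fm)+
    have "(\<integral>\<^sup>+q. ?I q * (c k * variation \<nu> (slab j q (h k))) \<partial>lborel) =
        (\<integral>\<^sup>+q. c k * (?I q * emeasure (pos_part \<nu>) (slab j q (h k)) + ?I q * emeasure (neg_part \<nu>) (slab j q (h k))) \<partial>lborel)"
      by (intro nn_integral_cong) (simp add: variation_def algebra_simps)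
    also have "\<dots> = c k * ((\<integral>\<^sup>+q. ?I q * emeasure (pos_part \<nu>) (slab j q (h k)) \<partial>lborel) +
        (\<integral>\<^sup>+q. ?I q * emeasure (neg_part \<nu>) (slab j q (h k)) \<partial>lborel))"
      using m by (subst nn_integral_cmult) (simp_all add: nn_integral_add)
    also have "\<dots> \<le> c k * (ennreal (h k ^ CARD('n + 'n)) * emeasure (pos_part \<nu>) UNIV +
        ennreal (h k ^ CARD('n + 'n)) * emeasure (neg_part \<nu>) UNIV)"
      by (intro mult_left_mono add_mono nn_integral_emeasure_slab fm h) auto
    also have "\<dots> = (c k * ennreal (h k ^ CARD('n + 'n))) * total_variation \<nu>"
      by (simp add: total_variation_def algebra_simps)
    also have "c k * ennreal (h k ^ CARD('n + 'n)) = 1"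
      unfolding c_def h_def by (simp add: power_inverse flip: ennreal_mult)
    finally show ?thesis by simp
  qed
  have "(\<integral>\<^sup>+q. ?I q * slope j \<nu> q \<partial>lborel) =
      (\<integral>\<^sup>+q. liminf (\<lambda>k. ?I q * (c k * variation \<nu> (slab j q (h k)))) \<partial>lborel)"
    by (intro nn_integral_cong) (auto simp: slope_def c_def h_def indicator_def Liminf_const)
  also have "\<dots> \<le> liminf (\<lambda>k. \<integral>\<^sup>+q. ?I q * (c k * variation \<nu> (slab j q (h k))) \<partial>lborel)"
    by (intro nn_integral_liminf) measurable
  also have "\<dots> \<le> liminf (\<lambda>k::nat. total_variation \<nu>)"
    by (intro Liminf_mono always_eventually allI step)
  finally show ?thesis by (simp add: Liminf_const)
qed

section \<open>Hoelder's and Finner's inequalities\<close>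

text \<open>With the values 0 at 0 and \<open>top\<close> at \<open>top\<close> for every exponent,
  zero and negative ones included, products and sums of exponents obey the usual laws without side
  conditions. The price is that \<open>epowr 0 0\<close> is 0 rather than 1.\<close>

definition epowr :: "ennreal \<Rightarrow> real \<Rightarrow> ennreal" where
  "epowr x a = (if x = top then top else ennreal (enn2real x powr a))"

lemma epowr_0 [simp]: "epowr 0 a = 0"
  by (simp add: epowr_def)

lemma epowr_top [simp]: "epowr top a = top"
  by (simp add: epowr_def)

lemma epowr_ennreal: "x \<ge> 0 \<Longrightarrow> epowr (ennreal x) a = ennreal (x powr a)"
  by (simp add: epowr_def)

lemma epowr_eq_0_iff [simp]: "epowr x a = 0 \<longleftrightarrow> x = 0"
  by (cases x) (auto simp: epowr_ennreal)

lemma epowr_eq_top_iff [simp]: "epowr x a = top \<longleftrightarrow> x = top"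
  by (simp add: epowr_def)

lemma epowr_mult: "epowr (x * y) a = epowr x a * epowr y a"
proof (cases "x = top \<or> y = top")
  case True
  then show ?thesis by (auto simp: ennreal_top_mult ennreal_mult_top)
next
  case False
  then obtain r s where "x = ennreal r" "0 \<le> r" "y = ennreal s" "0 \<le> s"
    by (metis ennreal_cases)
  then show ?thesis
    by (simp add: epowr_ennreal powr_mult flip: ennreal_mult)
qed

lemma epowr_prod: "epowr (\<Prod>i\<in>S. f i) a = (\<Prod>i\<in>S. epowr (f i) a)"
  by (induction S rule: infinite_finite_induct)
    (simp_all add: epowr_mult, simp_all add: epowr_def)

lemma epowr_mono: "a \<ge> 0 \<Longrightarrow> x \<le> y \<Longrightarrow> epowr x a \<le> epowr y a"
  by (cases x; cases y) (auto simp: epowr_ennreal powr_mono2 ennreal_leI top_unique)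

lemma epowr_add: "epowr x (a + b) = epowr x a * epowr x b"
  by (cases x) (simp_all add: epowr_ennreal powr_add ennreal_mult)

lemma epowr_epowr: "epowr (epowr x a) b = epowr x (a * b)"
  by (cases x) (simp_all add: epowr_ennreal powr_powr)

lemma epowr_one [simp]: "epowr x 1 = x"
  by (cases x) (simp_all add: epowr_ennreal)

lemma epowr_numeral: "epowr x (numeral n) = x ^ numeral n"
proof (cases x)
  case top
  have "(top :: ennreal) ^ Suc k = top" for k
    by (induction k) (simp_all add: ennreal_mult_top)
  then show ?thesis using top by (simp add: numeral_eq_Suc)
qed (simp add: epowr_ennreal powr_numeral ennreal_power)

lemma epowr_measurable [measurable (raw)]:
  assumes [measurable]: "f \<in> borel_measurable M"
  shows "(\<lambda>x. epowr (f x) a) \<in> borel_measurable M"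
  unfolding epowr_def by measurable

text \<open>Convexity of the exponential at the logarithms of the \<open>a i\<close>; a vanishing
  \<open>a i\<close> makes the left side 0.\<close>

lemma weighted_arith_geom_mean:
  fixes a :: "'i \<Rightarrow> real"
  assumes S: "finite S" and w: "\<And>i. i \<in> S \<Longrightarrow> w i > 0" "(\<Sum>i\<in>S. w i) = 1"
    and a: "\<And>i. i \<in> S \<Longrightarrow> a i \<ge> 0"
  shows "(\<Prod>i\<in>S. a i powr w i) \<le> (\<Sum>i\<in>S. w i * a i)"
proof (cases "\<exists>i\<in>S. a i = 0")
  case True
  then have "(\<Prod>i\<in>S. a i powr w i) = 0"
    using S by (intro prod_zero) auto
  moreover have "0 \<le> (\<Sum>i\<in>S. w i * a i)"
    by (intro sum_nonneg mult_nonneg_nonneg) (simp_all add: w a less_imp_le)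
  ultimately show ?thesis by simp
next
  case False
  then have pos: "a i > 0" if "i \<in> S" for i using a[OF that] that by force
  have "S \<noteq> {}" using w(2) by auto
  have "(\<Prod>i\<in>S. a i powr w i) = exp (\<Sum>i\<in>S. w i * ln (a i))"
    using S pos by (simp add: exp_sum powr_def) (auto intro!: prod.cong dest: pos)
  also have "\<dots> \<le> (\<Sum>i\<in>S. w i * exp (ln (a i)))"
    using convex_on_sum[OF S \<open>S \<noteq> {}\<close> exp_convex w(2), of "\<lambda>i. ln (a i)"] w(1)
    by (simp add: less_imp_le)
  also have "\<dots> = (\<Sum>i\<in>S. w i * a i)"
    using pos by (intro sum.cong) simp_all
  finally show ?thesis .
qed

lemma weighted_arith_geom_mean_ennreal:
  assumes S: "finite S" and w: "\<And>i. i \<in> S \<Longrightarrow> w i > 0" "(\<Sum>i\<in>S. w i) = 1"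
  shows "(\<Prod>i\<in>S. epowr (a i) (w i)) \<le> (\<Sum>i\<in>S. ennreal (w i) * a i)"
proof (cases "\<exists>i\<in>S. a i = top")
  case True
  then obtain i where i: "i \<in> S" "a i = top" by auto
  have "top = ennreal (w i) * a i" using w(1)[OF i(1)] i(2) by (simp add: ennreal_mult_top)
  also have "\<dots> \<le> (\<Sum>i\<in>S. ennreal (w i) * a i)"
    using S i by (intro member_le_sum) auto
  finally show ?thesis by (simp add: top_unique)
next
  case False
  define b where "b i = enn2real (a i)" for i
  have a: "a i = ennreal (b i)" if "i \<in> S" for i
    using False that by (simp add: b_def top.not_eq_extremum)
  have b: "b i \<ge> 0" for i by (simp add: b_def)
  have "(\<Prod>i\<in>S. epowr (a i) (w i)) = (\<Prod>i\<in>S. ennreal (b i powr w i))"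
    by (intro prod.cong) (simp_all add: a b epowr_ennreal)
  also have "\<dots> = ennreal (\<Prod>i\<in>S. b i powr w i)"
    by (rule prod_ennreal) simp
  also have "\<dots> \<le> ennreal (\<Sum>i\<in>S. w i * b i)"
    by (intro ennreal_leI weighted_arith_geom_mean S w b)
  also have "\<dots> = (\<Sum>i\<in>S. ennreal (w i * b i))"
    using w(1) b by (intro sum_ennreal[symmetric] mult_nonneg_nonneg) (auto intro: less_imp_le)
  also have "\<dots> = (\<Sum>i\<in>S. ennreal (w i) * a i)"
    using w(1) b by (intro sum.cong) (auto simp: a ennreal_mult less_imp_le)
  finally show ?thesis .
qed

text \<open>After division by the integrals \<open>A i\<close> the weighted inequality of means
  holds pointwise, and its right side integrates to the sum of the weights, which is 1.\<close>

lemma nn_integral_Holder: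
  assumes S: "finite S" and w: "\<And>i. i \<in> S \<Longrightarrow> w i > 0" "(\<Sum>i\<in>S. w i) = 1"
    and f[measurable]: "\<And>i. i \<in> S \<Longrightarrow> f i \<in> borel_measurable M"
  shows "(\<integral>\<^sup>+x. (\<Prod>i\<in>S. epowr (f i x) (w i)) \<partial>M) \<le> (\<Prod>i\<in>S. epowr (\<integral>\<^sup>+x. f i x \<partial>M) (w i))"
proof -
  define A where "A i = (\<integral>\<^sup>+x. f i x \<partial>M)" for i
  \<comment> \<open>A vanishing integral is treated before an infinite one: if both occur, the right
    side is 0 by the convention for 0 times \<open>top\<close>, and the left side must be shown to
    vanish.\<close>
  consider i where "i \<in> S" "A i = 0" | "\<And>i. i \<in> S \<Longrightarrow> A i \<noteq> 0" "\<exists>i\<in>S. A i = top"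
    | "\<And>i. i \<in> S \<Longrightarrow> A i \<noteq> 0" "\<And>i. i \<in> S \<Longrightarrow> A i \<noteq> top" by blast
  then show ?thesis
  proof cases
    case 1
    then have "AE x in M. f i x = 0"
      using f[of i] by (simp add: A_def nn_integral_0_iff_AE)
    then have "AE x in M. (\<Prod>i\<in>S. epowr (f i x) (w i)) = 0"
    proof eventually_elim
      case (elim x)
      then show ?case using S 1(1) by (intro prod_zero) auto
    qed
    then have "(\<integral>\<^sup>+x. (\<Prod>i\<in>S. epowr (f i x) (w i)) \<partial>M) = 0"
      by (subst nn_integral_0_iff_AE) (auto intro!: borel_measurable_prod)
    then show ?thesis by simp
  next
    case 2
    then obtain i where i: "i \<in> S" "A i = top" by auto
    have "(\<Prod>i\<in>S. epowr (A i) (w i)) = epowr (A i) (w i) * (\<Prod>i\<in>S - {i}. epowr (A i) (w i))"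
      using S i(1) by (rule prod.remove)
    also have "\<dots> = top"
      using i(2) 2(1) S by (simp add: ennreal_top_mult)
    finally show ?thesis by (simp add: A_def)
  next
    case 3
    have split: "f i x = A i * (f i x / A i)" if "i \<in> S" for i x
      using 3(1)[OF that] 3(2)[OF that]
      by (simp add: ennreal_times_divide ennreal_mult_divide_eq mult.commute[of "A i"] top.not_eq_extremum)
    have "(\<integral>\<^sup>+x. (\<Prod>i\<in>S. epowr (f i x) (w i)) \<partial>M) \<le>
        (\<integral>\<^sup>+x. (\<Prod>i\<in>S. epowr (A i) (w i)) * (\<Sum>i\<in>S. ennreal (w i) * (f i x / A i)) \<partial>M)"
    proof (rule nn_integral_mono)
      fix x
      have "(\<Prod>i\<in>S. epowr (f i x) (w i)) = (\<Prod>i\<in>S. epowr (A i) (w i) * epowr (f i x / A i) (w i))"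
        by (intro prod.cong refl) (metis split epowr_mult)
      also have "\<dots> = (\<Prod>i\<in>S. epowr (A i) (w i)) * (\<Prod>i\<in>S. epowr (f i x / A i) (w i))"
        by (rule prod.distrib)
      also have "\<dots> \<le> (\<Prod>i\<in>S. epowr (A i) (w i)) * (\<Sum>i\<in>S. ennreal (w i) * (f i x / A i))"
        by (intro mult_left_mono weighted_arith_geom_mean_ennreal S w) auto
      finally show "(\<Prod>i\<in>S. epowr (f i x) (w i)) \<le>
        (\<Prod>i\<in>S. epowr (A i) (w i)) * (\<Sum>i\<in>S. ennreal (w i) * (f i x / A i))" .
    qed
    also have "\<dots> = (\<Prod>i\<in>S. epowr (A i) (w i)) * (\<Sum>i\<in>S. ennreal (w i) * (A i / A i))"
      by (simp add: nn_integral_cmult nn_integral_sum nn_integral_divide A_def cong: sum.cong)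
    also have "(\<Sum>i\<in>S. ennreal (w i) * (A i / A i)) = (\<Sum>i\<in>S. ennreal (w i))"
      using 3 by (intro sum.cong) (auto simp: ennreal_divide_self top.not_eq_extremum)
    also have "\<dots> = 1"
      using w by (subst sum_ennreal) (auto intro: less_imp_le)
    finally show ?thesis by (simp add: A_def)
  qed
qed

text \<open>Finner's inequality. A function that does not depend on the coordinate \<open>c\<close> is integrated
  against a probability measure in that coordinate, so that all integrals run over the same
  product space.\<close>

lemma Finner:
  fixes f :: "'i \<Rightarrow> ('c \<Rightarrow> real) \<Rightarrow> ennreal" and M :: "'i \<Rightarrow> 'c \<Rightarrow> real measure"
  assumes J: "finite J" and S: "finite S" and w: "\<And>i. i \<in> S \<Longrightarrow> w i > 0"
    and sf: "\<And>c. sigma_finite_measure (N c)" "\<And>i c. sigma_finite_measure (M i c)"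
    and sets: "\<And>c. sets (N c) = sets borel" "\<And>i c. sets (M i c) = sets borel"
    and D: "\<And>c. c \<in> J \<Longrightarrow> D c \<subseteq> S" "\<And>c. c \<in> J \<Longrightarrow> (\<Sum>i\<in>D c. w i) = 1"
    and MD: "\<And>c i. c \<in> J \<Longrightarrow> i \<in> D c \<Longrightarrow> M i c = N c"
    and M1: "\<And>c i. c \<in> J \<Longrightarrow> i \<in> S - D c \<Longrightarrow> emeasure (M i c) UNIV = 1"
    and f: "\<And>i. i \<in> S \<Longrightarrow> f i \<in> borel_measurable (PiM J (\<lambda>_. borel))"
    and indep: "\<And>c i x y. c \<in> J \<Longrightarrow> i \<in> S - D c \<Longrightarrow> f i (x(c := y)) = f i x"
  shows "(\<integral>\<^sup>+x. (\<Prod>i\<in>S. epowr (f i x) (w i)) \<partial>PiM J N) \<le> (\<Prod>i\<in>S. epowr (\<integral>\<^sup>+x. f i x \<partial>PiM J (M i)) (w i))"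
  using J D MD M1 f indep
proof (induction J arbitrary: f rule: finite_induct)
  case empty
  interpret N: product_sigma_finite N by (rule product_sigma_finite.intro) (rule sf(1))
  have M: "product_sigma_finite (M i)" for i by (rule product_sigma_finite.intro) (rule sf(2))
  show ?case
    by (simp add: N.nn_integral_empty product_sigma_finite.nn_integral_empty[OF M])
next
  case (insert c J)
  interpret N: product_sigma_finite N by (rule product_sigma_finite.intro) (rule sf(1))
  have M: "product_sigma_finite (M i)" for i by (rule product_sigma_finite.intro) (rule sf(2))
  have eqN: "borel_measurable (PiM K N) = borel_measurable (PiM K (\<lambda>_. borel))" for K :: "'c set"
    by (intro measurable_cong_sets sets_PiM_cong refl sets(1))
  have eqM: "borel_measurable (PiM K (M i)) = borel_measurable (PiM K (\<lambda>_. borel))" for i and K :: "'c set"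
    by (intro measurable_cong_sets sets_PiM_cong refl sets(2))
  have f: "f i \<in> borel_measurable (PiM (insert c J) (\<lambda>_. borel))" if "i \<in> S" for i
    using insert.prems(5) that by blast
  define F where "F i x = (\<integral>\<^sup>+y. f i (x(c := y)) \<partial>M i c)" for i x
  have upd: "(\<lambda>y. f i (x(c := y))) \<in> borel_measurable borel" if "i \<in> S" "x \<in> space (PiM J (\<lambda>_. borel))" for i x
    using measurable_comp[OF measurable_component_update[OF that(2) insert.hyps(2)] f[OF that(1)]]
    by (simp add: comp_def)
  have F: "F i \<in> borel_measurable (PiM J (\<lambda>_. borel))" if "i \<in> S" for i
  proof -
    interpret sigma_finite_measure "M i c" by (rule sf)
    have "(\<lambda>z. f i ((fst z)(c := snd z))) \<in> borel_measurable (PiM J (\<lambda>_. borel) \<Otimes>\<^sub>M borel)"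
      using measurable_comp[OF measurable_add_dim f[OF that]] by (simp add: comp_def split_beta)
    then have "(\<lambda>z. f i ((fst z)(c := snd z))) \<in> borel_measurable (PiM J (\<lambda>_. borel) \<Otimes>\<^sub>M M i c)"
      by (subst measurable_cong_sets[OF sets_pair_measure_cong[OF refl sets(2)] refl])
    then show ?thesis
      unfolding F_def by (intro borel_measurable_nn_integral) (simp add: split_beta)
  qed
  have space: "space (PiM J N) = space (PiM J (\<lambda>_. borel))"
    by (intro sets_eq_imp_space_eq sets_PiM_cong refl sets(1))
  have Dc: "finite (D c)" "D c \<subseteq> S" using insert.prems(1) S finite_subset by blast+
  \<comment> \<open>In the coordinate \<open>c\<close> the factors outside \<open>D c\<close> are
    constant and equal to their own means under a probability measure; the others have weights of
    sum 1, so Hoelder's inequality applies to them.\<close>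
  have inner: "(\<integral>\<^sup>+y. (\<Prod>i\<in>S. epowr (f i (x(c := y))) (w i)) \<partial>N c) \<le> (\<Prod>i\<in>S. epowr (F i x) (w i))"
    if x: "x \<in> space (PiM J N)" for x
  proof -
    have m: "(\<lambda>y. f i (x(c := y))) \<in> borel_measurable (N c)" if "i \<in> S" for i
      using upd[OF that] x by (simp add: space measurable_cong_sets[OF sets(1) refl])
    have const: "f i (x(c := y)) = F i x" if "i \<in> S - D c" for i y
    proof -
      have "f i (x(c := z)) = f i x" for z
        using insert.prems(6)[of c i] that by blast
      moreover have "emeasure (M i c) (space (M i c)) = 1"
        using insert.prems(4)[of c i] that sets_eq_imp_space_eq[OF sets(2)[of i c]] by simp
      ultimately show ?thesis by (simp add: F_def)
    qed
    have prod_split: "(\<Prod>i\<in>S. g i) = (\<Prod>i\<in>S - D c. g i) * (\<Prod>i\<in>D c. g i)" for g :: "'i \<Rightarrow> ennreal"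
      using prod.subset_diff[OF Dc(2) S] .
    have "(\<integral>\<^sup>+y. (\<Prod>i\<in>S. epowr (f i (x(c := y))) (w i)) \<partial>N c) =
        (\<integral>\<^sup>+y. (\<Prod>i\<in>S - D c. epowr (F i x) (w i)) * (\<Prod>i\<in>D c. epowr (f i (x(c := y))) (w i)) \<partial>N c)"
      unfolding prod_split by (simp add: const)
    also have "\<dots> = (\<Prod>i\<in>S - D c. epowr (F i x) (w i)) *
        (\<integral>\<^sup>+y. (\<Prod>i\<in>D c. epowr (f i (x(c := y))) (w i)) \<partial>N c)"
      using m Dc by (intro nn_integral_cmult borel_measurable_prod_ennreal epowr_measurable) auto
    also have "\<dots> \<le> (\<Prod>i\<in>S - D c. epowr (F i x) (w i)) *
        (\<Prod>i\<in>D c. epowr (\<integral>\<^sup>+y. f i (x(c := y)) \<partial>N c) (w i))"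
      using m Dc w insert.prems(2)[of c]
      by (intro mult_left_mono nn_integral_Holder) auto
    also have "(\<Prod>i\<in>D c. epowr (\<integral>\<^sup>+y. f i (x(c := y)) \<partial>N c) (w i)) = (\<Prod>i\<in>D c. epowr (F i x) (w i))"
      using insert.prems(3) by (intro prod.cong refl) (simp add: F_def)
    finally show ?thesis unfolding prod_split .
  qed
  have "(\<integral>\<^sup>+x. (\<Prod>i\<in>S. epowr (f i x) (w i)) \<partial>PiM (insert c J) N) =
      (\<integral>\<^sup>+x. \<integral>\<^sup>+y. (\<Prod>i\<in>S. epowr (f i (x(c := y))) (w i)) \<partial>N c \<partial>PiM J N)"
    using insert.hyps f
    by (intro N.product_nn_integral_insert borel_measurable_prod_ennreal epowr_measurable) (auto simp: eqN)
  also have "\<dots> \<le> (\<integral>\<^sup>+x. (\<Prod>i\<in>S. epowr (F i x) (w i)) \<partial>PiM J N)"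
    by (intro nn_integral_mono inner)
  also have "\<dots> \<le> (\<Prod>i\<in>S. epowr (\<integral>\<^sup>+x. F i x \<partial>PiM J (M i)) (w i))"
  proof (rule insert.IH)
    fix d i x y assume d: "d \<in> J" "i \<in> S - D d"
    then have "d \<noteq> c" using insert.hyps(2) by auto
    then have "f i (x(d := y, c := z)) = f i (x(c := z))" for z
      using d insert.prems(6)[of d i "x(c := z)" y] by (metis fun_upd_twist insertI2)
    then show "F i (x(d := y)) = F i x" by (simp add: F_def)
  qed (use insert.prems F in auto)
  also have "\<dots> = (\<Prod>i\<in>S. epowr (\<integral>\<^sup>+x. f i x \<partial>PiM (insert c J) (M i)) (w i))"
    using insert.hyps f
    by (intro prod.cong refl) (simp add: F_def eqM product_sigma_finite.product_nn_integral_insert[OF M])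
  finally show ?case .
qed

section \<open>Incidences of points and lines in the plane\<close>

text \<open>If the mass of \<open>u\<close> is at most 3\<delta>, the first term suffices. Otherwise
  the interval of length 2\<delta> around any \<open>y\<close> holds mass at most 2\<delta>, since
  \<open>u\<close> is at most 1, and mass at least \<delta> remains at distance greater than
  \<delta> from \<open>y\<close>.\<close>

lemma line_integral_le:
  fixes u :: "real \<Rightarrow> ennreal"
  assumes [measurable]: "u \<in> borel_measurable borel" and u: "\<And>y. u y \<le> 1" and \<delta>: "\<delta> > 0"
  shows "ennreal \<delta> * (\<integral>\<^sup>+y. u y \<partial>lborel) \<le> ennreal (3 * \<delta>\<^sup>2) +
    (\<integral>\<^sup>+y. \<integral>\<^sup>+z. u y * u z * indicator {z. \<bar>y - z\<bar> > \<delta>} z \<partial>lborel \<partial>lborel)"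
proof -
  define R where "R = (\<integral>\<^sup>+y. u y \<partial>lborel)"
  define S where "S y = (\<integral>\<^sup>+z. u z * indicator {z. \<bar>y - z\<bar> > \<delta>} z \<partial>lborel)" for y
  have S: "R \<le> S y + ennreal (2 * \<delta>)" for y
  proof -
    have "R \<le> (\<integral>\<^sup>+z. u z * indicator {z. \<bar>y - z\<bar> > \<delta>} z + indicator {y - \<delta>..y + \<delta>} z \<partial>lborel)"
      unfolding R_def using u by (intro nn_integral_mono) (auto simp: indicator_def)
    also have "\<dots> = S y + ennreal (2 * \<delta>)"
      unfolding S_def using \<delta> by (subst nn_integral_add) simp_all
    finally show ?thesis .
  qed
  have P: "(\<integral>\<^sup>+y. \<integral>\<^sup>+z. u y * u z * indicator {z. \<bar>y - z\<bar> > \<delta>} z \<partial>lborel \<partial>lborel) = (\<integral>\<^sup>+y. u y * S y \<partial>lborel)"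
    by (simp add: S_def mult.assoc nn_integral_cmult)
  show ?thesis
  proof (cases "R \<le> ennreal (3 * \<delta>)")
    case True
    then have "ennreal \<delta> * R \<le> ennreal \<delta> * ennreal (3 * \<delta>)" by (rule mult_left_mono) simp
    also have "\<dots> = ennreal (3 * \<delta>\<^sup>2)"
      using \<delta> by (simp add: power2_eq_square algebra_simps flip: ennreal_mult)
    finally show ?thesis unfolding R_def by (simp add: add_increasing2)
  next
    case False
    have "ennreal \<delta> \<le> S y" for y
    proof (rule ccontr)
      assume "\<not> ennreal \<delta> \<le> S y"
      then have "S y \<le> ennreal \<delta>" by simp
      then have "S y + ennreal (2 * \<delta>) \<le> ennreal \<delta> + ennreal (2 * \<delta>)" by (rule add_right_mono)
      also have "\<dots> = ennreal (3 * \<delta>)" using \<delta> by (simp flip: ennreal_plus)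
      finally show False using S[of y] False by (meson order_trans)
    qed
    then have "(\<integral>\<^sup>+y. ennreal \<delta> * u y \<partial>lborel) \<le> (\<integral>\<^sup>+y. u y * S y \<partial>lborel)"
      by (intro nn_integral_mono) (simp add: mult.commute mult_right_mono)
    then show ?thesis unfolding P by (simp add: nn_integral_cmult add_increasing)
  qed
qed

context
  fixes g b :: "real \<times> real \<Rightarrow> ennreal"
  assumes g [measurable]: "g \<in> borel_measurable (borel \<Otimes>\<^sub>M borel)"
    and b [measurable]: "b \<in> borel_measurable (borel \<Otimes>\<^sub>M borel)"
    and g1: "\<And>p. g p \<le> 1" and b1: "\<And>p. b p \<le> 1"
begin

text \<open>A pair (slope, intercept) is determined by the ordinates of its line over two abscissae
  y and z. The Jacobian of this substitution is \<bar>z - y\<bar>, which exceeds \<delta> on the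
  pairs that are kept; what results is a product of two integrals of \<open>g\<close>.\<close>

lemma planar_pairs:
  assumes \<delta>: "\<delta> > 0"
  shows "ennreal \<delta> * (\<integral>\<^sup>+p. \<integral>\<^sup>+y. \<integral>\<^sup>+z. g (y, snd p + fst p * y) * g (z, snd p + fst p * z) *
      indicator {z. \<bar>y - z\<bar> > \<delta>} z \<partial>lborel \<partial>lborel \<partial>lborel) \<le> (\<integral>\<^sup>+p. g p \<partial>lborel)\<^sup>2"
proof -
  have gb [measurable]: "g \<in> borel_measurable borel" using g by (simp add: borel_prod)
  define H where "H p q = g (fst q, snd p + fst p * fst q) * g (snd q, snd p + fst p * snd q) *
    indicator {q. \<bar>fst q - snd q\<bar> > \<delta>} q" for p q :: "real \<times> real"
  have H: "(\<lambda>(p, q). H p q) \<in> borel_measurable ((borel \<Otimes>\<^sub>M borel) \<Otimes>\<^sub>M (borel \<Otimes>\<^sub>M borel))"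
    unfolding H_def by measurable
  then have H' [measurable]: "(\<lambda>(p, q). H p q) \<in> borel_measurable (borel \<Otimes>\<^sub>M borel)"
    unfolding borel_prod[where 'a=real and 'b=real] .
  define a where "a y = (\<integral>\<^sup>+s. g (y, s) \<partial>lborel)" for y
  have a [measurable]: "a \<in> borel_measurable borel" unfolding a_def by measurable
  have inner: "ennreal \<delta> * (\<integral>\<^sup>+p. H p (y, z) \<partial>lborel) \<le> a y * a z" for y z
  proof (cases "\<bar>y - z\<bar> > \<delta>")
    case True
    have "(\<integral>\<^sup>+p. H p (y, z) \<partial>lborel) = (\<integral>\<^sup>+x. \<integral>\<^sup>+t. H (x, t) (y, z) \<partial>lborel \<partial>lborel)"
      by (rule nn_integral_lborel_pair) measurable
    also have "\<dots> = (\<integral>\<^sup>+x. \<integral>\<^sup>+t. g (y, t) * g (z, t + x * (z - y)) \<partial>lborel \<partial>lborel)"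
    proof (rule nn_integral_cong)
      fix x
      have "(\<integral>\<^sup>+t. H (x, t) (y, z) \<partial>lborel) =
          (\<integral>\<^sup>+t. g (y, t + x * y) * g (z, (t + x * y) + x * (z - y)) \<partial>lborel)"
        using True by (simp add: H_def algebra_simps)
      also have "\<dots> = (\<integral>\<^sup>+t. g (y, t) * g (z, t + x * (z - y)) \<partial>lborel)"
        by (rule nn_integral_lborel_translate) measurable
      finally show "(\<integral>\<^sup>+t. H (x, t) (y, z) \<partial>lborel) = (\<integral>\<^sup>+t. g (y, t) * g (z, t + x * (z - y)) \<partial>lborel)" .
    qed
    also have "\<dots> = (\<integral>\<^sup>+t. \<integral>\<^sup>+x. g (y, t) * g (z, t + x * (z - y)) \<partial>lborel \<partial>lborel)"
      by (rule lborel_pair.Fubini') measurable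
    also have "\<dots> = (\<integral>\<^sup>+t. g (y, t) * (\<integral>\<^sup>+x. g (z, t + (z - y) * x) \<partial>lborel) \<partial>lborel)"
      by (simp add: nn_integral_cmult mult.commute)
    finally have eq: "(\<integral>\<^sup>+p. H p (y, z) \<partial>lborel) =
      (\<integral>\<^sup>+t. g (y, t) * (\<integral>\<^sup>+x. g (z, t + (z - y) * x) \<partial>lborel) \<partial>lborel)" .
    have "ennreal \<delta> * (\<integral>\<^sup>+x. g (z, t + (z - y) * x) \<partial>lborel) \<le> a z" for t
    proof -
      have "ennreal \<delta> * (\<integral>\<^sup>+x. g (z, t + (z - y) * x) \<partial>lborel) \<le>
          ennreal \<bar>z - y\<bar> * (\<integral>\<^sup>+x. g (z, t + (z - y) * x) \<partial>lborel)"
        using True by (intro mult_right_mono ennreal_leI) auto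
      also have "\<dots> = a z"
        unfolding a_def using True \<delta> by (intro nn_integral_real_affine[symmetric]) auto
      finally show ?thesis .
    qed
    then have "(\<integral>\<^sup>+t. g (y, t) * (ennreal \<delta> * (\<integral>\<^sup>+x. g (z, t + (z - y) * x) \<partial>lborel)) \<partial>lborel) \<le>
        (\<integral>\<^sup>+t. g (y, t) * a z \<partial>lborel)"
      by (intro nn_integral_mono mult_left_mono) auto
    also have "\<dots> = a y * a z"
      by (simp add: nn_integral_multc a_def)
    finally show ?thesis
      unfolding eq by (subst nn_integral_cmult[symmetric]) (simp_all add: mult.left_commute)
  qed (simp add: H_def)
  have "(\<integral>\<^sup>+p. \<integral>\<^sup>+y. \<integral>\<^sup>+z. g (y, snd p + fst p * y) * g (z, snd p + fst p * z) *
      indicator {z. \<bar>y - z\<bar> > \<delta>} z \<partial>lborel \<partial>lborel \<partial>lborel) = (\<integral>\<^sup>+p. \<integral>\<^sup>+q. H p q \<partial>lborel \<partial>lborel)"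
  proof (rule nn_integral_cong)
    fix p :: "real \<times> real"
    have "(\<integral>\<^sup>+q. H p q \<partial>lborel) = (\<integral>\<^sup>+y. \<integral>\<^sup>+z. H p (y, z) \<partial>lborel \<partial>lborel)"
      by (rule nn_integral_lborel_pair) measurable
    then show "(\<integral>\<^sup>+y. \<integral>\<^sup>+z. g (y, snd p + fst p * y) * g (z, snd p + fst p * z) *
      indicator {z. \<bar>y - z\<bar> > \<delta>} z \<partial>lborel \<partial>lborel) = (\<integral>\<^sup>+q. H p q \<partial>lborel)"
      by (simp add: H_def indicator_def)
  qed
  also have "\<dots> = (\<integral>\<^sup>+q. \<integral>\<^sup>+p. H p q \<partial>lborel \<partial>lborel)"
    by (rule lborel_pair.Fubini'[symmetric]) measurable
  also have "ennreal \<delta> * \<dots> = (\<integral>\<^sup>+q. ennreal \<delta> * (\<integral>\<^sup>+p. H p q \<partial>lborel) \<partial>lborel)"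
    by (rule nn_integral_cmult[symmetric]) measurable
  also have "\<dots> \<le> (\<integral>\<^sup>+q. a (fst q) * a (snd q) \<partial>lborel)"
    using inner by (intro nn_integral_mono) (metis prod.collapse)
  also have "\<dots> = (\<integral>\<^sup>+y. \<integral>\<^sup>+z. a y * a z \<partial>lborel \<partial>lborel)"
  proof -
    have "(\<lambda>q. a (fst q) * a (snd q)) \<in> borel_measurable (borel \<Otimes>\<^sub>M borel)" by measurable
    then show ?thesis by (subst nn_integral_lborel_pair) (simp_all add: borel_prod)
  qed
  also have "\<dots> = (\<integral>\<^sup>+y. a y \<partial>lborel)\<^sup>2"
    by (simp add: nn_integral_cmult nn_integral_multc power2_eq_square)
  also have "(\<integral>\<^sup>+y. a y \<partial>lborel) = (\<integral>\<^sup>+p. g p \<partial>lborel)"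
    unfolding a_def by (rule nn_integral_lborel_pair[symmetric]) measurable
  finally show ?thesis .
qed

text \<open>\<open>g\<close> is a weight on points and \<open>b\<close> a weight on lines, a line
  being given by slope and intercept. The estimate on each line is integrated against
  \<open>b\<close>; bounding \<open>b\<close> by 1 in the term with pairs leaves exactly the
  quantity of \<open>planar_pairs\<close>.\<close>

lemma planar_incidence:
  assumes \<delta>: "\<delta> > 0"
  shows "ennreal (\<delta>\<^sup>2) * (\<integral>\<^sup>+p. b p * (\<integral>\<^sup>+y. g (y, snd p + fst p * y) \<partial>lborel) \<partial>lborel) \<le>
    ennreal (3 * \<delta> ^ 3) * (\<integral>\<^sup>+p. b p \<partial>lborel) + (\<integral>\<^sup>+p. g p \<partial>lborel)\<^sup>2"
proof -
  have bb [measurable]: "b \<in> borel_measurable borel" using b by (simp add: borel_prod)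
  define P where "P p = (\<integral>\<^sup>+y. \<integral>\<^sup>+z. g (y, snd p + fst p * y) * g (z, snd p + fst p * z) *
      indicator {z. \<bar>y - z\<bar> > \<delta>} z \<partial>lborel \<partial>lborel)" for p
  define R where "R p = (\<integral>\<^sup>+y. g (y, snd p + fst p * y) \<partial>lborel)" for p
  have "P \<in> borel_measurable (borel \<Otimes>\<^sub>M borel)" "R \<in> borel_measurable (borel \<Otimes>\<^sub>M borel)"
    unfolding P_def R_def by measurable
  then have [measurable]: "P \<in> borel_measurable borel" "R \<in> borel_measurable borel"
    by (simp_all add: borel_prod)
  have "ennreal (\<delta>\<^sup>2) * (\<integral>\<^sup>+p. b p * R p \<partial>lborel) = ennreal \<delta> * (\<integral>\<^sup>+p. b p * (ennreal \<delta> * R p) \<partial>lborel)"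
    using \<delta> by (simp add: power2_eq_square ennreal_mult mult.assoc nn_integral_cmult mult.left_commute[of "b _"])
  also have "\<dots> \<le> ennreal \<delta> * (\<integral>\<^sup>+p. ennreal (3 * \<delta>\<^sup>2) * b p + P p \<partial>lborel)"
  proof (intro mult_left_mono nn_integral_mono)
    fix p
    have "ennreal \<delta> * R p \<le> ennreal (3 * \<delta>\<^sup>2) + P p"
      unfolding R_def P_def by (intro line_integral_le \<delta> g1) measurable
    then have "b p * (ennreal \<delta> * R p) \<le> b p * (ennreal (3 * \<delta>\<^sup>2) + P p)"
      by (rule mult_left_mono) simp
    also have "\<dots> \<le> ennreal (3 * \<delta>\<^sup>2) * b p + P p"
      using mult_right_mono[OF b1[of p], of "P p"] by (simp add: distrib_left mult.commute add_left_mono)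
    finally show "b p * (ennreal \<delta> * R p) \<le> ennreal (3 * \<delta>\<^sup>2) * b p + P p" .
  qed simp
  also have "\<dots> = ennreal (3 * \<delta> ^ 3) * (\<integral>\<^sup>+p. b p \<partial>lborel) + ennreal \<delta> * (\<integral>\<^sup>+p. P p \<partial>lborel)"
    using \<delta> by (simp add: nn_integral_add nn_integral_cmult distrib_left power2_eq_square power3_eq_cube
        ennreal_mult mult.assoc mult.left_commute)
  also have "\<dots> \<le> ennreal (3 * \<delta> ^ 3) * (\<integral>\<^sup>+p. b p \<partial>lborel) + (\<integral>\<^sup>+p. g p \<partial>lborel)\<^sup>2"
    unfolding P_def by (intro add_left_mono planar_pairs \<delta>)
  finally show ?thesis unfolding R_def .
qed

text \<open>Choosing \<delta> so that \<delta>^3 = \<alpha>^2 / \<beta> turns the previous bound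
  into \<delta>^2 I \<le> 4 \<alpha>^2; the constant 64 is the cube of this 4.\<close>

lemma planar_Loomis_Whitney:
  "(\<integral>\<^sup>+p. b p * (\<integral>\<^sup>+y. g (y, snd p + fst p * y) \<partial>lborel) \<partial>lborel) ^ 3 \<le>
    64 * (\<integral>\<^sup>+p. g p \<partial>lborel)\<^sup>2 * (\<integral>\<^sup>+p. b p \<partial>lborel)\<^sup>2"
proof -
  have bb [measurable]: "b \<in> borel_measurable borel" using b by (simp add: borel_prod)
  have gb [measurable]: "g \<in> borel_measurable borel" using g by (simp add: borel_prod)
  define R where "R p = (\<integral>\<^sup>+y. g (y, snd p + fst p * y) \<partial>lborel)" for p
  have "R \<in> borel_measurable (borel \<Otimes>\<^sub>M borel)"
    unfolding R_def by measurable
  then have R [measurable]: "R \<in> borel_measurable borel"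
    by (simp add: borel_prod)
  define I where "I = (\<integral>\<^sup>+p. b p * R p \<partial>lborel)"
  define \<alpha> where "\<alpha> = (\<integral>\<^sup>+p. g p \<partial>lborel)"
  define \<beta> where "\<beta> = (\<integral>\<^sup>+p. b p \<partial>lborel)"
  consider "\<alpha> = 0" | "\<beta> = 0" | "\<alpha> \<noteq> 0" "\<beta> \<noteq> 0" "\<alpha> = top \<or> \<beta> = top"
    | r s where "\<alpha> = ennreal r" "\<beta> = ennreal s" "r > 0" "s > 0"
    by (cases \<alpha>; cases \<beta>) (force simp: less_le)+
  then have "I ^ 3 \<le> 64 * \<alpha>\<^sup>2 * \<beta>\<^sup>2"
  proof cases
    case 1
    \<comment> \<open>Here the optimal \<delta> would be 0. Instead, for each slope the map of (y,
      t) to (y, t + x y) preserves area, so integrating \<open>g\<close> over all lines still gives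
      0.\<close>
    have "I \<le> (\<integral>\<^sup>+p. R p \<partial>lborel)"
      unfolding I_def using mult_right_mono[OF b1] by (intro nn_integral_mono) fastforce
    also have "\<dots> = (\<integral>\<^sup>+x. \<integral>\<^sup>+t. \<integral>\<^sup>+y. g (y, t + x * y) \<partial>lborel \<partial>lborel \<partial>lborel)"
      by (subst nn_integral_lborel_pair[OF R]) (simp add: R_def)
    also have "\<dots> = (\<integral>\<^sup>+x. \<integral>\<^sup>+y. \<integral>\<^sup>+t. g (y, t + x * y) \<partial>lborel \<partial>lborel \<partial>lborel)"
      by (intro nn_integral_cong lborel_pair.Fubini') measurable
    also have "\<dots> = (\<integral>\<^sup>+(x::real). \<integral>\<^sup>+y. \<integral>\<^sup>+t. g (y, t) \<partial>lborel \<partial>lborel \<partial>lborel)"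
      by (intro nn_integral_cong nn_integral_lborel_translate) measurable
    also have "\<dots> = 0"
      using 1 by (simp add: \<alpha>_def nn_integral_lborel_pair[OF gb])
    finally show ?thesis by simp
  next
    case 2
    then have "AE p in lborel. b p = 0" by (simp add: \<beta>_def nn_integral_0_iff_AE)
    then have "AE p in lborel. b p * R p = 0" by eventually_elim simp
    then have "I = 0" unfolding I_def by (subst nn_integral_0_iff_AE) auto
    then show ?thesis by simp
  next
    case 3
    then show ?thesis by (auto simp: power2_eq_square ennreal_mult_top ennreal_top_mult)
  next
    case 4
    \<comment> \<open>This choice makes the first term of \<open>planar_incidence\<close> three
      times the second.\<close>
    define \<delta> where "\<delta> = root 3 (r\<^sup>2 / s)"
    have \<delta>: "\<delta> > 0" "\<delta> ^ 3 = r\<^sup>2 / s" using 4 by (simp_all add: \<delta>_def)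
    have "ennreal (\<delta>\<^sup>2) * I \<le> ennreal (3 * \<delta> ^ 3) * \<beta> + \<alpha>\<^sup>2"
      unfolding I_def R_def \<alpha>_def \<beta>_def by (rule planar_incidence[OF \<delta>(1)])
    also have "\<dots> = ennreal (4 * r\<^sup>2)"
      using 4 unfolding \<delta>(2) by (simp add: ennreal_power flip: ennreal_mult ennreal_plus)
    finally have le: "ennreal (\<delta>\<^sup>2) * I \<le> ennreal (4 * r\<^sup>2)" .
    then have "I \<noteq> top" using \<delta>(1) by (auto simp: ennreal_mult_top top_unique)
    then obtain i where i: "I = ennreal i" "i \<ge> 0" by (cases I) auto
    have "\<delta>\<^sup>2 * i \<le> 4 * r\<^sup>2"
      using le i by (simp flip: ennreal_mult)
    then have "(\<delta>\<^sup>2 * i) ^ 3 \<le> (4 * r\<^sup>2) ^ 3"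
      using i by (intro power_mono) auto
    then have "(\<delta> ^ 3)\<^sup>2 * i ^ 3 \<le> 64 * (r\<^sup>2) ^ 3"
      by (simp add: power_mult_distrib flip: power_mult)
    then have "(r\<^sup>2)\<^sup>2 * i ^ 3 \<le> (r\<^sup>2)\<^sup>2 * (64 * r\<^sup>2 * s\<^sup>2)"
      unfolding \<delta>(2) using 4 by (simp add: field_simps power2_eq_square power3_eq_cube)
    then have "i ^ 3 \<le> 64 * r\<^sup>2 * s\<^sup>2"
      using 4 by (simp add: mult_le_cancel_left)
    then have "ennreal (i ^ 3) \<le> ennreal (64 * r\<^sup>2 * s\<^sup>2)" by (rule ennreal_leI)
    then show ?thesis
      using 4 i by (simp add: ennreal_power ennreal_mult)
  qed
  then show ?thesis unfolding I_def R_def \<alpha>_def \<beta>_def .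
qed

end

section \<open>The Loomis-Whitney inequality\<close>

lemma measurable_vec_lambda [measurable (raw)]:
  fixes f :: "'a \<Rightarrow> 'm::finite \<Rightarrow> real"
  assumes "\<And>i. (\<lambda>x. f x i) \<in> borel_measurable M"
  shows "(\<lambda>x. \<chi> i. f x i) \<in> borel_measurable M"
  using assms by (subst borel_measurable_euclidean_space) (auto simp: Basis_vec_def inner_axis)

text \<open>The product measure has the right volume on boxes, which characterises Lebesgue measure;
  this moves integrals over vectors to the function spaces on which \<open>Finner\<close> is
  stated.\<close>

lemma nn_integral_lborel_vec:
  fixes g :: "real ^ 'm::finite \<Rightarrow> ennreal"
  assumes [measurable]: "g \<in> borel_measurable borel"
  shows "(\<integral>\<^sup>+x. g x \<partial>lborel) = (\<integral>\<^sup>+x. g (\<chi> i. x i) \<partial>PiM UNIV (\<lambda>_. lborel))"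
proof -
  interpret product_sigma_finite "\<lambda>_::'m. lborel :: real measure"
    by (rule product_sigma_finite.intro) (rule sigma_finite_lborel)
  have V: "(\<lambda>x. \<chi> i. x i) \<in> borel_measurable (PiM UNIV (\<lambda>_::'m. lborel :: real measure))"
    by (rule measurable_vec_lambda) measurable
  have "(lborel :: (real ^ 'm) measure) = distr (PiM UNIV (\<lambda>_. lborel)) borel (\<lambda>x. \<chi> i. x i)"
  proof (rule lborel_eqI)
    fix l u :: "real ^ 'm" assume le: "\<And>b. b \<in> Basis \<Longrightarrow> l \<bullet> b \<le> u \<bullet> b"
    have le': "l $ i \<le> u $ i" for i using le[of "axis i 1"] by (simp add: inner_axis)
    have "(\<lambda>x. \<chi> i. x i) -` box l u \<inter> space (PiM UNIV (\<lambda>_. lborel)) = (\<Pi>\<^sub>E i\<in>UNIV. {l $ i<..<u $ i})"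
      by (auto simp: mem_box_cart space_PiM PiE_def Pi_def)
    then have "emeasure (distr (PiM UNIV (\<lambda>_. lborel)) borel (\<lambda>x. \<chi> i. x i)) (box l u) =
        emeasure (PiM UNIV (\<lambda>_. lborel)) (\<Pi>\<^sub>E i\<in>UNIV. {l $ i<..<u $ i})"
      using V by (simp add: emeasure_distr)
    also have "\<dots> = (\<Prod>i\<in>UNIV. ennreal (u $ i - l $ i))"
      using le' by (subst emeasure_PiM) auto
    also have "\<dots> = ennreal (\<Prod>i\<in>UNIV. u $ i - l $ i)"
      using le' by (intro prod_ennreal) simp
    also have "(\<Prod>i\<in>UNIV. u $ i - l $ i) = (\<Prod>b\<in>Basis. (u - l) \<bullet> b)"
    proof -
      have B: "Basis = (\<lambda>i. axis i (1::real)) ` (UNIV :: 'm set)" by (auto simp: Basis_vec_def)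
      have inj: "inj (\<lambda>i::'m. axis i (1::real))" by (auto simp: inj_def axis_eq_axis)
      have "(\<Prod>b\<in>Basis. (u - l) \<bullet> b) = (\<Prod>i\<in>UNIV. (u - l) \<bullet> axis i 1)"
        unfolding B prod.reindex[OF inj] by simp
      then show ?thesis by (simp add: inner_axis)
    qed
    finally show "emeasure (distr (PiM UNIV (\<lambda>_. lborel)) borel (\<lambda>x. \<chi> i. x i)) (box l u) =
        (\<Prod>b\<in>Basis. (u - l) \<bullet> b)" .
  qed simp
  then have "(\<integral>\<^sup>+x. g x \<partial>lborel) = (\<integral>\<^sup>+x. g x \<partial>distr (PiM UNIV (\<lambda>_. lborel)) borel (\<lambda>x. \<chi> i. x i))"
    by simp
  also have "\<dots> = (\<integral>\<^sup>+x. g (\<chi> i. x i) \<partial>PiM UNIV (\<lambda>_. lborel))"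
    using V by (rule nn_integral_distr) simp
  finally show ?thesis .
qed

definition unif :: "real measure" where
  "unif = density lborel (indicator {0..1})"

lemma sets_unif [simp, measurable_cong]: "sets unif = sets borel"
  by (simp add: unif_def)

lemma space_unif [simp]: "space unif = UNIV"
  by (simp add: unif_def)

lemma emeasure_unif: "emeasure unif UNIV = 1"
  by (simp add: unif_def emeasure_density)

lemma sigma_finite_unif: "sigma_finite_measure unif"
proof -
  interpret finite_measure unif by (rule finite_measureI) (simp add: emeasure_unif)
  show ?thesis ..
qed

definition coord_measure :: "'c \<Rightarrow> 'c \<Rightarrow> real measure" where
  "coord_measure j l = (if l = j then unif else lborel)"

lemma sets_coord_measure [simp, measurable_cong]: "sets (coord_measure j l) = sets borel"
  by (simp add: coord_measure_def)

lemma sigma_finite_coord_measure: "sigma_finite_measure (coord_measure j l)"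
  by (simp add: coord_measure_def sigma_finite_unif sigma_finite_lborel)

text \<open>Translates the restriction of x_j to the unit interval, used in the bounds on slopes,
  into the probability factor required by \<open>Finner\<close>.\<close>

lemma nn_integral_coord_measure:
  fixes F :: "('c::finite \<Rightarrow> real) \<Rightarrow> ennreal"
  assumes F: "F \<in> borel_measurable (PiM UNIV (\<lambda>_. borel))"
  shows "(\<integral>\<^sup>+x. F x \<partial>PiM UNIV (coord_measure j)) =
    (\<integral>\<^sup>+x. indicator {0..1} (x j) * F x \<partial>PiM UNIV (\<lambda>_. lborel))"
proof -
  interpret L: product_sigma_finite "\<lambda>_::'c. lborel :: real measure"
    by (rule product_sigma_finite.intro) (rule sigma_finite_lborel)
  interpret M: product_sigma_finite "coord_measure j"
    by (rule product_sigma_finite.intro) (rule sigma_finite_coord_measure)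
  have ins: "UNIV = insert j (UNIV - {j})" by auto
  have mL: "borel_measurable (PiM K (\<lambda>_. lborel)) = borel_measurable (PiM K (\<lambda>_. borel :: real measure))" for K :: "'c set"
    by (intro measurable_cong_sets sets_PiM_cong refl) simp
  have mM: "borel_measurable (PiM K (coord_measure j)) = borel_measurable (PiM K (\<lambda>_. borel :: real measure))" for K :: "'c set"
    by (intro measurable_cong_sets sets_PiM_cong refl) simp
  have F': "F \<in> borel_measurable (PiM (insert j (UNIV - {j})) (\<lambda>_. borel))"
    using F by (simp flip: ins)
  have "(\<lambda>x. indicator {0..1} (x j) * F x) \<in> borel_measurable (PiM UNIV (\<lambda>_. borel))"
    using F by measurable
  then have "(\<integral>\<^sup>+x. indicator {0..1} (x j) * F x \<partial>PiM UNIV (\<lambda>_. lborel)) =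
      (\<integral>\<^sup>+x. \<integral>\<^sup>+y. indicator {0..1} y * F (x(j := y)) \<partial>lborel \<partial>PiM (UNIV - {j}) (\<lambda>_. lborel))"
    using L.product_nn_integral_insert[of "UNIV - {j}" j "\<lambda>x. indicator {0..1} (x j) * F x"]
    by (simp add: mL flip: ins)
  also have "\<dots> = (\<integral>\<^sup>+x. \<integral>\<^sup>+y. F (x(j := y)) \<partial>unif \<partial>PiM (UNIV - {j}) (\<lambda>_. lborel))"
  proof (rule nn_integral_cong)
    fix x assume "x \<in> space (PiM (UNIV - {j}) (\<lambda>_. lborel :: real measure))"
    then have "x \<in> space (PiM (UNIV - {j}) (\<lambda>_. borel :: real measure))" by (simp add: space_PiM)
    from measurable_comp[OF measurable_component_update[OF this, of j] F']
    have "(\<lambda>y. F (x(j := y))) \<in> borel_measurable borel" by (simp add: comp_def)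
    then show "(\<integral>\<^sup>+y. indicator {0..1} y * F (x(j := y)) \<partial>lborel) = (\<integral>\<^sup>+y. F (x(j := y)) \<partial>unif)"
      by (simp add: unif_def nn_integral_density)
  qed
  also have "PiM (UNIV - {j}) (\<lambda>_. lborel) = PiM (UNIV - {j}) (coord_measure j)"
    by (rule PiM_cong) (auto simp: coord_measure_def)
  also have "(\<integral>\<^sup>+x. \<integral>\<^sup>+y. F (x(j := y)) \<partial>unif \<partial>PiM (UNIV - {j}) (coord_measure j)) =
      (\<integral>\<^sup>+x. F x \<partial>PiM UNIV (coord_measure j))"
    using M.product_nn_integral_insert[of "UNIV - {j}" j F] F
    by (simp add: mM coord_measure_def flip: ins)
  finally show ?thesis by simp
qed

text \<open>With \<theta> = 1/(2n+1), the pair \<open>a\<close> receives 2\<theta> for each field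
  and every other field receives \<theta>. At a coordinate outside the pair Finner's condition
  holds, since leaving out the field of that coordinate gives (2n-3)\<theta> + 4\<theta> =
  1.\<close>

definition pair_weight :: "'n \<Rightarrow> 'n::finite + 'n \<Rightarrow> real" where
  "pair_weight a j = (if j = Inl a \<or> j = Inr a then 2 else 1) / (2 * real CARD('n) + 1)"

lemma prod_epowr_mult:
  "finite S \<Longrightarrow> (\<Prod>j\<in>S. epowr x a) * epowr x b = epowr x (real (card S) * a + b)"
  by (induction S rule: finite_induct) (simp_all add: mult.assoc distrib_right add.assoc flip: epowr_add)

context
  fixes u :: "'n::finite + 'n \<Rightarrow> 'n heisenberg \<Rightarrow> ennreal" and a :: 'n
  assumes u: "\<And>j. u j \<in> borel_measurable borel" and u1: "\<And>j p. u j p \<le> 1"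
    and indep: "\<And>j q q'. (\<And>i. i \<noteq> j \<Longrightarrow> fst q $ i = fst q' $ i) \<Longrightarrow> snd q = snd q' \<Longrightarrow> u j q = u j q'"
begin

definition fiber :: "'n + 'n \<Rightarrow> ('n + 'n \<Rightarrow> real) \<Rightarrow> ennreal" where
  "fiber j x = (\<integral>\<^sup>+t. u j (\<chi> i. x i, t) \<partial>lborel)"

definition joint_fiber :: "('n + 'n \<Rightarrow> real) \<Rightarrow> ennreal" where
  "joint_fiber x = (\<integral>\<^sup>+t. (\<Prod>j\<in>UNIV. u j (\<chi> i. x i, t + twist j * (x j * x (opp j)))) \<partial>lborel)"

definition slice_joint :: "('n + 'n \<Rightarrow> real) \<Rightarrow> ennreal" where
  "slice_joint z = (\<integral>\<^sup>+v. \<integral>\<^sup>+y. joint_fiber (z(Inr a := v, Inl a := y)) \<partial>lborel \<partial>lborel)"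

definition slice :: "'n + 'n \<Rightarrow> ('n + 'n \<Rightarrow> real) \<Rightarrow> ennreal" where
  "slice j z = (\<integral>\<^sup>+v. \<integral>\<^sup>+y. fiber j (z(Inr a := v, Inl a := y))
     \<partial>coord_measure j (Inl a) \<partial>coord_measure j (Inr a))"

abbreviation rest :: "('n + 'n) set" where
  "rest \<equiv> UNIV - {Inl a, Inr a}"

lemma measurable_u:
  assumes "\<And>i. (\<lambda>w. f w i) \<in> borel_measurable M" "g \<in> borel_measurable M"
  shows "(\<lambda>w. u j (\<chi> i. f w i, g w)) \<in> borel_measurable M"
  by (rule measurable_compose[OF _ u]) (intro borel_measurable_Pair measurable_vec_lambda assms)

text \<open>A point of the product over \<open>rest\<close> carries no information at the two
  indices of the pair, and these are exactly the ones overwritten.\<close>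

lemma measurable_update:
  "(\<lambda>w. ((fst (fst w))(Inr a := snd (fst w), Inl a := snd w)) i) \<in>
    borel_measurable ((PiM rest (\<lambda>_. borel) \<Otimes>\<^sub>M borel) \<Otimes>\<^sub>M (borel :: real measure))"
proof -
  consider "i = Inl a" | "i = Inr a" | "i \<in> rest" by auto
  then show ?thesis
  proof cases
    case 3
    then have [measurable]: "(\<lambda>z. z i) \<in> borel_measurable (PiM rest (\<lambda>_. borel :: real measure))"
      by (rule measurable_component_singleton)
    from 3 show ?thesis by simp
  qed simp_all
qed

lemma measurable_fiber [measurable]: "fiber j \<in> borel_measurable (PiM UNIV (\<lambda>_. borel))"
  unfolding fiber_def[abs_def]
  by (rule lborel.borel_measurable_nn_integral) (unfold split_beta, rule measurable_u; measurable)

lemma measurable_joint_fiber [measurable]: "joint_fiber \<in> borel_measurable (PiM UNIV (\<lambda>_. borel))"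
  unfolding joint_fiber_def[abs_def]
  by (rule lborel.borel_measurable_nn_integral)
    (unfold split_beta, intro borel_measurable_prod_ennreal measurable_u; measurable)

lemma measurable_fiber_update:
  "(\<lambda>w. fiber j ((fst (fst w))(Inr a := snd (fst w), Inl a := snd w))) \<in>
    borel_measurable ((PiM rest (\<lambda>_. borel) \<Otimes>\<^sub>M borel) \<Otimes>\<^sub>M borel)"
  unfolding fiber_def
  by (rule lborel.borel_measurable_nn_integral)
    (unfold split_beta, rule measurable_u;
      (rule measurable_compose[OF measurable_fst measurable_update] | measurable))

lemma measurable_slice: "slice j \<in> borel_measurable (PiM rest (\<lambda>_. borel))"
proof -
  interpret l: sigma_finite_measure "coord_measure j (Inl a)" by (rule sigma_finite_coord_measure)
  interpret r: sigma_finite_measure "coord_measure j (Inr a)" by (rule sigma_finite_coord_measure)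
  have "sets ((PiM rest (\<lambda>_. borel) \<Otimes>\<^sub>M coord_measure j (Inr a)) \<Otimes>\<^sub>M coord_measure j (Inl a)) =
      sets ((PiM rest (\<lambda>_. borel :: real measure) \<Otimes>\<^sub>M borel) \<Otimes>\<^sub>M borel)"
    by (intro sets_pair_measure_cong refl) simp_all
  then have "(\<lambda>w. fiber j ((fst (fst w))(Inr a := snd (fst w), Inl a := snd w))) \<in>
      borel_measurable ((PiM rest (\<lambda>_. borel) \<Otimes>\<^sub>M coord_measure j (Inr a)) \<Otimes>\<^sub>M coord_measure j (Inl a))"
    using measurable_fiber_update by (simp cong: measurable_cong_sets)
  then have "(\<lambda>w. \<integral>\<^sup>+y. fiber j ((fst w)(Inr a := snd w, Inl a := y)) \<partial>coord_measure j (Inl a)) \<in>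
      borel_measurable (PiM rest (\<lambda>_. borel) \<Otimes>\<^sub>M coord_measure j (Inr a))"
    by (intro l.borel_measurable_nn_integral) (simp add: split_beta)
  then show ?thesis
    unfolding slice_def[abs_def] by (intro r.borel_measurable_nn_integral) (simp add: split_beta)
qed

lemma nn_integral_split_rest:
  fixes M :: "'n + 'n \<Rightarrow> real measure"
  assumes M: "\<And>i. sigma_finite_measure (M i)" "\<And>i. sets (M i) = sets borel"
    and F: "F \<in> borel_measurable (PiM UNIV (\<lambda>_. borel))"
  shows "(\<integral>\<^sup>+x. F x \<partial>PiM UNIV M) =
    (\<integral>\<^sup>+z. \<integral>\<^sup>+v. \<integral>\<^sup>+y. F (z(Inr a := v, Inl a := y)) \<partial>M (Inl a) \<partial>M (Inr a) \<partial>PiM rest M)"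
proof -
  interpret product_sigma_finite M by (rule product_sigma_finite.intro) (rule M)
  have ins: "UNIV = insert (Inl a) (insert (Inr a) rest)" "insert (Inr a) rest = UNIV - {Inl a}" by auto
  have meas: "borel_measurable (PiM K M) = borel_measurable (PiM K (\<lambda>_. borel :: real measure))" for K
    by (intro measurable_cong_sets sets_PiM_cong refl M)
  have F': "F \<in> borel_measurable (PiM (insert (Inl a) (insert (Inr a) rest)) M)"
    using F by (simp add: meas flip: ins(1))
  have "(\<integral>\<^sup>+x. F x \<partial>PiM UNIV M) = (\<integral>\<^sup>+x. F x \<partial>PiM (insert (Inl a) (insert (Inr a) rest)) M)"
    by (simp only: ins(1)[symmetric])
  also have "\<dots> = (\<integral>\<^sup>+x. \<integral>\<^sup>+y. F (x(Inl a := y)) \<partial>M (Inl a) \<partial>PiM (insert (Inr a) rest) M)"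
    by (rule product_nn_integral_insert[OF _ _ F']) auto
  also have "\<dots> = (\<integral>\<^sup>+z. \<integral>\<^sup>+v. \<integral>\<^sup>+y. F (z(Inr a := v, Inl a := y)) \<partial>M (Inl a) \<partial>M (Inr a) \<partial>PiM rest M)"
  proof (rule product_nn_integral_insert)
    have "(\<lambda>w. F ((fst w)(Inl a := snd w))) \<in> borel_measurable (PiM (insert (Inr a) rest) M \<Otimes>\<^sub>M M (Inl a))"
      using measurable_comp[OF measurable_add_dim F'] by (simp add: comp_def split_beta)
    then show "(\<lambda>x. \<integral>\<^sup>+y. F (x(Inl a := y)) \<partial>M (Inl a)) \<in> borel_measurable (PiM (insert (Inr a) rest) M)"
      by (intro sigma_finite_measure.borel_measurable_nn_integral[OF M(1)]) (simp add: split_beta)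
  qed auto
  finally show ?thesis .
qed

text \<open>The trivial bound by one projection: all factors but the \<open>j\<close>-th are at most
  1, and the shift of \<open>t\<close> in the remaining factor does not change its integral. Since
  \<open>j\<close> lies outside the pair, both coordinates of the pair carry Lebesgue measure on
  either side.\<close>

lemma slice_joint_le_slice:
  assumes "j \<in> rest"
  shows "slice_joint z \<le> slice j z"
proof -
  have lb: "coord_measure j (Inl a) = lborel" "coord_measure j (Inr a) = lborel"
    using assms by (auto simp: coord_measure_def)
  have "joint_fiber x \<le> fiber j x" for x
  proof -
    have "joint_fiber x \<le> (\<integral>\<^sup>+t. u j (\<chi> i. x i, t + twist j * (x j * x (opp j))) \<partial>lborel)"
      unfolding joint_fiber_def
    proof (rule nn_integral_mono)
      fix t
      have "(\<Prod>j\<in>UNIV. u j (\<chi> i. x i, t + twist j * (x j * x (opp j)))) =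
          u j (\<chi> i. x i, t + twist j * (x j * x (opp j))) *
          (\<Prod>j\<in>UNIV - {j}. u j (\<chi> i. x i, t + twist j * (x j * x (opp j))))"
        by (rule prod.remove) auto
      also have "\<dots> \<le> u j (\<chi> i. x i, t + twist j * (x j * x (opp j))) * 1"
        by (intro mult_left_mono prod_le_1) (auto simp: u1)
      finally show "(\<Prod>j\<in>UNIV. u j (\<chi> i. x i, t + twist j * (x j * x (opp j)))) \<le>
          u j (\<chi> i. x i, t + twist j * (x j * x (opp j)))" by simp
    qed
    also have "\<dots> = fiber j x"
      unfolding fiber_def by (rule nn_integral_lborel_translate) (rule measurable_u; measurable)
    finally show ?thesis .
  qed
  then show ?thesis
    unfolding slice_joint_def slice_def lb by (intro nn_integral_mono)
qed

text \<open>Write y and v for the two coordinates of the pair. The two shears add y v / 2 and - y v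
  / 2 to \<open>t\<close>; translating \<open>t\<close> by the latter leaves \<open>t\<close> in one
  factor and t + y v in the other. The first is a function of the line with slope y and intercept t,
  the second a function of the point over v on that line.\<close>

lemma slice_joint_planar: "slice_joint z ^ 3 \<le> 64 * (slice (Inl a) z)\<^sup>2 * (slice (Inr a) z)\<^sup>2"
proof -
  \<comment> \<open>The value 0 fills the coordinate on which the function does not depend;
    \<open>gu\<close> and \<open>bu\<close> remove it through \<open>indep\<close>.\<close>
  define g where "g p = u (Inl a) (\<chi> i. (z(Inr a := fst p, Inl a := 0)) i, snd p)" for p :: "real \<times> real"
  define b where "b p = u (Inr a) (\<chi> i. (z(Inr a := 0, Inl a := fst p)) i, snd p)" for p :: "real \<times> real"
  have g: "g \<in> borel_measurable (borel \<Otimes>\<^sub>M borel)"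
    unfolding g_def[abs_def] by (rule measurable_u) (unfold fun_upd_def, measurable)
  have b: "b \<in> borel_measurable (borel \<Otimes>\<^sub>M borel)"
    unfolding b_def[abs_def] by (rule measurable_u) (unfold fun_upd_def, measurable)
  note [measurable] = g b
  have gb: "g \<in> borel_measurable borel" "b \<in> borel_measurable borel"
    using g b by (simp_all add: borel_prod)
  have gu: "u (Inl a) (\<chi> i. (z(Inr a := v, Inl a := y)) i, t) = g (v, t)" for v y t
    unfolding g_def by (rule indep) auto
  have bu: "u (Inr a) (\<chi> i. (z(Inr a := v, Inl a := y)) i, t) = b (y, t)" for v y t
    unfolding b_def by (rule indep) auto
  have le: "joint_fiber (z(Inr a := v, Inl a := y)) \<le> (\<integral>\<^sup>+t. b (y, t) * g (v, t + y * v) \<partial>lborel)" for v y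
  proof -
    let ?x = "z(Inr a := v, Inl a := y)"
    have "joint_fiber ?x \<le> (\<integral>\<^sup>+t. b (y, t + (- (y * v / 2))) * g (v, (t + (- (y * v / 2))) + y * v) \<partial>lborel)"
      unfolding joint_fiber_def
    proof (rule nn_integral_mono)
      fix t
      let ?P = "\<lambda>j. u j (\<chi> i. ?x i, t + twist j * (?x j * ?x (opp j)))"
      have "(\<Prod>j\<in>UNIV. ?P j) = (\<Prod>j\<in>rest. ?P j) * (\<Prod>j\<in>{Inl a, Inr a}. ?P j)"
        by (rule prod.subset_diff) auto
      also have "\<dots> \<le> 1 * (\<Prod>j\<in>{Inl a, Inr a}. ?P j)"
        by (intro mult_right_mono prod_le_1) (auto simp: u1)
      also have "\<dots> = b (y, t + (- (y * v / 2))) * g (v, (t + (- (y * v / 2))) + y * v)"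
        by (simp add: gu bu mult.commute add.commute algebra_simps del: fun_upd_apply)
          (simp add: mult.commute)
      finally show "(\<Prod>j\<in>UNIV. ?P j) \<le> b (y, t + (- (y * v / 2))) * g (v, (t + (- (y * v / 2))) + y * v)" .
    qed
    also have "\<dots> = (\<integral>\<^sup>+t. b (y, t) * g (v, t + y * v) \<partial>lborel)"
      by (rule nn_integral_lborel_translate) measurable
    finally show ?thesis .
  qed
  have H: "(\<lambda>(v, p). b p * g (v, snd p + fst p * v)) \<in> borel_measurable (borel \<Otimes>\<^sub>M borel)"
    unfolding borel_prod[where 'a=real and 'b=real, symmetric] by measurable
  have "slice_joint z \<le> (\<integral>\<^sup>+v. \<integral>\<^sup>+y. \<integral>\<^sup>+t. b (y, t) * g (v, t + y * v) \<partial>lborel \<partial>lborel \<partial>lborel)"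
    unfolding slice_joint_def by (intro nn_integral_mono le)
  also have "\<dots> = (\<integral>\<^sup>+v. \<integral>\<^sup>+p. b p * g (v, snd p + fst p * v) \<partial>lborel \<partial>lborel)"
  proof (rule nn_integral_cong)
    fix v :: real
    have "(\<lambda>p. b p * g (v, snd p + fst p * v)) \<in> borel_measurable (borel \<Otimes>\<^sub>M borel)" by measurable
    then show "(\<integral>\<^sup>+y. \<integral>\<^sup>+t. b (y, t) * g (v, t + y * v) \<partial>lborel \<partial>lborel) =
        (\<integral>\<^sup>+p. b p * g (v, snd p + fst p * v) \<partial>lborel)"
      by (subst nn_integral_lborel_pair) (simp_all add: borel_prod)
  qed
  also have "\<dots> = (\<integral>\<^sup>+p. \<integral>\<^sup>+v. b p * g (v, snd p + fst p * v) \<partial>lborel \<partial>lborel)"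
    using H by (intro lborel_pair.Fubini') (simp cong: measurable_cong_sets)
  also have "\<dots> = (\<integral>\<^sup>+p. b p * (\<integral>\<^sup>+v. g (v, snd p + fst p * v) \<partial>lborel) \<partial>lborel)"
    by (intro nn_integral_cong nn_integral_cmult) measurable
  finally have "slice_joint z ^ 3 \<le> (\<integral>\<^sup>+p. b p * (\<integral>\<^sup>+v. g (v, snd p + fst p * v) \<partial>lborel) \<partial>lborel) ^ 3"
    by (rule power_mono) simp
  also have "\<dots> \<le> 64 * (\<integral>\<^sup>+p. g p \<partial>lborel)\<^sup>2 * (\<integral>\<^sup>+p. b p \<partial>lborel)\<^sup>2"
    by (rule planar_Loomis_Whitney[OF g b]) (simp_all add: g_def b_def u1)
  \<comment> \<open>The coordinate that \<open>g\<close> ignores carries the uniform measure in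
    \<open>slice\<close> and contributes a factor 1.\<close>
  also have "(\<integral>\<^sup>+p. g p \<partial>lborel) = slice (Inl a) z"
    unfolding slice_def fiber_def gu nn_integral_lborel_pair[OF gb(1)]
    by (simp add: coord_measure_def emeasure_unif)
  also have "(\<integral>\<^sup>+p. b p \<partial>lborel) = slice (Inr a) z"
    unfolding slice_def fiber_def bu nn_integral_lborel_pair[OF gb(2)]
    by (simp add: coord_measure_def emeasure_unif)
  finally show ?thesis .
qed

lemma pair_weight_pos: "pair_weight a j > 0"
  by (simp add: pair_weight_def)

lemma sum_pair_weight:
  assumes "c \<in> rest"
  shows "(\<Sum>j\<in>UNIV - {c}. pair_weight a j) = 1"
proof -
  let ?\<theta> = "1 / (2 * real CARD('n) + 1)"
  have "(\<Sum>j\<in>UNIV - {c}. pair_weight a j) =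
      (\<Sum>j\<in>(UNIV - {c}) - {Inl a, Inr a}. pair_weight a j) + (\<Sum>j\<in>{Inl a, Inr a}. pair_weight a j)"
    using assms by (intro sum.subset_diff) auto
  also have "(\<Sum>j\<in>(UNIV - {c}) - {Inl a, Inr a}. pair_weight a j) =
      (\<Sum>j\<in>(UNIV - {c}) - {Inl a, Inr a}. ?\<theta>)"
    by (intro sum.cong refl) (auto simp: pair_weight_def)
  also have "\<dots> = real (card (UNIV - {c, Inl a, Inr a})) * ?\<theta>"
    by (simp add: Diff_insert insert_commute set_diff_eq Collect_conj_eq)
  also have "card (UNIV - {c, Inl a, Inr a}) = 2 * CARD('n) - 3"
    using assms by (subst card_Diff_subset) auto
  also have "(\<Sum>j\<in>{Inl a, Inr a}. pair_weight a j) = 4 * ?\<theta>"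
    by (simp add: pair_weight_def)
  finally have eq: "(\<Sum>j\<in>UNIV - {c}. pair_weight a j) = real (2 * CARD('n) - 3) * ?\<theta> + 4 * ?\<theta>" .
  \<comment> \<open>A coordinate outside the pair exists only for n \<ge> 2, so the subtraction of 3
    on natural numbers is exact.\<close>
  have "card {c, Inl a, Inr a} \<le> CARD('n + 'n)" by (rule card_mono) auto
  then have "3 \<le> 2 * CARD('n)" using assms by auto
  then have "real (2 * CARD('n) - 3) = 2 * real CARD('n) - 3" by (simp add: of_nat_diff)
  then have "(\<Sum>j\<in>UNIV - {c}. pair_weight a j) = (2 * real CARD('n) + 1) * ?\<theta>"
    unfolding eq by (simp only: distrib_right[symmetric]) (rule arg_cong2[where f = "(*)"]; simp)
  moreover have "2 * real CARD('n) + 1 > 0" by (simp add: add_pos_pos)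
  ultimately show ?thesis by simp
qed

text \<open>The exponent 1 is split as (2n-2)\<theta> + 3\<theta> with \<theta> = 1/(2n+1). Each of
  the 2n-2 trivial bounds takes \<theta>; the cubed planar bound takes the last 3\<theta>, and its
  squares produce the weights 2\<theta> of the pair.\<close>

lemma slice_joint_le:
  "slice_joint z \<le> epowr 64 (1 / (2 * real CARD('n) + 1)) * (\<Prod>j\<in>UNIV. epowr (slice j z) (pair_weight a j))"
proof -
  let ?N = "2 * real CARD('n) + 1"
  let ?\<theta> = "1 / ?N"
  have card: "card rest = 2 * CARD('n) - 2" by (subst card_Diff_subset) auto
  have "CARD('n) \<ge> 1" by (simp add: Suc_leI)
  then have card': "real (card rest) = 2 * real CARD('n) - 2" unfolding card by (simp add: of_nat_diff)
  have "?N > 0" by (simp add: add_pos_pos)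
  moreover have "real (card rest) * ?\<theta> + 3 * ?\<theta> = ?N * ?\<theta>"
    unfolding card' by (simp only: distrib_right[symmetric]) (rule arg_cong2[where f = "(*)"]; simp)
  ultimately have "slice_joint z = epowr (slice_joint z) (real (card rest) * ?\<theta> + 3 * ?\<theta>)" by simp
  also have "\<dots> = (\<Prod>j\<in>rest. epowr (slice_joint z) ?\<theta>) * epowr (slice_joint z ^ 3) ?\<theta>"
    by (simp only: prod_epowr_mult[symmetric] finite epowr_epowr flip: epowr_numeral)
  finally have eq: "slice_joint z = (\<Prod>j\<in>rest. epowr (slice_joint z) ?\<theta>) * epowr (slice_joint z ^ 3) ?\<theta>" .
  have "(\<Prod>j\<in>rest. epowr (slice_joint z) ?\<theta>) \<le> (\<Prod>j\<in>rest. epowr (slice j z) ?\<theta>)"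
    by (intro prod_mono_ennreal epowr_mono slice_joint_le_slice) auto
  also have "\<dots> = (\<Prod>j\<in>rest. epowr (slice j z) (pair_weight a j))"
    by (intro prod.cong refl) (auto simp: pair_weight_def)
  finally have rest: "(\<Prod>j\<in>rest. epowr (slice_joint z) ?\<theta>) \<le> (\<Prod>j\<in>rest. epowr (slice j z) (pair_weight a j))" .
  have "epowr (slice_joint z ^ 3) ?\<theta> \<le> epowr (64 * (slice (Inl a) z)\<^sup>2 * (slice (Inr a) z)\<^sup>2) ?\<theta>"
    by (intro epowr_mono slice_joint_planar) simp
  also have "\<dots> = epowr 64 ?\<theta> * (\<Prod>j\<in>{Inl a, Inr a}. epowr (slice j z) (pair_weight a j))"
    by (simp add: epowr_mult epowr_epowr pair_weight_def mult.assoc flip: epowr_numeral)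
  finally have "slice_joint z \<le> (\<Prod>j\<in>rest. epowr (slice j z) (pair_weight a j)) *
      (epowr 64 ?\<theta> * (\<Prod>j\<in>{Inl a, Inr a}. epowr (slice j z) (pair_weight a j)))"
    by (subst eq) (rule mult_mono[OF rest]; simp)
  also have "\<dots> = epowr 64 ?\<theta> * (\<Prod>j\<in>UNIV. epowr (slice j z) (pair_weight a j))"
    by (subst prod.subset_diff[of "{Inl a, Inr a}" UNIV]) (simp_all add: ac_simps)
  finally show ?thesis .
qed

lemma slice_indep: "slice c (z(c := y)) = slice c z" if "c \<in> rest"
proof -
  have "fiber c (z(c := y, Inr a := v, Inl a := w)) = fiber c (z(Inr a := v, Inl a := w))" for v w
    unfolding fiber_def by (intro nn_integral_cong indep) auto
  then show ?thesis by (simp add: slice_def)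
qed

text \<open>Finner's inequality in the coordinates outside the pair, applied to the slices. At a
  coordinate \<open>c\<close> of \<open>rest\<close> only \<open>slice c\<close> is constant, whence
  the choice of \<open>D\<close>; the sum of weights required there is
  \<open>sum_pair_weight\<close>.\<close>

lemma Heisenberg_Loomis_Whitney_pair:
  "(\<integral>\<^sup>+p. (\<Prod>j\<in>UNIV. u j (shear j p)) \<partial>lborel) \<le> epowr 64 (1 / (2 * real CARD('n) + 1)) *
    (\<Prod>j\<in>UNIV. epowr (\<integral>\<^sup>+q. indicator {q. fst q $ j \<in> {0..1}} q * u j q \<partial>lborel) (pair_weight a j))"
proof -
  let ?c = "epowr 64 (1 / (2 * real CARD('n) + 1))"
  note [measurable] = u
  have measL: "borel_measurable (PiM K (\<lambda>_. lborel)) = borel_measurable (PiM K (\<lambda>_. borel :: real measure))" for K :: "('n + 'n) set"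
    by (intro measurable_cong_sets sets_PiM_cong refl) simp
  have m1: "(\<lambda>p. \<Prod>j\<in>UNIV. u j (shear j p)) \<in> borel_measurable borel" by measurable
  have m2: "(\<lambda>q. indicator {q. fst q $ j \<in> {0..1}} q * u j q) \<in> borel_measurable borel" for j by measurable
  have fst_meas: "(\<lambda>x. \<integral>\<^sup>+t. F (x, t) \<partial>lborel) \<in> borel_measurable borel"
    if "F \<in> borel_measurable borel" for F :: "'n heisenberg \<Rightarrow> ennreal"
  proof -
    have [measurable]: "F \<in> borel_measurable (borel \<Otimes>\<^sub>M borel)" using that by (simp add: borel_prod)
    show ?thesis by measurable
  qed
  have bound: "(\<integral>\<^sup>+z. slice j z \<partial>PiM rest (coord_measure j)) =
      (\<integral>\<^sup>+q. indicator {q. fst q $ j \<in> {0..1}} q * u j q \<partial>lborel)" for j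
  proof -
    have "(\<integral>\<^sup>+z. slice j z \<partial>PiM rest (coord_measure j)) = (\<integral>\<^sup>+x. fiber j x \<partial>PiM UNIV (coord_measure j))"
      unfolding slice_def
      by (rule nn_integral_split_rest[symmetric]) (simp_all add: sigma_finite_coord_measure measurable_fiber)
    also have "\<dots> = (\<integral>\<^sup>+x. indicator {0..1} (x j) * fiber j x \<partial>PiM UNIV (\<lambda>_. lborel))"
      by (rule nn_integral_coord_measure[OF measurable_fiber])
    also have "\<dots> = (\<integral>\<^sup>+x. (\<integral>\<^sup>+t. indicator {q. fst q $ j \<in> {0..1}} (\<chi> i. x i, t) * u j (\<chi> i. x i, t) \<partial>lborel) \<partial>PiM UNIV (\<lambda>_. lborel))"
      by (intro nn_integral_cong) (auto simp: fiber_def indicator_def)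
    also have "\<dots> = (\<integral>\<^sup>+q. indicator {q. fst q $ j \<in> {0..1}} q * u j q \<partial>lborel)"
      unfolding nn_integral_lborel_pair[OF m2] by (rule nn_integral_lborel_vec[OF fst_meas[OF m2], symmetric])
    finally show ?thesis .
  qed
  have "(\<integral>\<^sup>+p. (\<Prod>j\<in>UNIV. u j (shear j p)) \<partial>lborel) = (\<integral>\<^sup>+x. joint_fiber x \<partial>PiM UNIV (\<lambda>_. lborel))"
    unfolding nn_integral_lborel_pair[OF m1] nn_integral_lborel_vec[OF fst_meas[OF m1]]
    by (simp add: joint_fiber_def shear_def height_def)
  also have "\<dots> = (\<integral>\<^sup>+z. slice_joint z \<partial>PiM rest (\<lambda>_. lborel))"
    unfolding slice_joint_def
    by (rule nn_integral_split_rest) (simp_all add: sigma_finite_lborel measurable_joint_fiber)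
  also have "\<dots> \<le> (\<integral>\<^sup>+z. ?c * (\<Prod>j\<in>UNIV. epowr (slice j z) (pair_weight a j)) \<partial>PiM rest (\<lambda>_. lborel))"
    by (intro nn_integral_mono slice_joint_le)
  also have "\<dots> = ?c * (\<integral>\<^sup>+z. (\<Prod>j\<in>UNIV. epowr (slice j z) (pair_weight a j)) \<partial>PiM rest (\<lambda>_. lborel))"
    using measurable_slice
    by (intro nn_integral_cmult borel_measurable_prod_ennreal epowr_measurable) (simp add: measL)
  also have "\<dots> \<le> ?c * (\<Prod>j\<in>UNIV. epowr (\<integral>\<^sup>+z. slice j z \<partial>PiM rest (coord_measure j)) (pair_weight a j))"
  proof (intro mult_left_mono Finner[where D = "\<lambda>c. UNIV - {c}"])
    show "slice i (x(c := y)) = slice i x" if "c \<in> rest" "i \<in> UNIV - (UNIV - {c})" for c i x y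
      using that slice_indep by auto
    show "emeasure (coord_measure i c) UNIV = 1" if "c \<in> rest" "i \<in> UNIV - (UNIV - {c})" for c i :: "'n + 'n"
      using that by (auto simp: coord_measure_def emeasure_unif)
    show "coord_measure i c = lborel" if "c \<in> rest" "i \<in> UNIV - {c}" for c i
      using that by (auto simp: coord_measure_def)
  qed (auto simp: pair_weight_pos sigma_finite_lborel sigma_finite_coord_measure measurable_slice
      intro: sum_pair_weight)
  finally show ?thesis unfolding bound .
qed

end

section \<open>The Sobolev inequality\<close>

text \<open>For an empty index set the two sides differ at 0, where \<open>epowr 0 0\<close> is 0
  and the empty product is 1.\<close>

lemma epowr_sum:
  assumes "finite S" "S \<noteq> {}"
  shows "epowr x (\<Sum>i\<in>S. w i) = (\<Prod>i\<in>S. epowr x (w i))"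
  using assms by (induction S rule: finite_ne_induct) (simp_all add: epowr_add)

lemma sum_pair_weight_index:
  "(\<Sum>a\<in>UNIV. pair_weight a j) = (real CARD('n) + 1) / (2 * real CARD('n) + 1)"
  for j :: "'n::finite + 'n"
proof -
  define b where "b = (case j of Inl b \<Rightarrow> b | Inr b \<Rightarrow> b)"
  have "(\<Sum>a\<in>UNIV. pair_weight a j) =
      (\<Sum>a\<in>UNIV. ((if a = b then 1 else 0) + 1) / (2 * real CARD('n) + 1))"
    by (intro sum.cong refl) (cases j; auto simp: pair_weight_def b_def)
  also have "\<dots> = (real CARD('n) + 1) / (2 * real CARD('n) + 1)"
    by (simp add: sum.distrib flip: sum_divide_distrib)
  finally show ?thesis .
qed

text \<open>A field has weight 2/(2n+1) for its own pair and 1/(2n+1) for the n-1 others, so the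
  geometric mean gives it exponent (n+1)/(n(2n+1)). Over the 2n fields these add up to
  (2n+2)/(2n+1), as the scaling under Heisenberg dilations demands.\<close>

lemma Heisenberg_Loomis_Whitney:
  fixes u :: "'n::finite + 'n \<Rightarrow> 'n heisenberg \<Rightarrow> ennreal"
  assumes u: "\<And>j. u j \<in> borel_measurable borel" "\<And>j p. u j p \<le> 1"
    "\<And>j q q'. (\<And>i. i \<noteq> j \<Longrightarrow> fst q $ i = fst q' $ i) \<Longrightarrow> snd q = snd q' \<Longrightarrow> u j q = u j q'"
  shows "(\<integral>\<^sup>+p. (\<Prod>j\<in>UNIV. u j (shear j p)) \<partial>lborel) \<le> epowr 64 (1 / (2 * real CARD('n) + 1)) *
    (\<Prod>j\<in>UNIV. epowr (\<integral>\<^sup>+q. indicator {q. fst q $ j \<in> {0..1}} q * u j q \<partial>lborel)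
      ((real CARD('n) + 1) / (real CARD('n) * (2 * real CARD('n) + 1))))"
proof -
  let ?n = "real CARD('n)"
  define K where "K = (\<integral>\<^sup>+p. (\<Prod>j\<in>UNIV. u j (shear j p)) \<partial>lborel)"
  define m where "m j = (\<integral>\<^sup>+q. indicator {q. fst q $ j \<in> {0..1}} q * u j q \<partial>lborel)" for j
  define c where "c = epowr 64 (1 / (2 * ?n + 1))"
  have n: "(\<Sum>a\<in>(UNIV :: 'n set). 1 / ?n) = 1" by simp
  have ne: "(UNIV :: 'n set) \<noteq> {}" by simp
  have split: "x = (\<Prod>a\<in>(UNIV :: 'n set). epowr x (1 / ?n))" for x
    using epowr_sum[OF finite ne, of x "\<lambda>_. 1 / ?n"] unfolding n by simp
  have "K \<le> c * (\<Prod>j\<in>UNIV. epowr (m j) (pair_weight a j))" for a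
    unfolding K_def c_def m_def by (rule Heisenberg_Loomis_Whitney_pair[OF u])
  then have "(\<Prod>a\<in>(UNIV :: 'n set). epowr K (1 / ?n)) \<le>
      (\<Prod>a\<in>UNIV. epowr (c * (\<Prod>j\<in>UNIV. epowr (m j) (pair_weight a j))) (1 / ?n))"
    by (intro prod_mono_ennreal epowr_mono) auto
  also have "\<dots> = (\<Prod>a\<in>(UNIV :: 'n set). epowr c (1 / ?n)) *
      (\<Prod>j\<in>UNIV. \<Prod>a\<in>UNIV. epowr (m j) (pair_weight a j / ?n))"
    by (subst prod.swap) (simp add: epowr_mult epowr_prod epowr_epowr prod.distrib)
  also have "(\<Prod>j\<in>UNIV. \<Prod>a\<in>UNIV. epowr (m j) (pair_weight a j / ?n)) =
      (\<Prod>j\<in>UNIV. epowr (m j) ((?n + 1) / (?n * (2 * ?n + 1))))"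
    by (simp add: sum_pair_weight_index mult.commute flip: epowr_sum sum_divide_distrib)
  finally show ?thesis
    unfolding split[symmetric] unfolding K_def c_def m_def .
qed

lemma nn_integral_layers_le: "(\<integral>\<^sup>+l. indicator {l. 0 < l \<and> ennreal l < x} l \<partial>lborel) \<le> x"
proof (cases x)
  case (real r)
  have "{l. 0 < l \<and> ennreal l < x} = {0<..<r}"
    using real by (auto simp: ennreal_less_iff)
  then show ?thesis using real by simp
qed simp

text \<open>Only the levels between \<open>x / 2\<close> and \<open>x\<close> are used, at the cost of the factor \<open>2\<^sup>p\<close>.\<close>

lemma powr_le_layers:
  assumes "x \<ge> 0" "p \<ge> 1"
  shows "ennreal (x powr p) \<le> ennreal (2 powr p) *
    (\<integral>\<^sup>+l. ennreal (l powr (p - 1)) * indicator {0<..<x} l \<partial>lborel)"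
proof -
  have "ennreal (x powr p) = ennreal (2 powr p) * ennreal ((x / 2) powr (p - 1) * (x / 2))"
  proof (cases "x = 0")
    case False
    then have "(x / 2) powr p = (x / 2) powr (p - 1) * (x / 2)"
      using assms powr_mult_base[of "x / 2" "p - 1"] by (simp add: mult.commute)
    moreover have "x powr p = 2 powr p * (x / 2) powr p"
      using assms powr_mult[of 2 "x / 2" p] by simp
    ultimately show ?thesis using assms by (simp flip: ennreal_mult)
  qed simp
  also have "ennreal ((x / 2) powr (p - 1) * (x / 2)) =
      (\<integral>\<^sup>+l. ennreal ((x / 2) powr (p - 1)) * indicator {x / 2<..<x} l \<partial>lborel)"
  proof -
    have "ennreal ((x / 2) powr (p - 1) * (x / 2)) = ennreal ((x / 2) powr (p - 1)) * ennreal (x / 2)"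
      using assms by (intro ennreal_mult) auto
    then show ?thesis using assms by (simp add: nn_integral_cmult)
  qed
  also have "\<dots> \<le> (\<integral>\<^sup>+l. ennreal (l powr (p - 1)) * indicator {0<..<x} l \<partial>lborel)"
    using assms by (intro nn_integral_mono) (auto simp: indicator_def intro!: ennreal_leI powr_mono2)
  finally show ?thesis by (simp add: mult_left_mono)
qed

text \<open>The level \<open>l\<close> contributes the factor l^(p-1) and the product of the T_j to
  the power p/(2n), where T_j is the size of a superlevel set of F_j. Part (p-1)/(2n) of each
  exponent is paired with l^(p-1) and bounded by Chebyshev's inequality; the remaining exponents
  1/(2n) add up to 1, so Hoelder's inequality in \<open>l\<close> needs only the integrals of the
  T_j.\<close>

lemma BV_nn_integral_bound:
  fixes f :: "'n::finite heisenberg \<Rightarrow> real" and \<nu> :: "'n + 'n \<Rightarrow> 'n heisenberg set \<Rightarrow> real"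
  assumes f: "integrable lborel f" and tv: "\<And>j. total_variation (\<nu> j) < \<infinity>"
    and weak: "\<And>j \<phi>. \<phi> \<in> test_functions \<Longrightarrow>
      (\<integral>p. f p * horizontal j \<phi> p \<partial>lborel) = - signed_integral (\<nu> j) \<phi>"
  defines "p \<equiv> (2 * real CARD('n) + 2) / (2 * real CARD('n) + 1)"
  shows "(\<integral>\<^sup>+x. ennreal (\<bar>f x\<bar> powr p) \<partial>lborel) \<le>
    ennreal (2 powr p * 64 powr (1 / (2 * real CARD('n) + 1))) *
    (\<Prod>j\<in>UNIV. epowr (total_variation (\<nu> j)) (p / (2 * real CARD('n))))"
proof -
  let ?n = "real CARD('n)"
  define c where "c = epowr 64 (1 / (2 * ?n + 1))"
  have n: "?n > 0" by simp
  have p: "p \<ge> 1" unfolding p_def by (simp add: field_simps)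
  define S where "S j = total_variation (\<nu> j)" for j
  define F where "F j = slope j (\<nu> j)" for j
  have F [measurable]: "F j \<in> borel_measurable borel" for j
    unfolding F_def by (rule measurable_slope[OF tv])
  note [measurable] = borel_measurable_integrable[OF f]
  \<comment> \<open>As F_j ignores x_j, the unit range of x_j makes this the measure of a superlevel
    set in the remaining variables.\<close>
  define T where "T j l = (\<integral>\<^sup>+q. indicator {q. fst q $ j \<in> {0..1}} q * indicator {q. ennreal l < F j q} q \<partial>lborel)"
    for j and l :: real
  have T [measurable]: "T j \<in> borel_measurable borel" for j
  proof -
    have "(\<lambda>(l, q). indicator {q. fst q $ j \<in> {0..1}} q * indicator {q. ennreal l < F j q} q :: ennreal) =
      (\<lambda>z. indicator {z. fst (snd z) $ j \<in> {0..1}} z * indicator {z. ennreal (fst z) < F j (snd z)} z)"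
      by (auto simp: indicator_def fun_eq_iff)
    also have "\<dots> \<in> borel_measurable (borel \<Otimes>\<^sub>M lborel)" by measurable
    finally show ?thesis unfolding T_def by (rule lborel.borel_measurable_nn_integral)
  qed
  have ae: "AE x in lborel. \<forall>j. ennreal \<bar>f x\<bar> \<le> F j (shear j x)"
  proof -
    have "AE x in lborel. \<forall>j\<in>UNIV. ennreal \<bar>f x\<bar> \<le> F j (shear j x)"
      unfolding F_def by (intro AE_finite_allI abs_le_slope tv f weak) auto
    then show ?thesis by simp
  qed
  define N where "N l = (\<integral>\<^sup>+x. indicator {x. l < \<bar>f x\<bar>} x \<partial>lborel)" for l :: real
  have N: "N l \<le> c * (\<Prod>j\<in>UNIV. epowr (T j l) (p / (2 * ?n)))" if "l > 0" for l
  proof -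
    have "N l \<le> (\<integral>\<^sup>+x. (\<Prod>j\<in>UNIV. indicator {q. ennreal l < F j q} (shear j x)) \<partial>lborel)"
      unfolding N_def using ae
    proof (intro nn_integral_mono_AE, eventually_elim)
      case (elim x)
      have "ennreal l < F j (shear j x)" if "l < \<bar>f x\<bar>" for j
      proof -
        have "ennreal l < ennreal \<bar>f x\<bar>"
          using that \<open>l > 0\<close> by (simp add: ennreal_less_iff)
        also have "\<dots> \<le> F j (shear j x)" using elim by blast
        finally show ?thesis .
      qed
      then show ?case by (auto simp: indicator_def)
    qed
    also have "\<dots> \<le> c * (\<Prod>j\<in>UNIV. epowr (T j l) ((?n + 1) / (?n * (2 * ?n + 1))))"
      unfolding c_def T_def
    proof (rule Heisenberg_Loomis_Whitney)
      fix j and q q' :: "'n heisenberg"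
      assume "\<And>i. i \<noteq> j \<Longrightarrow> fst q $ i = fst q' $ i" "snd q = snd q'"
      then have "F j q = F j q'" unfolding F_def by (rule slope_cong)
      then show "indicator {q. ennreal l < F j q} q = (indicator {q. ennreal l < F j q} q' :: ennreal)"
        by (simp add: indicator_def)
    qed (auto simp: indicator_def)
    also have "(?n + 1) / (?n * (2 * ?n + 1)) = p / (2 * ?n)"
      unfolding p_def using n by (simp add: divide_simps)
    finally show ?thesis .
  qed
  have Cheb: "ennreal l * T j l \<le> S j" for j l
  proof -
    have "ennreal l * T j l = (\<integral>\<^sup>+q. ennreal l * (indicator {q. fst q $ j \<in> {0..1}} q * indicator {q. ennreal l < F j q} q) \<partial>lborel)"
      unfolding T_def by (rule nn_integral_cmult[symmetric]) measurable
    also have "\<dots> \<le> (\<integral>\<^sup>+q. indicator {q. fst q $ j \<in> {0..1}} q * F j q \<partial>lborel)"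
      by (intro nn_integral_mono) (auto simp: indicator_def)
    also have "\<dots> \<le> S j" unfolding F_def S_def by (rule nn_integral_slope[OF tv])
    finally show ?thesis .
  qed
  \<comment> \<open>Layer-cake formula: for each q the levels below F_j(q) have total length at most
    F_j(q).\<close>
  have T_int: "(\<integral>\<^sup>+l. indicator {0<..} l * T j l \<partial>lborel) \<le> S j" for j
  proof -
    have "(\<integral>\<^sup>+l. indicator {0<..} l * T j l \<partial>lborel) =
        (\<integral>\<^sup>+l. \<integral>\<^sup>+q. indicator {q. fst q $ j \<in> {0..1}} q * indicator {l. 0 < l \<and> ennreal l < F j q} l \<partial>lborel \<partial>lborel)"
      unfolding T_def
      by (intro nn_integral_cong) (auto simp: indicator_def)
    also have "\<dots> = (\<integral>\<^sup>+q. \<integral>\<^sup>+l. indicator {q. fst q $ j \<in> {0..1}} q * indicator {l. 0 < l \<and> ennreal l < F j q} l \<partial>lborel \<partial>lborel)"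
    proof (rule lborel_pair.Fubini')
      have "(\<lambda>(q, l). indicator {q. fst q $ j \<in> {0..1}} q * indicator {l. 0 < l \<and> ennreal l < F j q} l :: ennreal) =
        (\<lambda>z. indicator {z. fst (fst z) $ j \<in> {0..1}} z * indicator {z. 0 < snd z \<and> ennreal (snd z) < F j (fst z)} z)"
        by (auto simp: indicator_def fun_eq_iff)
      also have "\<dots> \<in> borel_measurable (lborel \<Otimes>\<^sub>M lborel)" by measurable
      finally show "(\<lambda>(q, l). indicator {q. fst q $ j \<in> {0..1}} q * indicator {l. 0 < l \<and> ennreal l < F j q} l :: ennreal)
        \<in> borel_measurable (lborel \<Otimes>\<^sub>M lborel)" .
    qed
    also have "\<dots> = (\<integral>\<^sup>+q. indicator {q. fst q $ j \<in> {0..1}} q * (\<integral>\<^sup>+l. indicator {l. 0 < l \<and> ennreal l < F j q} l \<partial>lborel) \<partial>lborel)"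
      by (intro nn_integral_cong nn_integral_cmult) measurable
    also have "\<dots> \<le> (\<integral>\<^sup>+q. indicator {q. fst q $ j \<in> {0..1}} q * F j q \<partial>lborel)"
      by (intro nn_integral_mono mult_left_mono nn_integral_layers_le) simp
    also have "\<dots> \<le> S j" unfolding F_def S_def by (rule nn_integral_slope[OF tv])
    finally show ?thesis .
  qed
  let ?J = "UNIV :: ('n + 'n) set"
  have ne: "?J \<noteq> {}" by simp
  have w: "(\<Sum>j\<in>?J. 1 / (2 * ?n)) = 1" by simp
  have w1: "(\<Sum>j\<in>?J. (p - 1) / (2 * ?n)) = p - 1" by simp
  have bound: "ennreal (l powr (p - 1)) * N l \<le>
      c * (\<Prod>j\<in>?J. epowr (S j) ((p - 1) / (2 * ?n))) * (\<Prod>j\<in>?J. epowr (indicator {0<..} l * T j l) (1 / (2 * ?n)))"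
    if "l > 0" for l
  proof -
    have "ennreal (l powr (p - 1)) = (\<Prod>j\<in>?J. epowr (ennreal l) ((p - 1) / (2 * ?n)))"
      unfolding epowr_sum[OF finite ne, symmetric] w1 using that by (simp add: epowr_ennreal)
    then have "ennreal (l powr (p - 1)) * N l \<le>
        (\<Prod>j\<in>?J. epowr (ennreal l) ((p - 1) / (2 * ?n))) * (c * (\<Prod>j\<in>?J. epowr (T j l) (p / (2 * ?n))))"
      using N[OF that] by (simp add: mult_left_mono)
    also have "\<dots> = c * (\<Prod>j\<in>?J. epowr (ennreal l * T j l) ((p - 1) / (2 * ?n)) * epowr (T j l) (1 / (2 * ?n)))"
    proof -
      \<comment> \<open>The split between the Chebyshev part and the part left for Hoelder's
        inequality.\<close>
      have "p / (2 * ?n) = (p - 1) / (2 * ?n) + 1 / (2 * ?n)"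
        by (simp add: diff_divide_distrib)
      then have "epowr x (p / (2 * ?n)) = epowr x ((p - 1) / (2 * ?n)) * epowr x (1 / (2 * ?n))" for x
        by (simp only: epowr_add)
      then show ?thesis
        by (simp add: epowr_mult prod.distrib ac_simps)
    qed
    also have "\<dots> \<le> c * (\<Prod>j\<in>?J. epowr (S j) ((p - 1) / (2 * ?n)) * epowr (T j l) (1 / (2 * ?n)))"
      using p n by (intro mult_left_mono prod_mono_ennreal mult_right_mono epowr_mono Cheb) auto
    finally show ?thesis using that by (simp add: prod.distrib mult.assoc)
  qed
  have "(\<integral>\<^sup>+x. ennreal (\<bar>f x\<bar> powr p) \<partial>lborel) \<le>
      (\<integral>\<^sup>+x. ennreal (2 powr p) * (\<integral>\<^sup>+l. ennreal (l powr (p - 1)) * indicator {0<..<\<bar>f x\<bar>} l \<partial>lborel) \<partial>lborel)"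
    by (intro nn_integral_mono powr_le_layers p) simp
  also have "\<dots> = ennreal (2 powr p) * (\<integral>\<^sup>+x. \<integral>\<^sup>+l. ennreal (l powr (p - 1)) * indicator {0<..<\<bar>f x\<bar>} l \<partial>lborel \<partial>lborel)"
  proof (rule nn_integral_cmult)
    have "(\<lambda>(x, l). ennreal (l powr (p - 1)) * indicator {0<..<\<bar>f x\<bar>} l) =
      (\<lambda>z. ennreal (snd z powr (p - 1)) * indicator {z. 0 < snd z \<and> snd z < \<bar>f (fst z)\<bar>} z)"
      by (auto simp: indicator_def fun_eq_iff)
    also have "\<dots> \<in> borel_measurable (lborel \<Otimes>\<^sub>M lborel)" by measurable
    finally show "(\<lambda>x. \<integral>\<^sup>+l. ennreal (l powr (p - 1)) * indicator {0<..<\<bar>f x\<bar>} l \<partial>lborel) \<in> borel_measurable lborel"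
      by (rule lborel.borel_measurable_nn_integral)
  qed
  also have "(\<integral>\<^sup>+x. \<integral>\<^sup>+l. ennreal (l powr (p - 1)) * indicator {0<..<\<bar>f x\<bar>} l \<partial>lborel \<partial>lborel) =
      (\<integral>\<^sup>+l. \<integral>\<^sup>+x. ennreal (l powr (p - 1)) * indicator {0<..<\<bar>f x\<bar>} l \<partial>lborel \<partial>lborel)"
  proof (rule lborel_pair.Fubini')
    have "(\<lambda>(l, x). ennreal (l powr (p - 1)) * indicator {0<..<\<bar>f x\<bar>} l) =
      (\<lambda>z. ennreal (fst z powr (p - 1)) * indicator {z. 0 < fst z \<and> fst z < \<bar>f (snd z)\<bar>} z)"
      by (auto simp: indicator_def fun_eq_iff)
    also have "\<dots> \<in> borel_measurable (lborel \<Otimes>\<^sub>M lborel)" by measurable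
    finally show "(\<lambda>(l, x). ennreal (l powr (p - 1)) * indicator {0<..<\<bar>f x\<bar>} l) \<in> borel_measurable (lborel \<Otimes>\<^sub>M lborel)" .
  qed
  also have "\<dots> \<le> (\<integral>\<^sup>+l. c * (\<Prod>j\<in>?J. epowr (S j) ((p - 1) / (2 * ?n))) *
      (\<Prod>j\<in>?J. epowr (indicator {0<..} l * T j l) (1 / (2 * ?n))) \<partial>lborel)"
  proof (rule nn_integral_mono)
    fix l :: real
    have "(\<integral>\<^sup>+x. ennreal (l powr (p - 1)) * indicator {0<..<\<bar>f x\<bar>} l \<partial>lborel) =
        (\<integral>\<^sup>+x. indicator {0<..} l * ennreal (l powr (p - 1)) * indicator {x. l < \<bar>f x\<bar>} x \<partial>lborel)"
      by (intro nn_integral_cong) (auto simp: indicator_def)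
    also have "\<dots> = indicator {0<..} l * ennreal (l powr (p - 1)) * N l"
      unfolding N_def by (rule nn_integral_cmult) measurable
    also have "\<dots> \<le> c * (\<Prod>j\<in>?J. epowr (S j) ((p - 1) / (2 * ?n))) *
      (\<Prod>j\<in>?J. epowr (indicator {0<..} l * T j l) (1 / (2 * ?n)))"
      using bound[of l] by (cases "l > 0") auto
    finally show "(\<integral>\<^sup>+x. ennreal (l powr (p - 1)) * indicator {0<..<\<bar>f x\<bar>} l \<partial>lborel) \<le>
      c * (\<Prod>j\<in>?J. epowr (S j) ((p - 1) / (2 * ?n))) *
      (\<Prod>j\<in>?J. epowr (indicator {0<..} l * T j l) (1 / (2 * ?n)))" .
  qed
  also have "\<dots> = c * (\<Prod>j\<in>?J. epowr (S j) ((p - 1) / (2 * ?n))) *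
      (\<integral>\<^sup>+l. (\<Prod>j\<in>?J. epowr (indicator {0<..} l * T j l) (1 / (2 * ?n))) \<partial>lborel)"
    by (rule nn_integral_cmult) measurable
  also have "\<dots> \<le> c * (\<Prod>j\<in>?J. epowr (S j) ((p - 1) / (2 * ?n))) * (\<Prod>j\<in>?J. epowr (S j) (1 / (2 * ?n)))"
  proof (rule mult_left_mono)
    have "(\<integral>\<^sup>+l. (\<Prod>j\<in>?J. epowr (indicator {0<..} l * T j l) (1 / (2 * ?n))) \<partial>lborel) \<le>
        (\<Prod>j\<in>?J. epowr (\<integral>\<^sup>+l. indicator {0<..} l * T j l \<partial>lborel) (1 / (2 * ?n)))"
      using n by (intro nn_integral_Holder w) auto
    also have "\<dots> \<le> (\<Prod>j\<in>?J. epowr (S j) (1 / (2 * ?n)))"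
      by (intro prod_mono_ennreal epowr_mono T_int) auto
    finally show "(\<integral>\<^sup>+l. (\<Prod>j\<in>?J. epowr (indicator {0<..} l * T j l) (1 / (2 * ?n))) \<partial>lborel) \<le>
        (\<Prod>j\<in>?J. epowr (S j) (1 / (2 * ?n)))" .
  qed simp
  also have "\<dots> = c * (\<Prod>j\<in>?J. epowr (S j) (p / (2 * ?n)))"
    by (simp add: mult.assoc diff_divide_distrib flip: prod.distrib epowr_add)
  finally show ?thesis
    unfolding S_def c_def using epowr_ennreal[of 64 "1 / (2 * ?n + 1)"]
    by (simp add: ennreal_mult mult.assoc mult_left_mono)
qed

theorem theorem1p13:
  shows "\<exists>C::real. 0 < C \<and>
    (\<forall>f \<in> (BV :: ('n::finite heisenberg \<Rightarrow> real) set).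
      \<forall>\<nu>. (\<forall>j. has_horizontal_measure f j (\<nu> j)) \<longrightarrow>
        lebesgue_norm ((2 * real CARD('n) + 2) / (2 * real CARD('n) + 1)) f
          \<le> ennreal (C * (\<Prod>j\<in>UNIV. enn2real (total_variation (\<nu> j)) powr (1 / (2 * real CARD('n))))))"
proof -
  define p where "p = (2 * real CARD('n) + 2) / (2 * real CARD('n) + 1)"
  \<comment> \<open>The factor 2^p comes from using only the upper half of the levels, the power of
    64 from the planar incidence bound; both depend on n alone.\<close>
  define A where "A = 2 powr p * 64 powr (1 / (2 * real CARD('n) + 1))"
  have p: "p > 0" unfolding p_def by (intro divide_pos_pos) (auto simp: add_pos_pos)
  have A: "A > 0" by (simp add: A_def)
  show ?thesis unfolding p_def[symmetric]
  proof (intro exI[of _ "A powr (1 / p)"] conjI ballI allI impI)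
    show "0 < A powr (1 / p)" using A by simp
    fix f :: "'n heisenberg \<Rightarrow> real" and \<nu>
    assume f: "f \<in> BV" and \<nu>: "\<forall>j. has_horizontal_measure f j (\<nu> j)"
    have int: "integrable lebesgue f" using f by (simp add: BV_def)
    have fm: "f \<in> borel_measurable lebesgue" by (rule borel_measurable_integrable[OF int])
    \<comment> \<open>A Borel representative; the norm of \<open>f\<close> and its weak derivatives
      see only the almost-everywhere class.\<close>
    obtain g where g: "g \<in> borel_measurable lborel" "AE x in lborel. f x = g x"
      using completion_ex_borel_measurable_real[OF fm] by blast
    have ae: "AE x in lebesgue. f x = g x" by (rule AE_completion[OF g(2)])
    have gm: "g \<in> borel_measurable lebesgue" by (rule measurable_completion[OF g(1)])
    have "integrable lebesgue g"
      using integrable_cong_AE[OF fm gm ae] int by simp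
    then have gint: "integrable lborel g" using integrable_completion[OF g(1)] by simp
    have tv: "total_variation (\<nu> j) < \<infinity>" for j
      using \<nu> by (simp add: has_horizontal_measure_def)
    define s where "s j = enn2real (total_variation (\<nu> j))" for j
    have s: "total_variation (\<nu> j) = ennreal (s j)" "s j \<ge> 0" for j
      using tv[of j] by (simp_all add: s_def)
    define P where "P = (\<Prod>j\<in>UNIV. s j powr (1 / (2 * real CARD('n))))"
    have P: "P \<ge> 0" by (simp add: P_def prod_nonneg)
    define I where "I = (\<integral>\<^sup>+x. ennreal (\<bar>f x\<bar> powr p) \<partial>lebesgue)"
    have "I = (\<integral>\<^sup>+x. ennreal (\<bar>g x\<bar> powr p) \<partial>lebesgue)"
      unfolding I_def
    proof (rule nn_integral_cong_AE)
      show "AE x in lebesgue. ennreal (\<bar>f x\<bar> powr p) = ennreal (\<bar>g x\<bar> powr p)"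
        using ae by eventually_elim simp
    qed
    also have "\<dots> = (\<integral>\<^sup>+x. ennreal (\<bar>g x\<bar> powr p) \<partial>lborel)"
      by (rule nn_integral_completion)
    also have "\<dots> \<le> ennreal A * (\<Prod>j\<in>UNIV. epowr (total_variation (\<nu> j)) (p / (2 * real CARD('n))))"
      unfolding A_def p_def using g \<nu> fm
      by (intro BV_nn_integral_bound gint tv has_horizontal_measure_cong_AE) auto
    also have "\<dots> = ennreal (A * (\<Prod>j\<in>UNIV. s j powr (p / (2 * real CARD('n)))))"
      using A by (simp add: s epowr_ennreal prod_ennreal ennreal_mult prod_nonneg)
    also have "(\<Prod>j\<in>UNIV. s j powr (p / (2 * real CARD('n)))) = P powr p"
      unfolding P_def by (simp add: powr_powr flip: prod_powr_distrib)
    finally have le: "I \<le> ennreal (A * P powr p)" .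
    then have fin: "I \<noteq> \<infinity>" by (auto simp: top_unique)
    have "enn2real I \<le> A * P powr p"
      using le A by (intro enn2real_leI) auto
    \<comment> \<open>Taking the p-th root turns the exponents p/(2n) into 1/(2n) and the constant
      \<open>A\<close> into its p-th root.\<close>
    then have "enn2real I powr (1 / p) \<le> (A * P powr p) powr (1 / p)"
      using p by (intro powr_mono2) auto
    also have "\<dots> = A powr (1 / p) * P"
      using A P p by (simp add: powr_mult powr_powr)
    finally have "ennreal (enn2real I powr (1 / p)) \<le> ennreal (A powr (1 / p) * P)"
      by (rule ennreal_leI)
    then show "lebesgue_norm p f \<le> ennreal (A powr (1 / p) *
        (\<Prod>j\<in>UNIV. enn2real (total_variation (\<nu> j)) powr (1 / (2 * real CARD('n)))))"
      using fin unfolding lebesgue_norm_def I_def[symmetric] P_def s_def by (simp add: Let_def)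
  qed
qed

end
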